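(* Let $m\in\mathbb N$, let $\Psi_1,\ldots,\Psi_m$ be bounded sets of nonnegative matrices that define operators on $l^2(R)$, let $\alpha\ge\frac1m$ and $r\in\{\rho,\hat\rho\}$. Below, indices of $\Psi$ are read cyclically modulo $m$ (in $\{1,\ldots,m\}$). If $m$ is even, put $P_j=\Psi_j^*\Psi_{j+1}\Psi_{j+2}^*\Psi_{j+3}\cdots\Psi_{j+m-2}^*\Psi_{j+m-1}$ for $j=1,\ldots,m$ (a product of $m$ factors, stars on every second factor starting with the first) and $\Sigma_\alpha=P_1^{(\alpha)}\circ P_2^{(\alpha)}\circ\cdots\circ P_m^{(\alpha)}$. Then $$\big\|\Psi_1^{(\alpha)}\circ\cdots\circ\Psi_m^{(\alpha)}\big\|\le r(\Sigma_\alpha)^{\frac1m}\le\big(r(\Psi_1^*\Psi_2\Psi_3^*\Psi_4\cdots\Psi_{m-1}^*\Psi_m)\,r(\Psi_m\Psi_{m-1}^*\cdots\Psi_4\Psi_3^*\Psi_2\Psi_1^* )\big)^{\frac\alpha2}.$$ If $m$ is odd, put $Q_j=\Psi_j^*\Psi_{j+1}\Psi_{j+2}^*\Psi_{j+3}\cdots\Psi_{j+2m-2}^*\Psi_{j+2m-1}$ for $j=1,\ldots,m$ (a product of $2m$ factors, stars on every second factor starting with the first) and $\Omega_\alpha=Q_1^{(\alpha)}\circ Q_2^{(\alpha)}\circ\cdots\circ Q_m^{(\alpha)}$. Then $$\big\|\Psi_1^{(\alpha)}\circ\cdots\circ\Psi_m^{(\alpha)}\big\|\le r(\Omega_\alpha)^{\frac1{2m}}\le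 r\big(\Psi_1\Psi_2^*\Psi_3\Psi_4^*\cdots\Psi_{m-2}\Psi_{m-1}^*\Psi_m\Psi_1^*\Psi_2\cdots\Psi_{m-1}\Psi_m^*\big)^{\frac\alpha2},$$ where the last product consists of $2m$ factors with indices $1,\ldots,m,1,\ldots,m$, with stars on every second factor starting with the second.
   Context: $R$ is $\mathbb N$ or $\{1,\ldots,N\}$ for some $N\in\mathbb N$, and $l^2(R)$ is the complex Hilbert space. A matrix $A=[a_{ij}]_{i,j\in R}$ is nonnegative if all $a_{ij}\ge0$; it defines an operator on $l^2(R)$ if $Ax\in l^2(R)$ for all $x\in l^2(R)$, where $(Ax)_i=\sum_j a_{ij}x_j$ (the operator is then positive and bounded). Matrices are identified with the operators they define; "bounded set" means bounded in operator norm. For nonnegative matrices $A_j=[a^{(j)}_{ik}]$ and positive $\alpha_j$, $A_1^{(\alpha_1)}\circ\cdots\circ A_m^{(\alpha_m)}$ is the matrix with entries $\prod_j (a^{(j)}_{ik})^{\alpha_j}$ (if $\sum_j\alpha_j\ge1$ and the $A_j$ define operators on $l^2(R)$, it defines an operator on $l^2(R)$). For bounded sets: $\Psi_1\cdots\Psi_k=\{A_1\cdots A_k: A_i\in\Psi_i\}$, $\Sigma^k=\{A_1\cdots A_k:A_i\in\Sigma\}$, $\Psi^*=\{A^*:A\in\Psi\}$ ($A^*$ the adjoint), $\|\Psi\|=\sup_{A\in\Psi}\|A\|$, and $\Psi_1^{(\alpha_1)}\circ\cdots\circ\Psi_m^{(\alpha_m)}=\{A_1^{(\alpha_1)}\circ\cdots\circ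 A_m^{(\alpha_m)}:A_j\in\Psi_j\}$ (elements chosen independently from each factor). With $\rho(A)$ the spectral radius of an operator, for a bounded set $\Sigma$ of bounded operators: $\rho(\Sigma)=\limsup_{k\to\infty}[\sup_{A\in\Sigma^k}\rho(A)]^{1/k}$ and $\hat\rho(\Sigma)=\lim_{k\to\infty}[\sup_{A\in\Sigma^k}\|A\|]^{1/k}$. *)

theory Defs
  imports "HOL-Analysis.Analysis"
begin

section \<open>The complex Hilbert space over an index set\<close>

text \<open>Vectors over \<open>R\<close> are functions on \<open>nat\<close> that vanish outside \<open>R\<close>, so that equality of
  vectors is equality of functions.\<close>

definition l2 :: "nat set \<Rightarrow> (nat \<Rightarrow> complex) set" where
  "l2 R = {x. (\<forall>i. i \<notin> R \<longrightarrow> x i = 0) \<and> (\<lambda>i. (cmod (x i))\<^sup>2) summable_on R}"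

definition l2_norm :: "nat set \<Rightarrow> (nat \<Rightarrow> complex) \<Rightarrow> real" where
  "l2_norm R x = sqrt (\<Sum>\<^sub>\<infinity>i\<in>R. (cmod (x i))\<^sup>2)"

definition l2_inner :: "nat set \<Rightarrow> (nat \<Rightarrow> complex) \<Rightarrow> (nat \<Rightarrow> complex) \<Rightarrow> complex" where
  "l2_inner R x y = (\<Sum>\<^sub>\<infinity>i\<in>R. x i * cnj (y i))"

definition bounded_operator :: "nat set \<Rightarrow> ((nat \<Rightarrow> complex) \<Rightarrow> nat \<Rightarrow> complex) \<Rightarrow> bool" where
  "bounded_operator R T \<longleftrightarrow>
     T ` l2 R \<subseteq> l2 R \<and>
     (\<forall>x\<in>l2 R. \<forall>y\<in>l2 R. T (\<lambda>i. x i + y i) = (\<lambda>i. T x i + T y i)) \<and>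
     (\<forall>c. \<forall>x\<in>l2 R. T (\<lambda>i. c * x i) = (\<lambda>i. c * T x i)) \<and>
     (\<exists>K. \<forall>x\<in>l2 R. l2_norm R (T x) \<le> K * l2_norm R x)"

text \<open>As for \<^const>\<open>onorm\<close>, the quotient at \<open>x = 0\<close> is \<open>0 / 0 = 0\<close>.\<close>

definition operator_norm :: "nat set \<Rightarrow> ((nat \<Rightarrow> complex) \<Rightarrow> nat \<Rightarrow> complex) \<Rightarrow> real" where
  "operator_norm R T = (SUP x\<in>l2 R. l2_norm R (T x) / l2_norm R x)"

definition spectrum :: "nat set \<Rightarrow> ((nat \<Rightarrow> complex) \<Rightarrow> nat \<Rightarrow> complex) \<Rightarrow> complex set" where
  "spectrum R T = {z. \<not> (\<exists>S. bounded_operator R S \<and>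
     (\<forall>x\<in>l2 R. S (\<lambda>i. z * x i - T x i) = x \<and> (\<lambda>i. z * S x i - T (S x) i) = x))}"

definition spectral_radius :: "nat set \<Rightarrow> ((nat \<Rightarrow> complex) \<Rightarrow> nat \<Rightarrow> complex) \<Rightarrow> real" where
  "spectral_radius R T = (SUP z\<in>spectrum R T. cmod z)"


section \<open>Nonnegative matrices and the operators they define\<close>

text \<open>Only the entries with both indices in \<open>R\<close> are meaningful.\<close>

type_synonym matrix = "nat \<Rightarrow> nat \<Rightarrow> real"

definition nonneg_matrix :: "nat set \<Rightarrow> matrix \<Rightarrow> bool" where
  "nonneg_matrix R A \<longleftrightarrow> (\<forall>i\<in>R. \<forall>j\<in>R. A i j \<ge> 0)"

definition matrix_op :: "nat set \<Rightarrow> matrix \<Rightarrow> (nat \<Rightarrow> complex) \<Rightarrow> nat \<Rightarrow> complex" where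
  "matrix_op R A x = (\<lambda>i. if i \<in> R then (\<Sum>\<^sub>\<infinity>j\<in>R. of_real (A i j) * x j) else 0)"

text \<open>\<^const>\<open>infsum\<close> is \<open>0\<close> when the series does not converge, so convergence is demanded
  separately.\<close>

definition defines_operator :: "nat set \<Rightarrow> matrix \<Rightarrow> bool" where
  "defines_operator R A \<longleftrightarrow>
     (\<forall>x\<in>l2 R. (\<forall>i\<in>R. (\<lambda>j. complex_of_real (A i j) * x j) summable_on R) \<and>
        matrix_op R A x \<in> l2 R)"

definition mat_norm :: "nat set \<Rightarrow> matrix \<Rightarrow> real" where
  "mat_norm R A = operator_norm R (matrix_op R A)"

definition mat_rho :: "nat set \<Rightarrow> matrix \<Rightarrow> real" where
  "mat_rho R A = spectral_radius R (matrix_op R A)"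

definition mat_mult :: "nat set \<Rightarrow> matrix \<Rightarrow> matrix \<Rightarrow> matrix" where
  "mat_mult R A B = (\<lambda>i k. \<Sum>\<^sub>\<infinity>j\<in>R. A i j * B j k)"

definition mat_one :: matrix where
  "mat_one = (\<lambda>i j. if i = j then 1 else 0)"

definition mat_prod :: "nat set \<Rightarrow> matrix list \<Rightarrow> matrix" where
  "mat_prod R As = foldr (mat_mult R) As mat_one"

text \<open>The conjugate transpose; the entries are real. See \<open>l2_inner_mat_adjoint\<close> below.\<close>

definition mat_adjoint :: "matrix \<Rightarrow> matrix" where
  "mat_adjoint A = (\<lambda>i j. A j i)"


section \<open>Sets of matrices\<close>

definition bounded_matrices :: "nat set \<Rightarrow> matrix set \<Rightarrow> bool" where
  "bounded_matrices R \<Psi> \<longleftrightarrow> bdd_above (mat_norm R ` \<Psi>)"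

definition set_adjoint :: "matrix set \<Rightarrow> matrix set" where
  "set_adjoint \<Psi> = mat_adjoint ` \<Psi>"

definition set_prod :: "nat set \<Rightarrow> matrix set list \<Rightarrow> matrix set" where
  "set_prod R \<Psi>s = mat_prod R ` listset \<Psi>s"

definition set_power :: "nat set \<Rightarrow> matrix set \<Rightarrow> nat \<Rightarrow> matrix set" where
  "set_power R \<Sigma> k = set_prod R (replicate k \<Sigma>)"

definition set_hadamard :: "nat \<Rightarrow> (nat \<Rightarrow> real) \<Rightarrow> (nat \<Rightarrow> matrix set) \<Rightarrow> matrix set" where
  "set_hadamard m \<alpha> \<Psi> =
     {(\<lambda>i k. \<Prod>j=1..m. A j i k powr \<alpha> j) | A. \<forall>j\<in>{1..m}. A j \<in> \<Psi> j}"

text \<open>Supremum of a set of nonnegative reals, with value \<open>0\<close> for the empty set (which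
  \<^const>\<open>Sup\<close> on the reals leaves unspecified).\<close>

definition nonneg_Sup :: "real set \<Rightarrow> real" where
  "nonneg_Sup X = Sup (insert 0 X)"

definition set_norm :: "nat set \<Rightarrow> matrix set \<Rightarrow> real" where
  "set_norm R \<Sigma> = nonneg_Sup (mat_norm R ` \<Sigma>)"

text \<open>The generalized spectral radius \<open>\<rho>\<close> and the joint spectral radius of a set. On the reals,
  \<^const>\<open>limsup\<close> is only available through the extended reals.\<close>

definition gen_spectral_radius :: "nat set \<Rightarrow> matrix set \<Rightarrow> real" where
  "gen_spectral_radius R \<Sigma> = real_of_ereal
     (limsup (\<lambda>k. ereal (root k (nonneg_Sup (mat_rho R ` set_power R \<Sigma> k)))))"

definition joint_spectral_radius :: "nat set \<Rightarrow> matrix set \<Rightarrow> real" where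
  "joint_spectral_radius R \<Sigma> = lim (\<lambda>k. root k (set_norm R (set_power R \<Sigma> k)))"


section \<open>Alternating products with cyclic indices\<close>

definition cyclic_index :: "nat \<Rightarrow> nat \<Rightarrow> nat" where
  "cyclic_index m j = Suc ((j - 1) mod m)"

text \<open>\<open>alternating star idx \<Psi> n\<close> lists the \<open>n\<close> factors with indices \<open>idx 0, \<dots>, idx (n - 1)\<close>,
  the factor at position \<open>i\<close> being starred if \<open>star i\<close>; positions are counted from \<open>0\<close>, so
  \<open>star = even\<close> begins with a star and \<open>star = odd\<close> without.\<close>

definition alternating ::
    "(nat \<Rightarrow> bool) \<Rightarrow> (nat \<Rightarrow> nat) \<Rightarrow> (nat \<Rightarrow> matrix set) \<Rightarrow> nat \<Rightarrow> matrix set list" where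
  "alternating star idx \<Psi> n =
     map (\<lambda>i. if star i then set_adjoint (\<Psi> (idx i)) else \<Psi> (idx i)) [0..<n]"


section \<open>Agreement of the matrix operations with the operator operations\<close>

lemma defines_operator_abs_summable:
  assumes "nonneg_matrix R A" "defines_operator R A" "x \<in> l2 R" "i \<in> R"
  shows "(\<lambda>j. norm (complex_of_real (A i j) * x j)) summable_on R"
    and "cmod (matrix_op R A (\<lambda>j. of_real (cmod (x j))) i) = (\<Sum>\<^sub>\<infinity>j\<in>R. A i j * cmod (x j))"
    and "matrix_op R A (\<lambda>j. of_real (cmod (x j))) \<in> l2 R"
proof -
  define y where "y = (\<lambda>j. complex_of_real (cmod (x j)))"
  have y: "y \<in> l2 R" using assms(3) by (auto simp: l2_def y_def)
  have eq: "(\<lambda>j. complex_of_real (A i j) * y j) = (\<lambda>j. complex_of_real (A i j * cmod (x j)))"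
    by (auto simp: y_def)
  have *: "(\<lambda>j. complex_of_real (A i j * cmod (x j))) summable_on R"
    using assms(2,4) y unfolding defines_operator_def eq[symmetric] by blast
  have s: "(\<lambda>j. A i j * cmod (x j)) summable_on R"
    using summable_on_Re[OF *] by simp
  show "(\<lambda>j. norm (complex_of_real (A i j) * x j)) summable_on R"
    using s assms(1,4)
    by (subst summable_on_cong[where g = "\<lambda>j. A i j * cmod (x j)"])
      (auto simp: norm_mult nonneg_matrix_def)
  have h: "((\<lambda>j. complex_of_real (A i j * cmod (x j))) has_sum
      complex_of_real (\<Sum>\<^sub>\<infinity>j\<in>R. A i j * cmod (x j))) R"
    using has_sum_infsum[OF s] by (rule has_sum_of_real)
  have "(\<Sum>\<^sub>\<infinity>j\<in>R. A i j * cmod (x j)) \<ge> 0"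
    using assms(1,4) by (intro infsum_nonneg) (auto simp: nonneg_matrix_def)
  then show "cmod (matrix_op R A (\<lambda>j. of_real (cmod (x j))) i) = (\<Sum>\<^sub>\<infinity>j\<in>R. A i j * cmod (x j))"
    using assms(4) infsumI[OF h] unfolding matrix_op_def y_def[symmetric] eq by simp
  show "matrix_op R A (\<lambda>j. of_real (cmod (x j))) \<in> l2 R"
    using assms(2) y unfolding defines_operator_def y_def by blast
qed

lemma matrix_op_mat_mult:
  assumes "nonneg_matrix R A" "defines_operator R A"
    and "nonneg_matrix R B" "defines_operator R B" and "x \<in> l2 R"
  shows "matrix_op R (mat_mult R A B) x = matrix_op R A (matrix_op R B x)"
proof
  fix i
  show "matrix_op R (mat_mult R A B) x i = matrix_op R A (matrix_op R B x) i"
  proof (cases "i \<in> R")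
    case True
    define f where "f = (\<lambda>j k. complex_of_real (A i j) * (complex_of_real (B j k) * x k))"
    define z where "z = matrix_op R B (\<lambda>j. of_real (cmod (x j)))"
    have inner: "(\<lambda>k. norm (f j k)) summable_on R" if "j \<in> R" for j
      unfolding f_def using defines_operator_abs_summable(1)[OF assms(3,4,5) that]
      by (simp add: norm_mult summable_on_cmult_right)
    have infs: "(\<Sum>\<^sub>\<infinity>k\<in>R. norm (f j k)) = cmod (complex_of_real (A i j) * z j)" if "j \<in> R" for j
    proof -
      have "(\<Sum>\<^sub>\<infinity>k\<in>R. norm (f j k)) = (\<Sum>\<^sub>\<infinity>k\<in>R. \<bar>A i j\<bar> * (B j k * cmod (x k)))"
        using assms(3) that
        by (intro infsum_cong) (auto simp: f_def norm_mult nonneg_matrix_def)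
      also have "\<dots> = \<bar>A i j\<bar> * (\<Sum>\<^sub>\<infinity>k\<in>R. B j k * cmod (x k))"
        by (rule infsum_cmult_right')
      also have "\<dots> = cmod (complex_of_real (A i j) * z j)"
        using defines_operator_abs_summable(2)[OF assms(3,4,5) that] by (simp add: norm_mult z_def)
      finally show ?thesis .
    qed
    have z: "z \<in> l2 R"
      unfolding z_def by (rule defines_operator_abs_summable(3)[OF assms(3,4,5) True])
    have outer: "(\<lambda>j. cmod (complex_of_real (A i j) * z j)) summable_on R"
      using defines_operator_abs_summable(1)[OF assms(1,2) z True] .
    have infs': "(\<lambda>j. norm (\<Sum>\<^sub>\<infinity>k\<in>R. norm (f j k))) summable_on R"
      by (rule summable_on_cong[THEN iffD1, OF _ outer]) (simp add: infs)
    have "(\<lambda>p. norm ((\<lambda>(j, k). f j k) p)) summable_on R \<times> R"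
      unfolding Infinite_Sum.abs_summable_on_Sigma_iff using inner infs' by simp
    then have "(\<lambda>(j, k). f j k) summable_on R \<times> R"
      by (rule Infinite_Sum.abs_summable_summable)
    then have swap: "(\<Sum>\<^sub>\<infinity>j\<in>R. \<Sum>\<^sub>\<infinity>k\<in>R. f j k) = (\<Sum>\<^sub>\<infinity>k\<in>R. \<Sum>\<^sub>\<infinity>j\<in>R. f j k)"
      by (rule infsum_swap_banach)
    have "(\<Sum>\<^sub>\<infinity>j\<in>R. f j k) = of_real (mat_mult R A B i k) * x k" for k
    proof -
      have "(\<Sum>\<^sub>\<infinity>j\<in>R. f j k) = (\<Sum>\<^sub>\<infinity>j\<in>R. of_real (A i j * B j k)) * x k"
        unfolding infsum_cmult_left'[symmetric] by (simp add: f_def mult.assoc)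
      also have "(\<Sum>\<^sub>\<infinity>j\<in>R. complex_of_real (A i j * B j k)) = of_real (mat_mult R A B i k)"
      proof (cases "(\<lambda>j. A i j * B j k) summable_on R")
        case True
        then show ?thesis
          unfolding mat_mult_def by (intro infsumI has_sum_of_real has_sum_infsum)
      next
        case False
        then have "\<not> (\<lambda>j. complex_of_real (A i j * B j k)) summable_on R"
          using summable_on_Re[of "\<lambda>j. complex_of_real (A i j * B j k)" R] by auto
        with False show ?thesis
          by (simp add: mat_mult_def infsum_not_exists del: of_real_mult)
      qed
      finally show ?thesis .
    qed
    moreover have "(\<Sum>\<^sub>\<infinity>k\<in>R. f j k) = of_real (A i j) * matrix_op R B x j" if "j \<in> R" for j
      unfolding f_def infsum_cmult_right' using that by (simp add: matrix_op_def)
    ultimately show ?thesis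
      using True swap unfolding matrix_op_def[of R A] matrix_op_def[of R "mat_mult R A B"]
      by (simp cong: infsum_cong)
  qed (simp add: matrix_op_def)
qed

lemma l2_inner_mat_adjoint:
  assumes "nonneg_matrix R A" "defines_operator R A" and x: "x \<in> l2 R" and y: "y \<in> l2 R"
  shows "l2_inner R (matrix_op R A x) y = l2_inner R x (matrix_op R (mat_adjoint A) y)"
proof -
  define f where "f = (\<lambda>i j. complex_of_real (A i j) * x j * cnj (y i))"
  define z where "z = matrix_op R A (\<lambda>j. of_real (cmod (x j)))"
  have inner: "(\<lambda>j. norm (f i j)) summable_on R" if "i \<in> R" for i
    unfolding f_def using defines_operator_abs_summable(1)[OF assms(1-3) that]
    by (simp add: norm_mult summable_on_cmult_left)
  have infs: "(\<Sum>\<^sub>\<infinity>j\<in>R. norm (f i j)) = norm (z i * y i)" if "i \<in> R" for i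
  proof -
    have "(\<Sum>\<^sub>\<infinity>j\<in>R. norm (f i j)) = (\<Sum>\<^sub>\<infinity>j\<in>R. A i j * cmod (x j) * cmod (y i))"
      using assms(1) that by (intro infsum_cong) (auto simp: f_def norm_mult nonneg_matrix_def)
    also have "\<dots> = (\<Sum>\<^sub>\<infinity>j\<in>R. A i j * cmod (x j)) * cmod (y i)"
      by (rule infsum_cmult_left')
    finally show ?thesis
      using defines_operator_abs_summable(2)[OF assms(1-3) that] by (simp add: norm_mult z_def)
  qed
  have outer: "(\<lambda>i. norm (z i * y i)) summable_on R"
  proof (cases "R = {}")
    case False
    then have "z \<in> l2 R"
      unfolding z_def using defines_operator_abs_summable(3)[OF assms(1-3)] by blast
    then show ?thesis
      using y by (intro Infinite_Sum.abs_summable_product[of z R y])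
        (simp_all add: l2_def norm_mult power2_eq_square)
  qed auto
  have infs': "(\<lambda>i. norm (\<Sum>\<^sub>\<infinity>j\<in>R. norm (f i j))) summable_on R"
    by (rule summable_on_cong[THEN iffD1, OF _ outer]) (simp add: infs)
  have "(\<lambda>p. norm ((\<lambda>(i, j). f i j) p)) summable_on R \<times> R"
    unfolding Infinite_Sum.abs_summable_on_Sigma_iff using inner infs' by simp
  then have "(\<lambda>(i, j). f i j) summable_on R \<times> R"
    by (rule Infinite_Sum.abs_summable_summable)
  then have swap: "(\<Sum>\<^sub>\<infinity>i\<in>R. \<Sum>\<^sub>\<infinity>j\<in>R. f i j) = (\<Sum>\<^sub>\<infinity>j\<in>R. \<Sum>\<^sub>\<infinity>i\<in>R. f i j)"
    by (rule infsum_swap_banach)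
  have "l2_inner R (matrix_op R A x) y = (\<Sum>\<^sub>\<infinity>i\<in>R. \<Sum>\<^sub>\<infinity>j\<in>R. f i j)"
    unfolding l2_inner_def f_def infsum_cmult_left'
    by (rule infsum_cong) (simp add: matrix_op_def)
  also have "\<dots> = l2_inner R x (matrix_op R (mat_adjoint A) y)"
    unfolding swap l2_inner_def
  proof (rule infsum_cong)
    fix j assume "j \<in> R"
    have "(\<Sum>\<^sub>\<infinity>i\<in>R. f i j) = (\<Sum>\<^sub>\<infinity>i\<in>R. x j * cnj (of_real (A i j) * y i))"
      by (rule infsum_cong) (simp add: f_def mult_ac)
    also have "\<dots> = x j * cnj (\<Sum>\<^sub>\<infinity>i\<in>R. of_real (A i j) * y i)"
      unfolding infsum_cmult_right' infsum_cnj ..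
    finally show "(\<Sum>\<^sub>\<infinity>i\<in>R. f i j) = x j * cnj (matrix_op R (mat_adjoint A) y j)"
      using \<open>j \<in> R\<close> by (simp add: matrix_op_def mat_adjoint_def)
  qed
  finally show ?thesis .
qed

end

theory Submission
  imports Defs
begin

text \<open>For a nonnegative matrix, defining an operator, its norm, products, adjoints and Hadamard products
  are all controlled by the finite sections of its quadratic form, so that only
  finite sums of nonnegative numbers have to be estimated; Hoelder's inequality for finite sums
  shows that a product of Hadamard products is dominated by the Hadamard product of
  the products, and that norms are submultiplicative under Hadamard products of powers.

  Gelfand's formula holds because the growth rate of the powers of a positive operator lies in its
  spectrum. It transfers monotonicity, invariance under cyclic permutation and adjoints, and
  the Hadamard estimate from the norm to the spectral radius.

  For \<open>N\<close> in the Hadamard product of the \<open>\<Psi>\<^sub>j\<close> and even \<open>n\<close>, the \<open>n\<close>-th power of the norm of \<open>N\<close> is at most the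
  spectral radius of \<open>N\<^sup>* N N\<^sup>* N \<dots>\<close> with \<open>n\<close> factors, which is dominated by an element of the
  Hadamard product of the \<open>P\<^sub>j\<close> (of the \<open>Q\<^sub>j\<close>). This gives the first inequality; the second is the Hadamard
  estimate, since up to cyclic permutation and adjoints the \<open>P\<^sub>j\<close> are the
  two products on the right, and the \<open>Q\<^sub>j\<close> are the only one.\<close>

text \<open>Gelfand's formula usually comes from complex analysis. Positivity replaces it here: only
  the one real point at the growth rate has to be placed in the spectrum, and an order argument does
  that. The Hadamard estimate for sets is proved for an abstract size of matrices and used twice:
  with the norm, where singletons yield the estimate for the spectral radius of one matrix, and then
  with the spectral radius itself. The sequence behind the generalized spectral radius need not be
  submultiplicative, so only an upper limit is available for it, and relations are established for
  each exponent k before passing to that limit. The number of factors must be even for the stars,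
  and a multiple of m for the indices, to close up under rotation. The least such number is m or 2 *
  m, which is the origin of the two parities. Entries with an index outside R are arbitrary, so laws
  such as associativity are statements about operators and not about the functions that encode
  matrices.\<close>

lemma infsum_nonneg_le:
  fixes f :: "'a \<Rightarrow> real"
  assumes "\<And>x. x \<in> A \<Longrightarrow> 0 \<le> f x"
    and "\<And>F. finite F \<Longrightarrow> F \<subseteq> A \<Longrightarrow> sum f F \<le> b"
  shows "f summable_on A" and "infsum f A \<le> b"
proof -
  show *: "f summable_on A"
    using assms by (intro nonneg_bdd_above_summable_on) (auto simp: bdd_above_def)
  show "infsum f A \<le> b"
    using assms(2) by (intro infsum_le_finite_sums[OF *])
qed

section \<open>Square summable vectors\<close>

lemma l2_norm_nonneg [simp]: "0 \<le> l2_norm R x"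
  unfolding l2_norm_def by (intro real_sqrt_ge_zero infsum_nonneg) auto

lemma l2_outside: "x \<in> l2 R \<Longrightarrow> i \<notin> R \<Longrightarrow> x i = 0"
  by (auto simp: l2_def)

lemma L2_set_le_l2_norm:
  assumes "x \<in> l2 R" "finite F" "F \<subseteq> R"
  shows "L2_set (\<lambda>i. cmod (x i)) F \<le> l2_norm R x"
  using assms unfolding L2_set_def l2_norm_def
  by (intro real_sqrt_le_mono finite_sum_le_infsum) (auto simp: l2_def)

text \<open>Converse of \<open>L2_set_le_l2_norm\<close>. Together they reduce every estimate in the
  space to \<open>L2_set\<close> inequalities over finite sets.\<close>

lemma l2_normI:
  assumes "\<And>i. i \<notin> R \<Longrightarrow> x i = 0" "0 \<le> K"
    and "\<And>F. finite F \<Longrightarrow> F \<subseteq> R \<Longrightarrow> L2_set (\<lambda>i. cmod (x i)) F \<le> K"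
  shows "x \<in> l2 R" and "l2_norm R x \<le> K"
proof -
  have le: "(\<Sum>i\<in>F. (cmod (x i))\<^sup>2) \<le> K\<^sup>2" if "finite F" "F \<subseteq> R" for F
    using assms(3)[OF that] assms(2) unfolding L2_set_def by (simp add: sqrt_le_D)
  note * = infsum_nonneg_le[of R "\<lambda>i. (cmod (x i))\<^sup>2", OF _ le]
  show "x \<in> l2 R" using *(1) assms(1) by (auto simp: l2_def)
  show "l2_norm R x \<le> K"
    unfolding l2_norm_def using *(2) assms(2) by (intro real_le_lsqrt) auto
qed

lemma l2_zero [simp]: "(\<lambda>i. 0) \<in> l2 R" and l2_norm_zero [simp]: "l2_norm R (\<lambda>i. 0) = 0"
  by (auto simp: l2_def l2_norm_def)

lemma l2_mono:
  assumes "y \<in> l2 R" "\<And>i. cmod (x i) \<le> cmod (y i)"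
  shows "x \<in> l2 R" and "l2_norm R x \<le> l2_norm R y"
proof -
  have 1: "x i = 0" if "i \<notin> R" for i
    using assms(2)[of i] l2_outside[OF assms(1) that] by simp
  have 2: "L2_set (\<lambda>i. cmod (x i)) F \<le> l2_norm R y" if "finite F" "F \<subseteq> R" for F
    using L2_set_le_l2_norm[OF assms(1) that] L2_set_mono[of F "\<lambda>i. cmod (x i)" "\<lambda>i. cmod (y i)"]
      assms(2) by fastforce
  show "x \<in> l2 R" and "l2_norm R x \<le> l2_norm R y"
    using l2_normI[of R x "l2_norm R y", OF 1 _ 2] by auto
qed

lemma l2_cmod: "x \<in> l2 R \<Longrightarrow> (\<lambda>i. complex_of_real (cmod (x i))) \<in> l2 R"
  and l2_norm_cmod: "l2_norm R (\<lambda>i. complex_of_real (cmod (x i))) = l2_norm R x"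
  by (auto simp: l2_def l2_norm_def)

lemma l2_add:
  assumes "x \<in> l2 R" "y \<in> l2 R"
  shows "(\<lambda>i. x i + y i) \<in> l2 R" and "l2_norm R (\<lambda>i. x i + y i) \<le> l2_norm R x + l2_norm R y"
proof -
  have 2: "L2_set (\<lambda>i. cmod (x i + y i)) F \<le> l2_norm R x + l2_norm R y"
    if "finite F" "F \<subseteq> R" for F
  proof -
    have "L2_set (\<lambda>i. cmod (x i + y i)) F \<le> L2_set (\<lambda>i. cmod (x i) + cmod (y i)) F"
      by (intro L2_set_mono norm_triangle_ineq) auto
    also have "\<dots> \<le> L2_set (\<lambda>i. cmod (x i)) F + L2_set (\<lambda>i. cmod (y i)) F"
      by (rule L2_set_triangle_ineq)
    also have "\<dots> \<le> l2_norm R x + l2_norm R y"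
      by (intro add_mono L2_set_le_l2_norm assms that)
    finally show ?thesis .
  qed
  show "(\<lambda>i. x i + y i) \<in> l2 R" and "l2_norm R (\<lambda>i. x i + y i) \<le> l2_norm R x + l2_norm R y"
    using l2_normI[of R "\<lambda>i. x i + y i", OF _ _ 2] assms by (auto simp: l2_outside)
qed

lemma l2_scale: "x \<in> l2 R \<Longrightarrow> (\<lambda>i. c * x i) \<in> l2 R"
  by (auto simp: l2_def norm_mult power_mult_distrib intro!: summable_on_cmult_right)

lemma l2_norm_scale: "l2_norm R (\<lambda>i. c * x i) = cmod c * l2_norm R x"
  unfolding l2_norm_def
  by (simp add: norm_mult power_mult_distrib infsum_cmult_right' real_sqrt_mult)

lemma l2_diff:
  assumes "x \<in> l2 R" "y \<in> l2 R"
  shows "(\<lambda>i. x i - y i) \<in> l2 R" and "l2_norm R (\<lambda>i. x i - y i) \<le> l2_norm R x + l2_norm R y"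
  using l2_add[OF assms(1) l2_scale[OF assms(2), of "-1"]] l2_norm_scale[of R "-1" y] by auto

lemma l2_entry_le:
  assumes "x \<in> l2 R"
  shows "cmod (x i) \<le> l2_norm R x"
proof (cases "i \<in> R")
  case True
  then show ?thesis using L2_set_le_l2_norm[OF assms, of "{i}"] by simp
qed (use l2_outside[OF assms] in auto)

lemma l2_finite_support:
  assumes "finite G" "G \<subseteq> R"
  shows "(\<lambda>i. if i \<in> G then complex_of_real (x i) else 0) \<in> l2 R"
    and "l2_norm R (\<lambda>i. if i \<in> G then complex_of_real (x i) else 0) = L2_set x G"
proof -
  let ?x = "\<lambda>i. if i \<in> G then complex_of_real (x i) else 0"
  have le: "L2_set (\<lambda>i. cmod (?x i)) F \<le> L2_set x G" if "finite F" "F \<subseteq> R" for F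
  proof -
    have "(\<Sum>i\<in>F. (cmod (?x i))\<^sup>2) = (\<Sum>i\<in>F \<inter> G. (x i)\<^sup>2)"
      using that by (subst sum.inter_restrict) (auto intro!: sum.cong)
    also have "\<dots> \<le> (\<Sum>i\<in>G. (x i)\<^sup>2)"
      using assms by (intro sum_mono2) auto
    finally show ?thesis unfolding L2_set_def by simp
  qed
  have "?x i = 0" if "i \<notin> R" for i using that assms by auto
  note * = l2_normI[of R ?x, OF this _ le]
  show "?x \<in> l2 R" using * assms by auto
  have "L2_set x G = L2_set (\<lambda>i. cmod (?x i)) G"
    unfolding L2_set_def by simp
  also have "\<dots> \<le> l2_norm R ?x"
    using * assms by (intro L2_set_le_l2_norm) auto
  finally show "l2_norm R ?x = L2_set x G"
    using * assms by (intro antisym) auto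
qed

lemma l2_sum:
  assumes "finite S" "\<And>k. k \<in> S \<Longrightarrow> v k \<in> l2 R"
  shows "(\<lambda>i. \<Sum>k\<in>S. v k i) \<in> l2 R"
    and "l2_norm R (\<lambda>i. \<Sum>k\<in>S. v k i) \<le> (\<Sum>k\<in>S. l2_norm R (v k))"
proof -
  have "(\<lambda>i. \<Sum>k\<in>S. v k i) \<in> l2 R \<and> l2_norm R (\<lambda>i. \<Sum>k\<in>S. v k i) \<le> (\<Sum>k\<in>S. l2_norm R (v k))"
    using assms
  proof (induction S rule: finite_induct)
    case (insert k S)
    then show ?case
      using l2_add[of "v k" R "\<lambda>i. \<Sum>k\<in>S. v k i"] by auto
  qed auto
  then show "(\<lambda>i. \<Sum>k\<in>S. v k i) \<in> l2 R"
    and "l2_norm R (\<lambda>i. \<Sum>k\<in>S. v k i) \<le> (\<Sum>k\<in>S. l2_norm R (v k))" by auto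
qed

text \<open>Completeness in series form. Entries are bounded by the norm, so the series converges
  entrywise; finite sections of the partial sums pass to the limit, which makes the entrywise sum
  square summable with the expected bound.\<close>

lemma l2_series:
  assumes v: "\<And>k. v k \<in> l2 R" and s: "summable (\<lambda>k. l2_norm R (v k))"
  shows "summable (\<lambda>k. v k i)"
    and "(\<lambda>i. \<Sum>k. v k i) \<in> l2 R"
    and "l2_norm R (\<lambda>i. \<Sum>k. v k i) \<le> (\<Sum>k. l2_norm R (v k))"
proof -
  have sm: "summable (\<lambda>k. v k i)" for i
    using l2_entry_le[OF v] by (intro summable_comparison_test[OF _ s]) auto
  then show "summable (\<lambda>k. v k i)" .
  have le: "L2_set (\<lambda>i. cmod (\<Sum>k. v k i)) F \<le> (\<Sum>k. l2_norm R (v k))" if F: "finite F" "F \<subseteq> R" for F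
  proof (rule LIMSEQ_le_const2)
    show "(\<lambda>n. L2_set (\<lambda>i. cmod (\<Sum>k<n. v k i)) F) \<longlonglongrightarrow> L2_set (\<lambda>i. cmod (\<Sum>k. v k i)) F"
      unfolding L2_set_def by (intro tendsto_intros summable_LIMSEQ sm)
    have "L2_set (\<lambda>i. cmod (\<Sum>k<n. v k i)) F \<le> (\<Sum>k. l2_norm R (v k))" for n
    proof -
      have "L2_set (\<lambda>i. cmod (\<Sum>k<n. v k i)) F \<le> l2_norm R (\<lambda>i. \<Sum>k<n. v k i)"
        by (intro L2_set_le_l2_norm l2_sum v F) auto
      also have "\<dots> \<le> (\<Sum>k<n. l2_norm R (v k))"
        by (intro l2_sum v) auto
      also have "\<dots> \<le> (\<Sum>k. l2_norm R (v k))"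
        by (intro sum_le_suminf s) auto
      finally show ?thesis .
    qed
    then show "\<exists>N. \<forall>n\<ge>N. L2_set (\<lambda>i. cmod (\<Sum>k<n. v k i)) F \<le> (\<Sum>k. l2_norm R (v k))"
      by blast
  qed
  show "(\<lambda>i. \<Sum>k. v k i) \<in> l2 R" "l2_norm R (\<lambda>i. \<Sum>k. v k i) \<le> (\<Sum>k. l2_norm R (v k))"
    using l2_normI[of R "\<lambda>i. \<Sum>k. v k i", OF _ _ le] l2_outside[OF v]
    by (auto simp: suminf_nonneg s)
qed

section \<open>Norms of nonnegative matrices through finite sections\<close>

text \<open>For a nonnegative matrix defining an operator, the least such K is the operator norm, by
  \<open>mat_norm_le\<close> and \<open>pos_op_norm\<close>. Keeping F and G as separate arguments
  spares the test vectors any condition on their support.\<close>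

definition form_bound :: "nat set \<Rightarrow> matrix \<Rightarrow> real \<Rightarrow> bool" where
  "form_bound R A K \<longleftrightarrow> 0 \<le> K \<and>
     (\<forall>F G x y. finite F \<longrightarrow> F \<subseteq> R \<longrightarrow> finite G \<longrightarrow> G \<subseteq> R \<longrightarrow> (\<forall>i. 0 \<le> x i) \<longrightarrow> (\<forall>i. 0 \<le> y i) \<longrightarrow>
        (\<Sum>i\<in>F. \<Sum>j\<in>G. y i * A i j * x j) \<le> K * L2_set y F * L2_set x G)"

definition pos_op :: "nat set \<Rightarrow> matrix \<Rightarrow> bool" where
  "pos_op R A \<longleftrightarrow> nonneg_matrix R A \<and> defines_operator R A"

lemma form_boundI:
  assumes "0 \<le> K"
    and "\<And>F G x y. finite F \<Longrightarrow> F \<subseteq> R \<Longrightarrow> finite G \<Longrightarrow> G \<subseteq> R \<Longrightarrow> (\<And>i. 0 \<le> x i) \<Longrightarrow> (\<And>i. 0 \<le> y i) \<Longrightarrow>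
        (\<Sum>i\<in>F. \<Sum>j\<in>G. y i * A i j * x j) \<le> K * L2_set y F * L2_set x G"
  shows "form_bound R A K"
  using assms unfolding form_bound_def by blast

lemma form_boundD:
  assumes "form_bound R A K" "finite F" "F \<subseteq> R" "finite G" "G \<subseteq> R" "\<And>i. 0 \<le> x i" "\<And>i. 0 \<le> y i"
  shows "(\<Sum>i\<in>F. \<Sum>j\<in>G. y i * A i j * x j) \<le> K * L2_set y F * L2_set x G"
  using assms unfolding form_bound_def by blast

lemma form_bound_nonneg: "form_bound R A K \<Longrightarrow> 0 \<le> K"
  unfolding form_bound_def by blast

text \<open>Duality: testing the form against the image itself gives L * L \<le> L * (K *
  \<open>L2_set x G\<close>), where L is the norm of the image over F, and L cancels unless it is
  0.\<close>

lemma form_bound_row: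
  assumes "form_bound R A K" "finite F" "F \<subseteq> R" "finite G" "G \<subseteq> R" "\<And>i. 0 \<le> x i"
    and "nonneg_matrix R A"
  shows "L2_set (\<lambda>i. \<Sum>j\<in>G. A i j * x j) F \<le> K * L2_set x G"
proof -
  \<comment> \<open>On F the absolute value changes nothing. It makes y nonnegative also at indices
    outside R, where the entries of A may be negative.\<close>
  define y where "y = (\<lambda>i. \<bar>\<Sum>j\<in>G. A i j * x j\<bar>)"
  define L where "L = L2_set y F"
  have eq: "(\<Sum>j\<in>G. A i j * x j) = y i" if "i \<in> F" for i
    using that assms unfolding y_def nonneg_matrix_def
    by (subst abs_of_nonneg) (auto simp: subset_iff intro!: sum_nonneg mult_nonneg_nonneg)
  have L: "L2_set (\<lambda>i. \<Sum>j\<in>G. A i j * x j) F = L"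
    unfolding L_def by (rule L2_set_cong) (auto simp: eq)
  have "L * L = (\<Sum>i\<in>F. y i * y i)"
    unfolding L_def L2_set_def by (simp add: sum_nonneg power2_eq_square)
  also have "\<dots> = (\<Sum>i\<in>F. \<Sum>j\<in>G. y i * A i j * x j)"
    by (intro sum.cong refl) (simp add: eq[symmetric] sum_distrib_left mult.assoc)
  also have "\<dots> \<le> K * L2_set y F * L2_set x G"
    using assms by (intro form_boundD[of R A K F G x y]) (auto simp: y_def)
  finally have "L * L \<le> L * (K * L2_set x G)" by (simp add: L_def mult_ac)
  moreover have "0 \<le> L" "0 \<le> K * L2_set x G"
    unfolding L_def using form_bound_nonneg[OF assms(1)] by auto
  ultimately show ?thesis unfolding L
    by (cases "L = 0") auto
qed

text \<open>The bound of \<open>form_bound_row\<close> is uniform in both finite sets. For fixed F,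
  continuity of a finite sum lets G grow to R; then F is arbitrary.\<close>

lemma form_bound_matrix_op:
  assumes A: "nonneg_matrix R A" "form_bound R A K" and x: "x \<in> l2 R"
  shows "i \<in> R \<Longrightarrow> (\<lambda>j. complex_of_real (A i j) * x j) summable_on R"
    and "matrix_op R A x \<in> l2 R"
    and "l2_norm R (matrix_op R A x) \<le> K * l2_norm R x"
proof -
  have K: "0 \<le> K" using A form_bound_nonneg by blast
  define u where "u = (\<lambda>j. cmod (x j))"
  have fin: "L2_set (\<lambda>i. \<Sum>j\<in>G. A i j * u j) F \<le> K * l2_norm R x"
    if "finite F" "F \<subseteq> R" "finite G" "G \<subseteq> R" for F G
  proof -
    have "L2_set (\<lambda>i. \<Sum>j\<in>G. A i j * u j) F \<le> K * L2_set u G"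
      using that A by (intro form_bound_row) (auto simp: u_def)
    also have "\<dots> \<le> K * l2_norm R x"
      unfolding u_def using that K x by (intro mult_left_mono L2_set_le_l2_norm) auto
    finally show ?thesis .
  qed
  have s: "(\<lambda>j. A i j * u j) summable_on R" if "i \<in> R" for i
  proof (rule infsum_nonneg_le)
    show "0 \<le> A i j * u j" if "j \<in> R" for j
      using A that \<open>i \<in> R\<close> by (auto simp: nonneg_matrix_def u_def)
    show "(\<Sum>j\<in>G. A i j * u j) \<le> K * l2_norm R x" if "finite G" "G \<subseteq> R" for G
      using fin[of "{i}" G] that \<open>i \<in> R\<close> by simp
  qed
  have s': "(\<lambda>j. norm (complex_of_real (A i j) * x j)) summable_on R" if "i \<in> R" for i
    using A that by (intro summable_on_cong[THEN iffD1, OF _ s[OF that]])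
      (auto simp: norm_mult nonneg_matrix_def u_def)
  then show "i \<in> R \<Longrightarrow> (\<lambda>j. complex_of_real (A i j) * x j) summable_on R" for i
    by (rule Infinite_Sum.abs_summable_summable)
  have le: "cmod (matrix_op R A x i) \<le> (\<Sum>\<^sub>\<infinity>j\<in>R. A i j * u j)" if "i \<in> R" for i
  proof -
    have "cmod (matrix_op R A x i) \<le> (\<Sum>\<^sub>\<infinity>j\<in>R. norm (complex_of_real (A i j) * x j))"
      unfolding matrix_op_def using that by (simp add: norm_infsum_bound s'[OF that])
    also have "\<dots> = (\<Sum>\<^sub>\<infinity>j\<in>R. A i j * u j)"
      using A that by (intro infsum_cong) (auto simp: norm_mult nonneg_matrix_def u_def)
    finally show ?thesis .
  qed
  have "L2_set (\<lambda>i. cmod (matrix_op R A x i)) F \<le> K * l2_norm R x" if F: "finite F" "F \<subseteq> R" for F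
  proof -
    have "L2_set (\<lambda>i. cmod (matrix_op R A x i)) F \<le> L2_set (\<lambda>i. \<Sum>\<^sub>\<infinity>j\<in>R. A i j * u j) F"
      using F le by (intro L2_set_mono) auto
    also have "\<dots> \<le> K * l2_norm R x"
    proof (rule tendsto_upperbound)
      show "((\<lambda>G. L2_set (\<lambda>i. \<Sum>j\<in>G. A i j * u j) F) \<longlongrightarrow> L2_set (\<lambda>i. \<Sum>\<^sub>\<infinity>j\<in>R. A i j * u j) F)
          (finite_subsets_at_top R)"
        unfolding L2_set_def using F
        by (intro tendsto_intros) (auto intro!: has_sum_infsum[unfolded has_sum_def] s)
      show "\<forall>\<^sub>F G in finite_subsets_at_top R. L2_set (\<lambda>i. \<Sum>j\<in>G. A i j * u j) F \<le> K * l2_norm R x"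
        using fin[OF F] by (intro eventually_finite_subsets_at_top_weakI) auto
    qed simp
    finally show ?thesis .
  qed
  then show "matrix_op R A x \<in> l2 R" "l2_norm R (matrix_op R A x) \<le> K * l2_norm R x"
    using l2_normI[of R "matrix_op R A x" "K * l2_norm R x"] K by (auto simp: matrix_op_def)
qed

lemma form_bound_pos_op:
  assumes "nonneg_matrix R A" "form_bound R A K"
  shows "pos_op R A"
  using assms form_bound_matrix_op[OF assms]
  unfolding pos_op_def defines_operator_def by blast

lemma mat_norm_le:
  assumes "nonneg_matrix R A" "form_bound R A K"
  shows "mat_norm R A \<le> K"
  unfolding mat_norm_def operator_norm_def
proof (rule cSUP_least)
  show "l2 R \<noteq> {}" using l2_zero by blast
  fix x assume x: "x \<in> l2 R"
  have "0 \<le> K" using assms form_bound_nonneg by blast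
  then show "l2_norm R (matrix_op R A x) / l2_norm R x \<le> K"
    using form_bound_matrix_op(3)[OF assms x]
    by (cases "l2_norm R x = 0") (auto simp: divide_le_eq less_le)
qed

text \<open>If the quadratic forms were unbounded, vectors \<open>u n\<close> of norm \<open>2\<^sup>-\<^sup>n\<close> whose images have
  norm at least \<open>2\<^sup>n\<close> would add up to a vector whose image dominates all these images.\<close>

lemma pos_op_form_bound:
  assumes "pos_op R A"
  shows "\<exists>K. form_bound R A K"
proof (rule ccontr)
  assume "\<nexists>K. form_bound R A K"
  have A: "nonneg_matrix R A" "defines_operator R A"
    using assms by (auto simp: pos_op_def)
  \<comment> \<open>The factor \<open>4 ^ n\<close> is shared out: one \<open>2 ^ n\<close> makes
    the rescaled vectors summable, the other survives as growth of their images.\<close>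
  define bad where "bad n F G x y \<longleftrightarrow> finite F \<and> F \<subseteq> R \<and> finite G \<and> G \<subseteq> R \<and> (\<forall>i. 0 \<le> x i) \<and> (\<forall>i. 0 \<le> y i) \<and>
      4 ^ n * L2_set y F * L2_set x G < (\<Sum>i\<in>F. \<Sum>j\<in>G. y i * A i j * x j)"
    for n :: nat and F G x y
  have "\<exists>F G x y. bad n F G x y" for n
  proof -
    have "\<not> form_bound R A (4 ^ n)" using \<open>\<nexists>K. form_bound R A K\<close> by blast
    then show ?thesis unfolding form_bound_def bad_def by (auto simp: not_le)
  qed
  then obtain F G x y where "\<And>n. bad n (F n) (G n) (x n) (y n)" by metis
  then have fin: "\<And>n. finite (F n)" "\<And>n. F n \<subseteq> R" "\<And>n. finite (G n)" "\<And>n. G n \<subseteq> R"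
    and xy: "\<And>n i. 0 \<le> x n i" "\<And>n i. (0::real) \<le> y n i"
    and big: "\<And>n. 4 ^ n * L2_set (y n) (F n) * L2_set (x n) (G n)
      < (\<Sum>i\<in>F n. \<Sum>j\<in>G n. y n i * A i j * x n j)"
    unfolding bad_def by blast+
  define c where "c n = 2 ^ n * L2_set (x n) (G n)" for n
  have cpos: "0 < c n" for n
  proof (rule ccontr)
    assume "\<not> 0 < c n"
    then have "L2_set (x n) (G n) = 0"
      unfolding c_def using L2_set_nonneg[of "x n" "G n"] by (simp add: zero_less_mult_iff)
    then have "\<forall>j\<in>G n. x n j = 0" using fin by (simp add: L2_set_eq_0_iff)
    then show False using big[of n] \<open>L2_set (x n) (G n) = 0\<close> by simp
  qed
  define U where "U n j = (if j \<in> G n then x n j / c n else 0)" for n j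
  define u where "u n = (\<lambda>j. complex_of_real (U n j))" for n
  have u_alt: "u n = (\<lambda>j. if j \<in> G n then complex_of_real (x n j / c n) else 0)" for n
    by (auto simp: u_def U_def)
  have u: "u n \<in> l2 R" "l2_norm R (u n) = (1/2) ^ n" for n
  proof -
    show "u n \<in> l2 R" unfolding u_alt by (rule l2_finite_support) (use fin in auto)
    have "l2_norm R (u n) = L2_set (\<lambda>j. x n j / c n) (G n)"
      unfolding u_alt by (rule l2_finite_support) (use fin in auto)
    also have "\<dots> = L2_set (x n) (G n) / c n"
      using L2_set_left_distrib[of "1 / c n" "x n" "G n"] cpos[of n] by simp
    finally show "l2_norm R (u n) = (1/2) ^ n"
      using cpos[of n] by (auto simp: c_def field_simps split: if_splits)
  qed
  have "summable (\<lambda>n. l2_norm R (u n))"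
    unfolding u by (rule summable_geometric) simp
  note ser = l2_series[OF u(1) this]
  define X where "X = (\<lambda>i. \<Sum>n. u n i)"
  have X: "X \<in> l2 R" unfolding X_def by (rule ser)
  have U0: "0 \<le> U n j" for n j using xy cpos[of n] by (auto simp: U_def)
  have sU: "summable (\<lambda>n. U n j)" for j
    using summable_Re[OF ser(1)[of j]] by (simp add: u_def)
  have UX: "U n j \<le> Re (X j)" for n j
  proof -
    have "Re (X j) = (\<Sum>n. U n j)"
      unfolding X_def u_def suminf_of_real[OF sU, symmetric] by simp
    moreover have "(\<Sum>k\<in>{n}. U k j) \<le> (\<Sum>n. U n j)"
      by (intro sum_le_suminf sU) (auto simp: U0)
    ultimately show ?thesis by simp
  qed
  have AX: "matrix_op R A X \<in> l2 R"
    and sAX: "\<And>i. i \<in> R \<Longrightarrow> (\<lambda>j. complex_of_real (A i j) * X j) summable_on R"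
    using A X unfolding defines_operator_def by auto
  have lower: "(\<Sum>j\<in>G n. A i j * U n j) \<le> cmod (matrix_op R A X i)" if "i \<in> R" for i n
  proof -
    have Xpos: "0 \<le> Re (X j)" for j using UX[of 0 j] U0[of 0 j] by linarith
    have "(\<Sum>j\<in>G n. A i j * U n j) \<le> (\<Sum>j\<in>G n. Re (complex_of_real (A i j) * X j))"
      using A(1) that fin UX by (intro sum_mono) (auto simp: nonneg_matrix_def subset_iff intro!: mult_left_mono)
    also have "\<dots> \<le> (\<Sum>\<^sub>\<infinity>j\<in>R. Re (complex_of_real (A i j) * X j))"
      using A(1) that fin Xpos
      by (intro finite_sum_le_infsum summable_on_Re sAX) (auto simp: nonneg_matrix_def)
    also have "\<dots> = Re (matrix_op R A X i)"
      unfolding infsum_Re[OF sAX[OF that]] using that by (simp add: matrix_op_def)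
    also have "\<dots> \<le> cmod (matrix_op R A X i)" by (rule complex_Re_le_cmod)
    finally show ?thesis .
  qed
  have "2 ^ n < l2_norm R (matrix_op R A X)" for n
  proof -
    define p q where "p = L2_set (y n) (F n)" and "q = L2_set (x n) (G n)"
    have "(\<Sum>i\<in>F n. \<Sum>j\<in>G n. y n i * A i j * x n j) =
        c n * (\<Sum>i\<in>F n. y n i * (\<Sum>j\<in>G n. A i j * U n j))"
      using cpos[of n] unfolding sum_distrib_left by (intro sum.cong refl) (simp add: U_def)
    also have "\<dots> \<le> c n * (\<Sum>i\<in>F n. y n i * cmod (matrix_op R A X i))"
      using cpos[of n] lower subsetD[OF fin(2)] xy
      by (intro mult_left_mono sum_mono) (auto intro: less_imp_le)
    also have "\<dots> = c n * (\<Sum>i\<in>F n. \<bar>y n i\<bar> * \<bar>cmod (matrix_op R A X i)\<bar>)"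
      using xy by simp
    also have "\<dots> \<le> c n * (p * L2_set (\<lambda>i. cmod (matrix_op R A X i)) (F n))"
      unfolding p_def using cpos[of n] by (intro mult_left_mono L2_set_mult_ineq) auto
    also have "\<dots> \<le> c n * (p * l2_norm R (matrix_op R A X))"
      unfolding p_def using cpos[of n] fin by (intro mult_left_mono L2_set_le_l2_norm AX) auto
    finally have "(2 ^ n * p * q) * 2 ^ n < (2 ^ n * p * q) * l2_norm R (matrix_op R A X)"
      using big[of n] unfolding c_def p_def[symmetric] q_def[symmetric]
      by (simp add: mult_ac flip: power_mult_distrib)
    moreover have "0 \<le> 2 ^ n * p * q" unfolding p_def q_def by simp
    ultimately show ?thesis using mult_less_cancel_left by (meson not_le)
  qed
  moreover obtain n where "l2_norm R (matrix_op R A X) < 2 ^ n"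
    using real_arch_pow[of 2] by auto
  ultimately show False by (meson less_asym)
qed

text \<open>\<open>mat_norm\<close> is a supremum of reals and says nothing before the quotients are
  known to be bounded; \<open>pos_op_form_bound\<close> supplies this. Finitely supported vectors
  then give back the form bound with the norm as its constant.\<close>

lemma pos_op_norm:
  assumes "pos_op R A"
  shows "x \<in> l2 R \<Longrightarrow> matrix_op R A x \<in> l2 R"
    and "x \<in> l2 R \<Longrightarrow> l2_norm R (matrix_op R A x) \<le> mat_norm R A * l2_norm R x"
    and "0 \<le> mat_norm R A"
    and "form_bound R A (mat_norm R A)"
proof -
  have A: "nonneg_matrix R A" using assms by (simp add: pos_op_def)
  obtain K where K: "form_bound R A K" using pos_op_form_bound[OF assms] by blast
  note * = form_bound_matrix_op[OF A K]
  have "l2_norm R (matrix_op R A x) / l2_norm R x \<le> K" if "x \<in> l2 R" for x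
    using *(3)[OF that] form_bound_nonneg[OF K]
    by (cases "l2_norm R x = 0") (auto simp: divide_le_eq less_le)
  then have bdd: "bdd_above ((\<lambda>x. l2_norm R (matrix_op R A x) / l2_norm R x) ` l2 R)"
    by (auto simp: bdd_above_def)
  have le: "l2_norm R (matrix_op R A x) / l2_norm R x \<le> mat_norm R A" if "x \<in> l2 R" for x
    unfolding mat_norm_def operator_norm_def using that by (intro cSUP_upper bdd)
  show l2: "x \<in> l2 R \<Longrightarrow> matrix_op R A x \<in> l2 R" for x by (rule *(2))
  show norm: "l2_norm R (matrix_op R A x) \<le> mat_norm R A * l2_norm R x" if "x \<in> l2 R" for x
  proof (cases "l2_norm R x = 0")
    case True
    then show ?thesis using *(3)[OF that] by simp
  next
    case False
    then show ?thesis using le[OF that] by (simp add: divide_le_eq less_le)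
  qed
  show nn: "0 \<le> mat_norm R A" using le[OF l2_zero] by simp
  show "form_bound R A (mat_norm R A)"
  proof (rule form_boundI[OF nn])
    fix F G :: "nat set" and x y :: "nat \<Rightarrow> real"
    assume fin: "finite F" "F \<subseteq> R" "finite G" "G \<subseteq> R" and xy: "\<And>i. 0 \<le> x i" "\<And>i. 0 \<le> y i"
    define X where "X = (\<lambda>i. if i \<in> G then complex_of_real (x i) else 0)"
    have X: "X \<in> l2 R" "l2_norm R X = L2_set x G"
      unfolding X_def using l2_finite_support[OF fin(3,4)] by auto
    have op: "matrix_op R A X i = complex_of_real (\<Sum>j\<in>G. A i j * x j)" if "i \<in> F" for i
    proof -
      have "(\<Sum>\<^sub>\<infinity>j\<in>R. complex_of_real (A i j) * X j) = (\<Sum>\<^sub>\<infinity>j\<in>G. complex_of_real (A i j) * X j)"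
        using fin by (intro infsum_cong_neutral) (auto simp: X_def)
      then show ?thesis using that fin by (auto simp: matrix_op_def X_def)
    qed
    have "(\<Sum>i\<in>F. \<Sum>j\<in>G. y i * A i j * x j) = (\<Sum>i\<in>F. y i * (\<Sum>j\<in>G. A i j * x j))"
      by (simp add: sum_distrib_left mult.assoc)
    also have "\<dots> \<le> (\<Sum>i\<in>F. \<bar>y i\<bar> * \<bar>cmod (matrix_op R A X i)\<bar>)"
      using xy by (intro sum_mono) (simp add: op mult_left_mono del: of_real_sum)
    also have "\<dots> \<le> L2_set y F * L2_set (\<lambda>i. cmod (matrix_op R A X i)) F"
      by (rule L2_set_mult_ineq)
    also have "\<dots> \<le> L2_set y F * (mat_norm R A * L2_set x G)"
      using L2_set_le_l2_norm[OF l2[OF X(1)] fin(1,2)] norm[OF X(1)] X(2)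
      by (intro mult_left_mono) auto
    finally show "(\<Sum>i\<in>F. \<Sum>j\<in>G. y i * A i j * x j) \<le> mat_norm R A * L2_set y F * L2_set x G"
      by (simp add: mult_ac)
  qed
qed

section \<open>Algebra of positive operators\<close>

text \<open>Nonnegativity of the smaller matrix is built in, so that \<open>form_bound\<close> and
  \<open>pos_op\<close> are inherited from the larger one.\<close>

definition mat_le :: "nat set \<Rightarrow> matrix \<Rightarrow> matrix \<Rightarrow> bool" where
  "mat_le R A B \<longleftrightarrow> (\<forall>i\<in>R. \<forall>j\<in>R. 0 \<le> A i j \<and> A i j \<le> B i j)"

lemma form_bound_mono:
  assumes "mat_le R A B" "form_bound R B K"
  shows "form_bound R A K"
proof (rule form_boundI)
  show "0 \<le> K" using assms form_bound_nonneg by blast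
  fix F G :: "nat set" and x y :: "nat \<Rightarrow> real"
  assume *: "finite F" "F \<subseteq> R" "finite G" "G \<subseteq> R" "\<And>i. 0 \<le> x i" "\<And>i. 0 \<le> y i"
  have "(\<Sum>i\<in>F. \<Sum>j\<in>G. y i * A i j * x j) \<le> (\<Sum>i\<in>F. \<Sum>j\<in>G. y i * B i j * x j)"
    using * assms(1) unfolding mat_le_def
    by (intro sum_mono mult_right_mono mult_left_mono) (auto simp: subset_iff)
  also have "\<dots> \<le> K * L2_set y F * L2_set x G"
    using * assms by (intro form_boundD) auto
  finally show "(\<Sum>i\<in>F. \<Sum>j\<in>G. y i * A i j * x j) \<le> K * L2_set y F * L2_set x G" .
qed

lemma mat_norm_mono:
  assumes "mat_le R A B" "pos_op R B"
  shows "pos_op R A" and "mat_norm R A \<le> mat_norm R B"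
proof -
  have A: "nonneg_matrix R A" "form_bound R A (mat_norm R B)"
    using form_bound_mono[OF assms(1) pos_op_norm(4)[OF assms(2)]] assms(1)
    by (auto simp: mat_le_def nonneg_matrix_def)
  show "pos_op R A" "mat_norm R A \<le> mat_norm R B"
    using form_bound_pos_op[OF A] mat_norm_le[OF A] by auto
qed

lemma form_bound_adjoint:
  assumes "form_bound R A K"
  shows "form_bound R (mat_adjoint A) K"
proof (rule form_boundI)
  show "0 \<le> K" using assms form_bound_nonneg by blast
  fix F G :: "nat set" and x y :: "nat \<Rightarrow> real"
  assume *: "finite F" "F \<subseteq> R" "finite G" "G \<subseteq> R" "\<And>i. 0 \<le> x i" "\<And>i. 0 \<le> y i"
  have "(\<Sum>i\<in>F. \<Sum>j\<in>G. y i * mat_adjoint A i j * x j) = (\<Sum>j\<in>G. \<Sum>i\<in>F. x j * A j i * y i)"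
    by (subst sum.swap) (simp add: mat_adjoint_def mult_ac)
  also have "\<dots> \<le> K * L2_set x G * L2_set y F"
    using * assms by (intro form_boundD) auto
  finally show "(\<Sum>i\<in>F. \<Sum>j\<in>G. y i * mat_adjoint A i j * x j) \<le> K * L2_set y F * L2_set x G"
    by (simp add: mult_ac)
qed

lemma mat_adjoint_adjoint [simp]: "mat_adjoint (mat_adjoint A) = A"
  by (simp add: mat_adjoint_def)

lemma nonneg_matrix_adjoint [simp]: "nonneg_matrix R (mat_adjoint A) \<longleftrightarrow> nonneg_matrix R A"
  by (auto simp: nonneg_matrix_def mat_adjoint_def)

lemma pos_op_adjoint:
  assumes "pos_op R A"
  shows "pos_op R (mat_adjoint A)" and "mat_norm R (mat_adjoint A) = mat_norm R A"
proof -
  have *: "pos_op R (mat_adjoint A)" "mat_norm R (mat_adjoint A) \<le> mat_norm R A" if "pos_op R A" for A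
    using that form_bound_adjoint[OF pos_op_norm(4)[OF that]]
    by (auto simp: pos_op_def intro!: mat_norm_le form_bound_pos_op[unfolded pos_op_def, THEN conjunct2])
  show "pos_op R (mat_adjoint A)" "mat_norm R (mat_adjoint A) = mat_norm R A"
    using *[OF assms] *[OF *(1)[OF assms]] by auto
qed

text \<open>Takes care of the surplus exponent in \<open>hadamard_norm\<close> when \<alpha> exceeds
  1/m.\<close>

lemma form_bound_entry:
  assumes "form_bound R A K" "i \<in> R" "j \<in> R"
  shows "A i j \<le> K"
  using form_boundD[OF assms(1), of "{i}" "{j}" "\<lambda>_. 1" "\<lambda>_. 1"] assms by simp

lemma pos_op_one: "pos_op R mat_one" and mat_norm_one_le: "mat_norm R mat_one \<le> 1"
proof -
  have nn: "nonneg_matrix R mat_one" by (simp add: nonneg_matrix_def mat_one_def)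
  have fb: "form_bound R mat_one 1"
  proof (rule form_boundI)
    fix F G :: "nat set" and x y :: "nat \<Rightarrow> real"
    assume *: "finite F" "F \<subseteq> R" "finite G" "G \<subseteq> R" "\<And>i. 0 \<le> x i" "\<And>i. 0 \<le> y i"
    have "(\<Sum>i\<in>F. \<Sum>j\<in>G. y i * mat_one i j * x j) = (\<Sum>i\<in>F. \<Sum>j\<in>G. if i = j then y i * x i else 0)"
      by (intro sum.cong) (auto simp: mat_one_def)
    also have "\<dots> = (\<Sum>i\<in>F. if i \<in> G then y i * x i else 0)"
      using * by (simp add: sum.delta)
    also have "\<dots> = (\<Sum>i\<in>F \<inter> G. y i * x i)"
      using * by (simp add: sum.inter_restrict)
    also have "\<dots> = (\<Sum>i\<in>F \<inter> G. \<bar>y i\<bar> * \<bar>x i\<bar>)"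
      using * by simp
    also have "\<dots> \<le> L2_set y (F \<inter> G) * L2_set x (F \<inter> G)"
      by (rule L2_set_mult_ineq)
    also have "\<dots> \<le> L2_set y F * L2_set x G"
      unfolding L2_set_def using *
      by (intro mult_mono real_sqrt_le_mono sum_mono2) (auto simp: sum_nonneg)
    finally show "(\<Sum>i\<in>F. \<Sum>j\<in>G. y i * mat_one i j * x j) \<le> 1 * L2_set y F * L2_set x G" by simp
  qed simp
  show "pos_op R mat_one" "mat_norm R mat_one \<le> 1"
    using form_bound_pos_op[OF nn fb] mat_norm_le[OF nn fb] by auto
qed

text \<open>With the inner index restricted to a finite J, the form of the product is the inner
  product over J of the adjoint of A applied to y with B applied to x. Cauchy-Schwarz and
  \<open>form_bound_row\<close> bound it uniformly in J, and J grows to R.\<close>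

lemma mat_mult_bound:
  assumes A: "nonneg_matrix R A" "form_bound R A K" and B: "nonneg_matrix R B" "form_bound R B L"
  shows "i \<in> R \<Longrightarrow> k \<in> R \<Longrightarrow> (\<lambda>j. A i j * B j k) summable_on R"
    and "nonneg_matrix R (mat_mult R A B)"
    and "form_bound R (mat_mult R A B) (K * L)"
proof -
  have KL: "0 \<le> K" "0 \<le> L" using A B form_bound_nonneg by blast+
  have fin: "(\<Sum>i\<in>F. \<Sum>k\<in>G. y i * (\<Sum>j\<in>J. A i j * B j k) * x k) \<le> K * L * L2_set y F * L2_set x G"
    if *: "finite F" "F \<subseteq> R" "finite G" "G \<subseteq> R" "\<And>i. 0 \<le> x i" "\<And>i. 0 \<le> y i"
      and J: "finite J" "J \<subseteq> R" for F G J and x y :: "nat \<Rightarrow> real"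
  proof -
    define a where "a j = (\<Sum>i\<in>F. mat_adjoint A j i * y i)" for j
    define b where "b j = (\<Sum>k\<in>G. B j k * x k)" for j
    have "(\<Sum>i\<in>F. \<Sum>k\<in>G. y i * (\<Sum>j\<in>J. A i j * B j k) * x k) =
        (\<Sum>i\<in>F. \<Sum>k\<in>G. \<Sum>j\<in>J. (A i j * y i) * (B j k * x k))"
      by (simp add: sum_distrib_left sum_distrib_right mult_ac)
    also have "\<dots> = (\<Sum>i\<in>F. \<Sum>j\<in>J. \<Sum>k\<in>G. (A i j * y i) * (B j k * x k))"
      by (intro sum.cong refl sum.swap)
    also have "\<dots> = (\<Sum>j\<in>J. \<Sum>i\<in>F. \<Sum>k\<in>G. (A i j * y i) * (B j k * x k))"
      by (rule sum.swap)
    also have "\<dots> = (\<Sum>j\<in>J. a j * b j)"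
      by (simp add: a_def b_def sum_product mat_adjoint_def)
    also have "\<dots> \<le> (\<Sum>j\<in>J. \<bar>a j\<bar> * \<bar>b j\<bar>)"
      by (intro sum_mono) (metis abs_ge_self abs_mult)
    also have "\<dots> \<le> L2_set a J * L2_set b J" by (rule L2_set_mult_ineq)
    also have "\<dots> \<le> (K * L2_set y F) * (L * L2_set x G)"
      unfolding a_def b_def using * J A B KL
      by (intro mult_mono form_bound_row form_bound_adjoint) auto
    finally show ?thesis by (simp add: mult_ac)
  qed
  have nn: "0 \<le> A i j * B j k" if "i \<in> R" "j \<in> R" "k \<in> R" for i j k
    using A B that by (auto simp: nonneg_matrix_def)
  show s: "(\<lambda>j. A i j * B j k) summable_on R" if "i \<in> R" "k \<in> R" for i k
    using fin[of "{i}" "{k}" "\<lambda>_. 1" "\<lambda>_. 1"] that nn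
    by (intro infsum_nonneg_le[where b = "K * L"]) auto
  show "nonneg_matrix R (mat_mult R A B)"
    using nn by (auto simp: nonneg_matrix_def mat_mult_def intro!: infsum_nonneg)
  show "form_bound R (mat_mult R A B) (K * L)"
  proof (rule form_boundI)
    show "0 \<le> K * L" using KL by simp
    fix F G :: "nat set" and x y :: "nat \<Rightarrow> real"
    assume *: "finite F" "F \<subseteq> R" "finite G" "G \<subseteq> R" "\<And>i. 0 \<le> x i" "\<And>i. 0 \<le> y i"
    show "(\<Sum>i\<in>F. \<Sum>k\<in>G. y i * mat_mult R A B i k * x k) \<le> K * L * L2_set y F * L2_set x G"
    proof (rule tendsto_upperbound)
      show "((\<lambda>J. \<Sum>i\<in>F. \<Sum>k\<in>G. y i * (\<Sum>j\<in>J. A i j * B j k) * x k) \<longlongrightarrow>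
          (\<Sum>i\<in>F. \<Sum>k\<in>G. y i * mat_mult R A B i k * x k)) (finite_subsets_at_top R)"
        unfolding mat_mult_def using *
        by (intro tendsto_intros) (auto intro!: has_sum_infsum[unfolded has_sum_def] s)
      show "\<forall>\<^sub>F J in finite_subsets_at_top R.
          (\<Sum>i\<in>F. \<Sum>k\<in>G. y i * (\<Sum>j\<in>J. A i j * B j k) * x k) \<le> K * L * L2_set y F * L2_set x G"
        using fin[OF *] by (intro eventually_finite_subsets_at_top_weakI) auto
    qed simp
  qed
qed

lemma pos_op_mult:
  assumes "pos_op R A" "pos_op R B"
  shows "pos_op R (mat_mult R A B)"
    and "mat_norm R (mat_mult R A B) \<le> mat_norm R A * mat_norm R B"
    and "i \<in> R \<Longrightarrow> k \<in> R \<Longrightarrow> (\<lambda>j. A i j * B j k) summable_on R"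
proof -
  have nn: "nonneg_matrix R A" "nonneg_matrix R B" using assms by (auto simp: pos_op_def)
  note * = mat_mult_bound[OF nn(1) pos_op_norm(4)[OF assms(1)] nn(2) pos_op_norm(4)[OF assms(2)]]
  show "pos_op R (mat_mult R A B)" "mat_norm R (mat_mult R A B) \<le> mat_norm R A * mat_norm R B"
    using form_bound_pos_op[OF *(2,3)] mat_norm_le[OF *(2,3)] by auto
  show "i \<in> R \<Longrightarrow> k \<in> R \<Longrightarrow> (\<lambda>j. A i j * B j k) summable_on R" by (rule *(1))
qed

lemma mat_mult_mono:
  assumes "mat_le R A A'" "mat_le R B B'" "pos_op R A'" "pos_op R B'"
  shows "mat_le R (mat_mult R A B) (mat_mult R A' B')"
proof -
  have "0 \<le> mat_mult R A B i k \<and> mat_mult R A B i k \<le> mat_mult R A' B' i k"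
    if "i \<in> R" "k \<in> R" for i k
    unfolding mat_mult_def
  proof
    show "0 \<le> (\<Sum>\<^sub>\<infinity>j\<in>R. A i j * B j k)"
      using assms that by (intro infsum_nonneg) (auto simp: mat_le_def)
    have "pos_op R A" "pos_op R B" using mat_norm_mono assms by blast+
    then show "(\<Sum>\<^sub>\<infinity>j\<in>R. A i j * B j k) \<le> (\<Sum>\<^sub>\<infinity>j\<in>R. A' i j * B' j k)"
      using assms that
      by (intro infsum_mono pos_op_mult(3)) (auto simp: mat_le_def intro!: mult_mono intro: order_trans)
  qed
  then show ?thesis by (simp add: mat_le_def)
qed

section \<open>Comparing matrices through their operators\<close>

lemma matrix_op_basis:
  assumes "i \<in> R" "j \<in> R"
  shows "matrix_op R A (\<lambda>k. if k = j then 1 else 0) i = complex_of_real (A i j)"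
proof -
  have "(\<Sum>\<^sub>\<infinity>k\<in>R. complex_of_real (A i k) * (if k = j then 1 else 0)) =
      (\<Sum>\<^sub>\<infinity>k\<in>{j}. complex_of_real (A i k) * (if k = j then 1 else 0))"
    using assms by (intro infsum_cong_neutral) auto
  then show ?thesis using assms by (simp add: matrix_op_def)
qed

lemma matrix_op_eq_iff:
  "matrix_op R A = matrix_op R B \<longleftrightarrow> (\<forall>i\<in>R. \<forall>j\<in>R. A i j = B i j)"
proof
  assume *: "matrix_op R A = matrix_op R B"
  show "\<forall>i\<in>R. \<forall>j\<in>R. A i j = B i j"
  proof (intro ballI)
    fix i j assume "i \<in> R" "j \<in> R"
    then show "A i j = B i j"
      using matrix_op_basis[of i R j A] matrix_op_basis[of i R j B] * by simp
  qed
next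
  assume "\<forall>i\<in>R. \<forall>j\<in>R. A i j = B i j"
  then show "matrix_op R A = matrix_op R B"
    unfolding matrix_op_def by (intro ext) (auto intro!: infsum_cong)
qed

text \<open>\<open>matrix_op\<close> is a function on all vectors, while operator identities are
  known only on \<open>l2 R\<close>. The unit vectors lie there and already determine the entries
  over R.\<close>

lemma matrix_op_eqI:
  assumes "\<And>x. x \<in> l2 R \<Longrightarrow> matrix_op R A x = matrix_op R B x"
  shows "matrix_op R A = matrix_op R B"
  unfolding matrix_op_eq_iff
proof (intro ballI)
  fix i j assume *: "i \<in> R" "j \<in> R"
  have "(\<lambda>k. if k \<in> {j} then complex_of_real 1 else 0) \<in> l2 R"
    using * by (intro l2_finite_support) auto
  then show "A i j = B i j"
    using assms[of "\<lambda>k. if k = j then 1 else 0"] matrix_op_basis[OF *, of A] matrix_op_basis[OF *, of B]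
    by (simp cong: if_cong)
qed

lemma mat_norm_cong: "matrix_op R A = matrix_op R B \<Longrightarrow> mat_norm R A = mat_norm R B"
  and mat_rho_cong: "matrix_op R A = matrix_op R B \<Longrightarrow> mat_rho R A = mat_rho R B"
  by (simp_all add: mat_norm_def mat_rho_def)

lemma mat_mult_cong:
  assumes "matrix_op R A = matrix_op R A'" "matrix_op R B = matrix_op R B'"
  shows "matrix_op R (mat_mult R A B) = matrix_op R (mat_mult R A' B')"
  using assms unfolding matrix_op_eq_iff by (auto simp: mat_mult_def intro!: infsum_cong)

lemma matrix_op_mult:
  assumes "pos_op R A" "pos_op R B" "x \<in> l2 R"
  shows "matrix_op R (mat_mult R A B) x = matrix_op R A (matrix_op R B x)"
  using assms matrix_op_mat_mult by (auto simp: pos_op_def)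

lemma mat_mult_assoc:
  assumes "pos_op R A" "pos_op R B" "pos_op R C"
  shows "matrix_op R (mat_mult R (mat_mult R A B) C) = matrix_op R (mat_mult R A (mat_mult R B C))"
  by (rule matrix_op_eqI) (simp add: matrix_op_mult pos_op_mult(1) pos_op_norm(1) assms)

lemma mat_mult_one:
  "matrix_op R (mat_mult R A mat_one) = matrix_op R A"
  "matrix_op R (mat_mult R mat_one A) = matrix_op R A"
proof -
  have 1: "(\<Sum>\<^sub>\<infinity>j\<in>R. A i j * mat_one j k) = A i k" if "k \<in> R" for i k
  proof -
    have "(\<Sum>\<^sub>\<infinity>j\<in>R. A i j * mat_one j k) = (\<Sum>\<^sub>\<infinity>j\<in>{k}. A i j * mat_one j k)"
      using that by (intro infsum_cong_neutral) (auto simp: mat_one_def)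
    then show ?thesis by (simp add: mat_one_def)
  qed
  have 2: "(\<Sum>\<^sub>\<infinity>j\<in>R. mat_one i j * A j k) = A i k" if "i \<in> R" for i k
  proof -
    have "(\<Sum>\<^sub>\<infinity>j\<in>R. mat_one i j * A j k) = (\<Sum>\<^sub>\<infinity>j\<in>{i}. mat_one i j * A j k)"
      using that by (intro infsum_cong_neutral) (auto simp: mat_one_def)
    then show ?thesis by (simp add: mat_one_def)
  qed
  show "matrix_op R (mat_mult R A mat_one) = matrix_op R A"
    "matrix_op R (mat_mult R mat_one A) = matrix_op R A"
    unfolding matrix_op_eq_iff mat_mult_def by (auto simp: 1 2)
qed

text \<open>The substantial half of the C*-identity. The squared norm of a finite section of A x is
  the form of a section product, whose entries are partial sums of the nonnegative series for the
  product of the adjoint with A. Hence the square root of the norm of that product is a form bound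
  for A.\<close>

lemma mat_norm_square_le:
  assumes "pos_op R A"
  shows "(mat_norm R A)\<^sup>2 \<le> mat_norm R (mat_mult R (mat_adjoint A) A)"
proof -
  let ?H = "mat_mult R (mat_adjoint A) A"
  have A: "nonneg_matrix R A" using assms by (simp add: pos_op_def)
  have H: "pos_op R ?H" using assms pos_op_mult(1) pos_op_adjoint(1) by blast
  define h where "h = mat_norm R ?H"
  have h: "0 \<le> h" unfolding h_def by (rule pos_op_norm(3)[OF H])
  have "form_bound R A (sqrt h)"
  proof (rule form_boundI)
    fix F G :: "nat set" and x y :: "nat \<Rightarrow> real"
    assume *: "finite F" "F \<subseteq> R" "finite G" "G \<subseteq> R" "\<And>i. 0 \<le> x i" "\<And>i. 0 \<le> y i"
    define z where "z i = (\<Sum>j\<in>G. A i j * x j)" for i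
    have Hle: "(\<Sum>i\<in>F. A i j * A i k) \<le> ?H j k" if "j \<in> R" "k \<in> R" for j k
      unfolding mat_mult_def mat_adjoint_def
      using pos_op_mult(3)[OF pos_op_adjoint(1)[OF assms] assms that] * A that
      by (intro finite_sum_le_infsum) (auto simp: mat_adjoint_def nonneg_matrix_def)
    have "(L2_set z F)\<^sup>2 = (\<Sum>i\<in>F. (z i)\<^sup>2)"
      by (simp add: L2_set_def sum_nonneg)
    also have "\<dots> = (\<Sum>i\<in>F. \<Sum>j\<in>G. \<Sum>k\<in>G. x j * (A i j * A i k) * x k)"
      unfolding z_def power2_eq_square sum_product by (simp add: mult_ac)
    also have "\<dots> = (\<Sum>j\<in>G. \<Sum>i\<in>F. \<Sum>k\<in>G. x j * (A i j * A i k) * x k)" by (rule sum.swap)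
    also have "\<dots> = (\<Sum>j\<in>G. \<Sum>k\<in>G. \<Sum>i\<in>F. x j * (A i j * A i k) * x k)"
      by (intro sum.cong refl sum.swap)
    also have "\<dots> = (\<Sum>j\<in>G. \<Sum>k\<in>G. x j * (\<Sum>i\<in>F. A i j * A i k) * x k)"
      by (simp add: sum_distrib_left sum_distrib_right)
    also have "\<dots> \<le> (\<Sum>j\<in>G. \<Sum>k\<in>G. x j * ?H j k * x k)"
      using * Hle by (intro sum_mono mult_right_mono mult_left_mono) (auto simp: subset_iff)
    also have "\<dots> \<le> h * L2_set x G * L2_set x G"
      unfolding h_def using * by (intro form_boundD[OF pos_op_norm(4)[OF H]]) auto
    also have "\<dots> = (sqrt h * L2_set x G)\<^sup>2"
      using h by (simp add: power_mult_distrib) (simp add: power2_eq_square)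
    finally have "(L2_set z F)\<^sup>2 \<le> (sqrt h * L2_set x G)\<^sup>2" .
    then have zF: "L2_set z F \<le> sqrt h * L2_set x G"
      by (rule power2_le_imp_le) (use h in auto)
    have "(\<Sum>i\<in>F. \<Sum>j\<in>G. y i * A i j * x j) = (\<Sum>i\<in>F. y i * z i)"
      by (simp add: z_def sum_distrib_left mult.assoc)
    also have "\<dots> \<le> (\<Sum>i\<in>F. \<bar>y i\<bar> * \<bar>z i\<bar>)"
      by (intro sum_mono) (metis abs_ge_self abs_mult)
    also have "\<dots> \<le> L2_set y F * L2_set z F" by (rule L2_set_mult_ineq)
    also have "\<dots> \<le> L2_set y F * (sqrt h * L2_set x G)"
      by (intro mult_left_mono zF) auto
    finally show "(\<Sum>i\<in>F. \<Sum>j\<in>G. y i * A i j * x j) \<le> sqrt h * L2_set y F * L2_set x G"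
      by (simp add: mult_ac)
  qed (use h in auto)
  from mat_norm_le[OF A this] have "(mat_norm R A)\<^sup>2 \<le> (sqrt h)\<^sup>2"
    using pos_op_norm(3)[OF assms] by (intro power_mono) auto
  then show ?thesis using h by (simp add: h_def)
qed

section \<open>Finite products\<close>

lemma mat_prod_Nil [simp]: "mat_prod R [] = mat_one"
  and mat_prod_Cons [simp]: "mat_prod R (A # As) = mat_mult R A (mat_prod R As)"
  by (simp_all add: mat_prod_def)

lemma pos_op_prod:
  assumes "\<And>A. A \<in> set As \<Longrightarrow> pos_op R A"
  shows "pos_op R (mat_prod R As)"
  using assms by (induction As) (auto simp: pos_op_one intro!: pos_op_mult(1))

lemma mat_prod_append:
  assumes "\<And>A. A \<in> set As \<union> set Bs \<Longrightarrow> pos_op R A"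
  shows "matrix_op R (mat_prod R (As @ Bs)) = matrix_op R (mat_mult R (mat_prod R As) (mat_prod R Bs))"
  using assms
proof (induction As)
  case (Cons A As)
  have "matrix_op R (mat_prod R ((A # As) @ Bs)) =
      matrix_op R (mat_mult R A (mat_mult R (mat_prod R As) (mat_prod R Bs)))"
    using Cons by (auto intro!: mat_mult_cong)
  also have "\<dots> = matrix_op R (mat_mult R (mat_mult R A (mat_prod R As)) (mat_prod R Bs))"
    using Cons.prems by (intro mat_mult_assoc[symmetric] pos_op_prod) auto
  finally show ?case by simp
qed (simp add: mat_mult_one)

lemma mat_norm_append_le:
  assumes "\<And>A. A \<in> set As \<union> set Bs \<Longrightarrow> pos_op R A"
  shows "mat_norm R (mat_prod R (As @ Bs)) \<le> mat_norm R (mat_prod R As) * mat_norm R (mat_prod R Bs)"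
proof -
  have "mat_norm R (mat_prod R (As @ Bs)) = mat_norm R (mat_mult R (mat_prod R As) (mat_prod R Bs))"
    by (intro mat_norm_cong mat_prod_append assms)
  also have "\<dots> \<le> mat_norm R (mat_prod R As) * mat_norm R (mat_prod R Bs)"
    using assms by (intro pos_op_mult(2) pos_op_prod) auto
  finally show ?thesis .
qed

lemma mat_prod_concat:
  assumes "\<And>As A. As \<in> set Ass \<Longrightarrow> A \<in> set As \<Longrightarrow> pos_op R A"
  shows "matrix_op R (mat_prod R (map (mat_prod R) Ass)) = matrix_op R (mat_prod R (concat Ass))"
  using assms
proof (induction Ass)
  case (Cons As Ass)
  have *: "\<And>B. B \<in> set As \<Longrightarrow> pos_op R B" "\<And>Bs B. Bs \<in> set Ass \<Longrightarrow> B \<in> set Bs \<Longrightarrow> pos_op R B"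
    using Cons.prems by auto
  have "matrix_op R (mat_prod R (concat (As # Ass))) =
      matrix_op R (mat_mult R (mat_prod R As) (mat_prod R (concat Ass)))"
    unfolding concat.simps by (rule mat_prod_append) (auto intro: *)
  also have "\<dots> = matrix_op R (mat_mult R (mat_prod R As) (mat_prod R (map (mat_prod R) Ass)))"
    using Cons.IH[OF *(2)] by (intro mat_mult_cong) auto
  finally show ?case by simp
qed simp

lemma mat_adjoint_mult: "mat_adjoint (mat_mult R A B) = mat_mult R (mat_adjoint B) (mat_adjoint A)"
  by (simp add: mat_adjoint_def mat_mult_def mult.commute)

lemma mat_adjoint_cong:
  "matrix_op R A = matrix_op R B \<Longrightarrow> matrix_op R (mat_adjoint A) = matrix_op R (mat_adjoint B)"
  by (simp add: matrix_op_eq_iff mat_adjoint_def)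

lemma mat_prod_rev_adjoint:
  assumes "\<And>A. A \<in> set As \<Longrightarrow> pos_op R A"
  shows "matrix_op R (mat_prod R (rev (map mat_adjoint As))) = matrix_op R (mat_adjoint (mat_prod R As))"
  using assms
proof (induction As)
  case (Cons A As)
  have "matrix_op R (mat_prod R (rev (map mat_adjoint (A # As)))) =
      matrix_op R (mat_mult R (mat_prod R (rev (map mat_adjoint As))) (mat_prod R [mat_adjoint A]))"
    using mat_prod_append[of "rev (map mat_adjoint As)" "[mat_adjoint A]" R] Cons.prems pos_op_adjoint(1)
    by auto
  also have "\<dots> = matrix_op R (mat_mult R (mat_adjoint (mat_prod R As)) (mat_adjoint A))"
    using Cons by (intro mat_mult_cong) (auto simp: mat_mult_one)
  finally show ?case by (simp add: mat_adjoint_mult)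
qed (simp add: mat_adjoint_def mat_one_def eq_commute cong: if_cong)

section \<open>Hadamard products of powers\<close>

definition hadamard :: "nat \<Rightarrow> real \<Rightarrow> (nat \<Rightarrow> matrix) \<Rightarrow> matrix" where
  "hadamard m \<alpha> A = (\<lambda>i k. \<Prod>j=1..m. A j i k powr \<alpha>)"

text \<open>Hoelder's inequality with m equal exponents of total at least 1. After each sum is
  normalised to 1, all terms lie between 0 and 1, so the power \<alpha> is at most the power 1/m,
  and the product of those is at most the arithmetic mean. A sum that vanishes cannot be normalised,
  but then its terms vanish and so does the left side.\<close>

lemma sum_prod_powr_le:
  fixes c :: "nat \<Rightarrow> 'a \<Rightarrow> real"
  assumes m: "1 \<le> m" and \<alpha>: "1 / real m \<le> \<alpha>" and F: "finite F"
    and c: "\<And>j n. j \<in> {1..m} \<Longrightarrow> n \<in> F \<Longrightarrow> 0 \<le> c j n"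
  shows "(\<Sum>n\<in>F. \<Prod>j=1..m. c j n powr \<alpha>) \<le> (\<Prod>j=1..m. (\<Sum>n\<in>F. c j n) powr \<alpha>)"
proof -
  define s where "s j = (\<Sum>n\<in>F. c j n)" for j
  have s0: "0 \<le> s j" if "j \<in> {1..m}" for j unfolding s_def using c that by (intro sum_nonneg) auto
  have cs: "c j n \<le> s j" if "j \<in> {1..m}" "n \<in> F" for j n
    unfolding s_def using c that F by (intro member_le_sum) auto
  have \<alpha>0: "0 < \<alpha>" using \<alpha> m by (smt (verit) divide_pos_pos of_nat_0_less_iff le_eq_less_or_eq One_nat_def Suc_le_eq)
  show ?thesis
  proof (cases "\<exists>j\<in>{1..m}. s j = 0")
    case True
    then obtain j where j: "j \<in> {1..m}" "s j = 0" by blast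
    then have "c j n = 0" if "n \<in> F" for n using c[OF j(1) that] cs[OF j(1) that] by simp
    then have "(\<Sum>n\<in>F. \<Prod>j=1..m. c j n powr \<alpha>) = 0"
      using j(1) by (intro sum.neutral ballI prod_zero) (auto intro!: bexI[of _ j])
    then show ?thesis by (simp add: prod_nonneg)
  next
    case False
    then have spos: "0 < s j" if "j \<in> {1..m}" for j using s0[OF that] that by fastforce
    have "(\<Sum>n\<in>F. \<Prod>j=1..m. (c j n / s j) powr \<alpha>) \<le> (\<Sum>n\<in>F. \<Sum>j=1..m. (c j n / s j) / m)"
    proof (rule sum_mono)
      fix n assume n: "n \<in> F"
      have d: "0 \<le> c j n / s j" "c j n / s j \<le> 1" if "j \<in> {1..m}" for j
        using c[OF that n] cs[OF that n] spos[OF that] by auto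
      have "(\<Prod>j=1..m. (c j n / s j) powr \<alpha>) \<le> (\<Prod>j=1..m. (c j n / s j) powr (1 / m))"
        using d \<alpha> by (intro prod_mono conjI powr_mono') auto
      also have "\<dots> = (\<Prod>j=1..m. c j n / s j) powr (1 / m)"
        by (rule prod_powr_distrib[symmetric])
      also have "\<dots> \<le> (\<Sum>j=1..m. (c j n / s j) / m)"
        using arith_geom_mean[of "{1..m}" "\<lambda>j. c j n / s j"] d m by auto
      finally show "(\<Prod>j=1..m. (c j n / s j) powr \<alpha>) \<le> (\<Sum>j=1..m. (c j n / s j) / m)" .
    qed
    also have "\<dots> = (\<Sum>j=1..m. (\<Sum>n\<in>F. c j n) / s j / m)"
      by (subst sum.swap) (simp add: sum_divide_distrib)
    also have "\<dots> = (\<Sum>j=1..m. 1 / m)"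
      using spos by (intro sum.cong refl) (metis divide_self less_irrefl s_def)
    also have "\<dots> = 1" using m by simp
    finally have le: "(\<Sum>n\<in>F. \<Prod>j=1..m. (c j n / s j) powr \<alpha>) \<le> 1" .
    have "(\<Sum>n\<in>F. \<Prod>j=1..m. c j n powr \<alpha>) =
        (\<Prod>j=1..m. s j powr \<alpha>) * (\<Sum>n\<in>F. \<Prod>j=1..m. (c j n / s j) powr \<alpha>)"
      unfolding sum_distrib_left prod.distrib[symmetric]
    proof (intro sum.cong prod.cong refl)
      fix n j assume "n \<in> F" "j \<in> {1..m}"
      then show "c j n powr \<alpha> = s j powr \<alpha> * (c j n / s j) powr \<alpha>"
        using c spos[of j] by (simp add: powr_divide)
    qed
    also have "\<dots> \<le> (\<Prod>j=1..m. s j powr \<alpha>)"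
      using mult_left_mono[OF le, of "\<Prod>j=1..m. s j powr \<alpha>"] by (simp add: prod_nonneg)
    finally show ?thesis by (simp add: s_def)
  qed
qed

text \<open>Write \<alpha> = b + 1/m. The b-th powers of the entries are bounded by those of the
  norms. What remains has exponent exactly 1/m, so y i and x k split into m equal roots, one for
  each factor, and Hoelder over the pairs (i, k) produces the forms of the single matrices.\<close>

lemma hadamard_norm:
  assumes m: "1 \<le> m" and \<alpha>: "1 / real m \<le> \<alpha>" and A: "\<And>j. j \<in> {1..m} \<Longrightarrow> pos_op R (A j)"
  shows "pos_op R (hadamard m \<alpha> A)"
    and "mat_norm R (hadamard m \<alpha> A) \<le> (\<Prod>j=1..m. mat_norm R (A j) powr \<alpha>)"
proof -
  define K where "K j = mat_norm R (A j)" for j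
  have K: "0 \<le> K j" "form_bound R (A j) (K j)" if "j \<in> {1..m}" for j
    unfolding K_def using pos_op_norm(3,4)[OF A[OF that]] by auto
  have A0: "0 \<le> A j i k" if "j \<in> {1..m}" "i \<in> R" "k \<in> R" for j i k
    using A that by (auto simp: pos_op_def nonneg_matrix_def)
  have nn: "nonneg_matrix R (hadamard m \<alpha> A)"
    by (auto simp: nonneg_matrix_def hadamard_def intro!: prod_nonneg)
  define b where "b = \<alpha> - 1 / real m"
  have b: "0 \<le> b" "\<alpha> = b + 1 / m" using \<alpha> by (auto simp: b_def)
  have fb: "form_bound R (hadamard m \<alpha> A) (\<Prod>j=1..m. K j powr \<alpha>)"
  proof (rule form_boundI)
    show "0 \<le> (\<Prod>j=1..m. K j powr \<alpha>)" by (simp add: prod_nonneg)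
    fix F G :: "nat set" and x y :: "nat \<Rightarrow> real"
    assume *: "finite F" "F \<subseteq> R" "finite G" "G \<subseteq> R" "\<And>i. 0 \<le> x i" "\<And>i. 0 \<le> y i"
    define c where "c j p = y (fst p) * A j (fst p) (snd p) * x (snd p)" for j p
    define D where "D = (\<Prod>j=1..m. K j powr b)"
    have c0: "0 \<le> c j p" if "j \<in> {1..m}" "p \<in> F \<times> G" for j p
      unfolding c_def using that * A0[of j "fst p" "snd p"] by (auto simp: subset_iff)
    have root_pow: "(\<Prod>j=1..m. t powr (1 / m)) = t" if "0 \<le> t" for t :: real
      using that m by (cases "t = 0") (auto simp: powr_power)
    have entry: "y i * hadamard m \<alpha> A i k * x k \<le> D * (\<Prod>j=1..m. c j (i, k) powr (1 / m))"
      if ik: "i \<in> F" "k \<in> G" for i k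
    proof -
      have "hadamard m \<alpha> A i k = (\<Prod>j=1..m. A j i k powr b * A j i k powr (1 / m))"
        unfolding hadamard_def b(2) powr_add ..
      also have "\<dots> \<le> (\<Prod>j=1..m. K j powr b * A j i k powr (1 / m))"
        using ik * b A0 K(2)
        by (intro prod_mono conjI mult_right_mono powr_mono2)
          (auto simp: subset_iff intro!: form_bound_entry[of R])
      also have "\<dots> = D * (\<Prod>j=1..m. A j i k powr (1 / m))"
        by (simp add: D_def prod.distrib)
      finally have "y i * hadamard m \<alpha> A i k * x k \<le> y i * (D * (\<Prod>j=1..m. A j i k powr (1 / m))) * x k"
        using * by (intro mult_right_mono mult_left_mono) auto
      also have "\<dots> = D * ((\<Prod>j=1..m. y i powr (1 / m)) * (\<Prod>j=1..m. A j i k powr (1 / m)) *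
          (\<Prod>j=1..m. x k powr (1 / m)))"
        using * by (simp only: root_pow) simp
      also have "\<dots> = D * (\<Prod>j=1..m. c j (i, k) powr (1 / m))"
        using * A0 ik unfolding prod.distrib[symmetric]
        by (intro arg_cong2[where f = "(*)"] refl prod.cong) (auto simp: c_def powr_mult subset_iff)
      finally show ?thesis .
    qed
    have "(\<Sum>i\<in>F. \<Sum>k\<in>G. y i * hadamard m \<alpha> A i k * x k) \<le>
        (\<Sum>i\<in>F. \<Sum>k\<in>G. D * (\<Prod>j=1..m. c j (i, k) powr (1 / m)))"
      by (intro sum_mono entry)
    also have "\<dots> = D * (\<Sum>p\<in>F \<times> G. \<Prod>j=1..m. c j p powr (1 / m))"
      by (simp add: sum_distrib_left sum.cartesian_product case_prod_unfold)
    also have "\<dots> \<le> D * (\<Prod>j=1..m. (\<Sum>p\<in>F \<times> G. c j p) powr (1 / m))"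
      using * c0 m by (intro mult_left_mono sum_prod_powr_le) (auto simp: D_def prod_nonneg)
    also have "\<dots> \<le> D * (\<Prod>j=1..m. (K j * L2_set y F * L2_set x G) powr (1 / m))"
    proof (intro mult_left_mono prod_mono conjI powr_mono2)
      fix j assume j: "j \<in> {1..m}"
      have "(\<Sum>p\<in>F \<times> G. c j p) = (\<Sum>i\<in>F. \<Sum>k\<in>G. y i * A j i k * x k)"
        by (simp add: c_def sum.cartesian_product case_prod_unfold)
      also have "\<dots> \<le> K j * L2_set y F * L2_set x G"
        using * by (intro form_boundD[OF K(2)[OF j]]) auto
      finally show "(\<Sum>p\<in>F \<times> G. c j p) \<le> K j * L2_set y F * L2_set x G" .
      show "0 \<le> (\<Sum>p\<in>F \<times> G. c j p)" by (intro sum_nonneg c0 j)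
    qed (auto simp: D_def prod_nonneg)
    also have "\<dots> = D * ((\<Prod>j=1..m. K j powr (1 / m)) * (\<Prod>j=1..m. L2_set y F powr (1 / m)) *
        (\<Prod>j=1..m. L2_set x G powr (1 / m)))"
      unfolding prod.distrib[symmetric] using K by (simp add: powr_mult)
    also have "\<dots> = (\<Prod>j=1..m. K j powr \<alpha>) * L2_set y F * L2_set x G"
      by (simp only: root_pow[OF L2_set_nonneg] D_def b(2) powr_add prod.distrib mult.assoc)
    finally show "(\<Sum>i\<in>F. \<Sum>k\<in>G. y i * hadamard m \<alpha> A i k * x k) \<le>
        (\<Prod>j=1..m. K j powr \<alpha>) * L2_set y F * L2_set x G" .
  qed
  show "pos_op R (hadamard m \<alpha> A)"
    "mat_norm R (hadamard m \<alpha> A) \<le> (\<Prod>j=1..m. mat_norm R (A j) powr \<alpha>)"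
    using form_bound_pos_op[OF nn fb] mat_norm_le[OF nn fb] by (auto simp: K_def)
qed

text \<open>Hoelder over the inner summation index, for each entry separately: finite partial sums
  are estimated first, and each of the m sums on the right is then enlarged to its full
  series.\<close>

lemma hadamard_mult_le:
  assumes m: "1 \<le> m" and \<alpha>: "1 / real m \<le> \<alpha>"
    and A: "\<And>j. j \<in> {1..m} \<Longrightarrow> pos_op R (A j)" and B: "\<And>j. j \<in> {1..m} \<Longrightarrow> pos_op R (B j)"
  shows "mat_le R (mat_mult R (hadamard m \<alpha> A) (hadamard m \<alpha> B))
    (hadamard m \<alpha> (\<lambda>j. mat_mult R (A j) (B j)))"
  unfolding mat_le_def
proof (intro ballI conjI)
  fix i k assume ik: "i \<in> R" "k \<in> R"
  have A0: "0 \<le> A j i k" if "j \<in> {1..m}" "i \<in> R" "k \<in> R" for j i k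
    using A that by (auto simp: pos_op_def nonneg_matrix_def)
  have B0: "0 \<le> B j i k" if "j \<in> {1..m}" "i \<in> R" "k \<in> R" for j i k
    using B that by (auto simp: pos_op_def nonneg_matrix_def)
  show "0 \<le> mat_mult R (hadamard m \<alpha> A) (hadamard m \<alpha> B) i k"
    unfolding mat_mult_def hadamard_def
    by (intro infsum_nonneg mult_nonneg_nonneg prod_nonneg) auto
  show "mat_mult R (hadamard m \<alpha> A) (hadamard m \<alpha> B) i k \<le> hadamard m \<alpha> (\<lambda>j. mat_mult R (A j) (B j)) i k"
    unfolding mat_mult_def
  proof (rule infsum_nonneg_le)
    show "0 \<le> hadamard m \<alpha> A i n * hadamard m \<alpha> B n k" for n
      by (auto simp: hadamard_def intro!: mult_nonneg_nonneg prod_nonneg)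
    fix F assume F: "finite F" "F \<subseteq> R"
    have "(\<Sum>n\<in>F. hadamard m \<alpha> A i n * hadamard m \<alpha> B n k) =
        (\<Sum>n\<in>F. \<Prod>j=1..m. (A j i n * B j n k) powr \<alpha>)"
      unfolding hadamard_def prod.distrib[symmetric] using A0 B0 ik F
      by (intro sum.cong prod.cong refl) (auto simp: powr_mult subset_iff)
    also have "\<dots> \<le> (\<Prod>j=1..m. (\<Sum>n\<in>F. A j i n * B j n k) powr \<alpha>)"
      using A0 B0 ik F by (intro sum_prod_powr_le m \<alpha>) (auto simp: subset_iff)
    also have "\<dots> \<le> (\<Prod>j=1..m. (\<Sum>\<^sub>\<infinity>n\<in>R. A j i n * B j n k) powr \<alpha>)"
    proof (intro prod_mono conjI powr_mono2)
      fix j assume j: "j \<in> {1..m}"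
      show "(\<Sum>n\<in>F. A j i n * B j n k) \<le> (\<Sum>\<^sub>\<infinity>n\<in>R. A j i n * B j n k)"
        using A0 B0 ik F j by (intro finite_sum_le_infsum pos_op_mult(3) A B) auto
      show "0 \<le> (\<Sum>n\<in>F. A j i n * B j n k)"
        using A0 B0 ik F j by (intro sum_nonneg mult_nonneg_nonneg) (auto simp: subset_iff)
      have "0 \<le> 1 / real m" by simp
      then show "0 \<le> \<alpha>" using \<alpha> by linarith
    qed auto
    finally show "(\<Sum>n\<in>F. hadamard m \<alpha> A i n * hadamard m \<alpha> B n k) \<le>
        hadamard m \<alpha> (\<lambda>j i k. \<Sum>\<^sub>\<infinity>n\<in>R. A j i n * B j n k) i k"
      by (simp add: hadamard_def)
  qed
qed

lemma mat_le_trans: "mat_le R A B \<Longrightarrow> mat_le R B C \<Longrightarrow> mat_le R A C"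
  unfolding mat_le_def by (meson order_trans)

lemma mat_le_refl: "pos_op R A \<Longrightarrow> mat_le R A A"
  by (auto simp: mat_le_def pos_op_def nonneg_matrix_def)

lemma hadamard_prod_le:
  assumes m: "1 \<le> m" and \<alpha>: "1 / real m \<le> \<alpha>"
    and A: "\<And>t j. t \<in> set ts \<Longrightarrow> j \<in> {1..m} \<Longrightarrow> pos_op R (A t j)"
  shows "mat_le R (mat_prod R (map (\<lambda>t. hadamard m \<alpha> (A t)) ts))
    (hadamard m \<alpha> (\<lambda>j. mat_prod R (map (\<lambda>t. A t j) ts)))"
  using A
proof (induction ts)
  case Nil
  \<comment> \<open>Off the diagonal this uses that \<open>0 powr \<alpha>\<close> is 0, and m \<ge>
    1 keeps the product from being empty.\<close>
  have "hadamard m \<alpha> (\<lambda>j. mat_one) = mat_one"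
    using m by (auto simp: hadamard_def mat_one_def fun_eq_iff)
  then show ?case by (simp add: mat_le_refl pos_op_one)
next
  case (Cons t ts)
  have p: "pos_op R (mat_prod R (map (\<lambda>t. A t j) ts))" if "j \<in> {1..m}" for j
    using Cons.prems that by (intro pos_op_prod) auto
  have "mat_le R (mat_mult R (hadamard m \<alpha> (A t)) (mat_prod R (map (\<lambda>t. hadamard m \<alpha> (A t)) ts)))
      (mat_mult R (hadamard m \<alpha> (A t)) (hadamard m \<alpha> (\<lambda>j. mat_prod R (map (\<lambda>t. A t j) ts))))"
    using Cons p by (intro mat_mult_mono mat_le_refl hadamard_norm(1) m \<alpha>) auto
  moreover have "mat_le R
      (mat_mult R (hadamard m \<alpha> (A t)) (hadamard m \<alpha> (\<lambda>j. mat_prod R (map (\<lambda>t. A t j) ts))))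
      (hadamard m \<alpha> (\<lambda>j. mat_mult R (A t j) (mat_prod R (map (\<lambda>t. A t j) ts))))"
    using Cons p by (intro hadamard_mult_le m \<alpha>) auto
  ultimately show ?case by (auto intro: mat_le_trans)
qed

section \<open>Submultiplicative sequences\<close>

text \<open>One good index d controls the whole sequence: after division by \<open>q ^ k\<close>,
  adding d to the index does not increase the value, so the finitely many residues modulo d bound
  everything.\<close>

lemma submult_le_power:
  fixes a :: "nat \<Rightarrow> real"
  assumes a0: "\<And>k. 0 \<le> a k" and sub: "\<And>j k. a (j + k) \<le> a j * a k"
    and d: "1 \<le> d" "a d \<le> q ^ d" and q: "0 < q"
  obtains C where "0 < C" "\<And>k. a k \<le> C * q ^ k"
proof -
  define b where "b k = a k / q ^ k" for k
  have b0: "0 \<le> b k" for k using a0 q by (simp add: b_def)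
  have bsub: "b (j + k) \<le> b j * b k" for j k
    using sub[of j k] q by (simp add: b_def power_add divide_right_mono)
  have bd: "b d \<le> 1" using d q by (simp add: b_def)
  have step: "b (n * d + r) \<le> b r" for n r
  proof (induction n)
    case (Suc n)
    have "b (Suc n * d + r) \<le> b d * b (n * d + r)"
      using bsub[of d "n * d + r"] by (simp add: add.assoc)
    also have "\<dots> \<le> 1 * b r" by (intro mult_mono bd Suc b0) auto
    finally show ?case by simp
  qed simp
  \<comment> \<open>The added 1 keeps the constant positive when all the residue values are
    0.\<close>
  have "a k \<le> (1 + (\<Sum>r<d. b r)) * q ^ k" for k
  proof -
    have "b k \<le> b (k mod d)" using step[of "k div d" "k mod d"] by simp
    also have "\<dots> \<le> (\<Sum>r<d. b r)"
      using d by (intro member_le_sum b0) auto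
    finally have "a k / q ^ k \<le> 1 + (\<Sum>r<d. b r)" by (simp add: b_def)
    then show ?thesis using q by (simp add: pos_divide_le_eq)
  qed
  moreover have "0 < 1 + (\<Sum>r<d. b r)" by (intro add_pos_nonneg sum_nonneg b0) auto
  ultimately show ?thesis using that by blast
qed

lemma root_tendsto_le:
  fixes a :: "nat \<Rightarrow> real"
  assumes "(\<lambda>k. root k (a k)) \<longlonglongrightarrow> L" "0 < C" "0 \<le> q"
    and "\<forall>\<^sub>F k in sequentially. a k \<le> C * q ^ k"
  shows "L \<le> q"
proof (rule tendsto_le[OF _ _ assms(1)])
  show "(\<lambda>k. root k C * q) \<longlonglongrightarrow> q"
    using tendsto_mult[OF LIMSEQ_root_const[OF assms(2)] tendsto_const[of q]] by simp
  show "\<forall>\<^sub>F k in sequentially. root k (a k) \<le> root k C * q"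
    using assms(4) eventually_ge_at_top[of 1]
  proof eventually_elim
    case (elim k)
    then have "root k (a k) \<le> root k (C * q ^ k)" by simp
    also have "\<dots> = root k C * q"
      using elim assms(3) by (simp add: real_root_mult real_root_power_cancel)
    finally show ?case .
  qed
qed simp

text \<open>Fekete's lemma, with the infimum of the roots as limit. The last conclusion, a geometric
  bound for every q above the limit, is the form in which the growth rate enters the Neumann series
  and the commutation argument.\<close>

lemma submult_root_tendsto:
  fixes a :: "nat \<Rightarrow> real"
  assumes a0: "\<And>k. 0 \<le> a k" and sub: "\<And>j k. a (j + k) \<le> a j * a k"
  obtains L where "0 \<le> L" "(\<lambda>k. root k (a k)) \<longlonglongrightarrow> L" "\<And>k. 1 \<le> k \<Longrightarrow> L ^ k \<le> a k"
    "\<And>q. L < q \<Longrightarrow> \<exists>C>0. \<forall>k. a k \<le> C * q ^ k"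
proof -
  \<comment> \<open>Index 0 has to be left out: \<open>root 0\<close> is constantly 0 and would make
    the infimum 0.\<close>
  define L where "L = (INF k\<in>{1..}. root k (a k))"
  have bdd: "bdd_below ((\<lambda>k. root k (a k)) ` {1..})"
    using a0 by (intro bdd_belowI2[where m = 0]) auto
  have L0: "0 \<le> L" unfolding L_def using a0 by (intro cINF_greatest) auto
  have Lle: "L \<le> root k (a k)" if "1 \<le> k" for k
    unfolding L_def using that by (intro cINF_lower bdd) auto
  have pow: "L ^ k \<le> a k" if "1 \<le> k" for k
  proof -
    have "L ^ k \<le> root k (a k) ^ k" using Lle[OF that] L0 by (rule power_mono)
    then show ?thesis using that a0 by simp
  qed
  have growth: "\<exists>C>0. \<forall>k. a k \<le> C * q ^ k" if q: "L < q" for q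
  proof -
    have "q > 0" using q L0 by linarith
    obtain d where d: "1 \<le> d" "root d (a d) < q"
      using q cINF_less_iff[OF _ bdd, of q] unfolding L_def by auto
    have "root d (a d) ^ d \<le> q ^ d" using d a0 by (intro power_mono) auto
    then have "a d \<le> q ^ d" using d a0 by simp
    then obtain C where "0 < C" "\<And>k. a k \<le> C * q ^ k"
      using submult_le_power[OF a0 sub d(1) _ \<open>q > 0\<close>] by blast
    then show ?thesis by blast
  qed
  have lim: "(\<lambda>k. root k (a k)) \<longlonglongrightarrow> L"
  proof (rule order_tendstoI)
    fix y assume "y < L"
    show "\<forall>\<^sub>F k in sequentially. y < root k (a k)"
      using eventually_ge_at_top[of 1] by eventually_elim (use Lle \<open>y < L\<close> in force)
  next
    fix y assume y: "L < y"
    define q where "q = (L + y) / 2"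
    have q: "L < q" "q < y" "0 < q" using y L0 by (auto simp: q_def)
    obtain C where C: "0 < C" "\<And>k. a k \<le> C * q ^ k" using growth[OF q(1)] by blast
    have "(\<lambda>k. root k C * q) \<longlonglongrightarrow> q"
      using tendsto_mult[OF LIMSEQ_root_const[OF C(1)] tendsto_const[of q]] by simp
    then have "\<forall>\<^sub>F k in sequentially. root k C * q < y" using q(2) by (rule order_tendstoD)
    then show "\<forall>\<^sub>F k in sequentially. root k (a k) < y"
      using eventually_ge_at_top[of 1]
    proof eventually_elim
      case (elim k)
      have "root k (a k) \<le> root k (C * q ^ k)" using elim C by simp
      also have "\<dots> = root k C * q" using elim q by (simp add: real_root_mult real_root_power_cancel)
      finally show ?case using elim by simp
    qed
  qed
  show ?thesis by (rule that[OF L0 lim pow growth])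
qed

section \<open>Bounded sets of positive operators\<close>

lemma nonneg_Sup_upper: "bdd_above X \<Longrightarrow> x \<in> X \<Longrightarrow> x \<le> nonneg_Sup X"
  unfolding nonneg_Sup_def by (intro cSup_upper) auto

lemma nonneg_Sup_nonneg: "bdd_above X \<Longrightarrow> 0 \<le> nonneg_Sup X"
  unfolding nonneg_Sup_def by (intro cSup_upper) auto

lemma nonneg_Sup_least: "0 \<le> K \<Longrightarrow> (\<And>x. x \<in> X \<Longrightarrow> x \<le> K) \<Longrightarrow> nonneg_Sup X \<le> K"
  unfolding nonneg_Sup_def by (intro cSup_least) auto

definition pos_set :: "nat set \<Rightarrow> matrix set \<Rightarrow> bool" where
  "pos_set R \<Sigma> \<longleftrightarrow> (\<forall>A\<in>\<Sigma>. pos_op R A) \<and> bounded_matrices R \<Sigma>"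

lemma pos_setI:
  assumes "\<And>A. A \<in> \<Sigma> \<Longrightarrow> pos_op R A" "\<And>A. A \<in> \<Sigma> \<Longrightarrow> mat_norm R A \<le> K"
  shows "pos_set R \<Sigma>"
  using assms by (auto simp: pos_set_def bounded_matrices_def bdd_above_def)

lemma pos_set_norm:
  assumes "pos_set R \<Sigma>"
  shows "A \<in> \<Sigma> \<Longrightarrow> pos_op R A" and "A \<in> \<Sigma> \<Longrightarrow> mat_norm R A \<le> set_norm R \<Sigma>"
    and "0 \<le> set_norm R \<Sigma>"
  using assms unfolding pos_set_def bounded_matrices_def set_norm_def
  by (auto intro: nonneg_Sup_upper nonneg_Sup_nonneg)

lemma set_norm_least: "0 \<le> K \<Longrightarrow> (\<And>A. A \<in> \<Sigma> \<Longrightarrow> mat_norm R A \<le> K) \<Longrightarrow> set_norm R \<Sigma> \<le> K"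
  unfolding set_norm_def by (rule nonneg_Sup_least) auto

lemma pos_set_singleton: "pos_op R A \<Longrightarrow> pos_set R {A}"
  by (rule pos_setI[where K = "mat_norm R A"]) auto

section \<open>Products of sets as images of sets of lists\<close>

lemma in_listset_iff: "As \<in> listset Ls \<longleftrightarrow> list_all2 (\<in>) As Ls"
proof (induction Ls arbitrary: As)
  case (Cons L Ls)
  then show ?case by (cases As) (auto simp: set_Cons_def)
qed auto

lemma listset_append: "listset (Ls @ Ms) = {As @ Bs | As Bs. As \<in> listset Ls \<and> Bs \<in> listset Ms}"
proof (rule set_eqI, rule iffI)
  fix xs assume "xs \<in> listset (Ls @ Ms)"
  then obtain us vs where "xs = us @ vs" "us \<in> listset Ls" "vs \<in> listset Ms"
    by (auto simp: in_listset_iff list_all2_append2)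
  then show "xs \<in> {As @ Bs | As Bs. As \<in> listset Ls \<and> Bs \<in> listset Ms}" by blast
qed (auto simp: in_listset_iff intro: list_all2_appendI)

lemma in_listset_pos_op:
  assumes "As \<in> listset Ls" "\<And>L. L \<in> set Ls \<Longrightarrow> pos_set R L" "A \<in> set As"
  shows "pos_op R A"
  using assms by (auto simp: in_listset_iff list_all2_conv_all_nth in_set_conv_nth) (metis nth_mem pos_set_norm(1))

lemma pos_set_prod:
  assumes "\<And>L. L \<in> set Ls \<Longrightarrow> pos_set R L"
  shows "pos_set R (set_prod R Ls)"
proof -
  have "\<exists>K\<ge>0. \<forall>As\<in>listset Ls. mat_norm R (mat_prod R As) \<le> K"
    using assms
  proof (induction Ls)
    case Nil
    then show ?case using mat_norm_one_le by (auto intro!: exI[of _ 1])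
  next
    case (Cons L Ls)
    then obtain K where K: "K \<ge> 0" "\<And>As. As \<in> listset Ls \<Longrightarrow> mat_norm R (mat_prod R As) \<le> K"
      by auto
    have "mat_norm R (mat_prod R As) \<le> set_norm R L * K" if As: "As \<in> listset (L # Ls)" for As
    proof -
      obtain B Bs where B: "As = B # Bs" "B \<in> L" "Bs \<in> listset Ls"
        using As by (auto simp: set_Cons_def)
      have L: "pos_set R L" "\<And>L. L \<in> set Ls \<Longrightarrow> pos_set R L" using Cons.prems by auto
      have Bs: "pos_op R A" if "A \<in> set Bs" for A
        using in_listset_pos_op[OF B(3) _ that] L(2) by blast
      have "mat_norm R (mat_prod R As) \<le> mat_norm R B * mat_norm R (mat_prod R Bs)"
        unfolding B mat_prod_Cons
        by (rule pos_op_mult(2)[OF pos_set_norm(1)[OF L(1) B(2)] pos_op_prod[OF Bs]])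
      also have "\<dots> \<le> set_norm R L * K"
        by (intro mult_mono pos_set_norm(2)[OF L(1) B(2)] K(2)[OF B(3)] pos_set_norm(3)[OF L(1)]
            pos_op_norm(3) pos_op_prod Bs)
      finally show ?thesis .
    qed
    moreover have "0 \<le> set_norm R L * K" using K Cons.prems by (auto intro!: mult_nonneg_nonneg pos_set_norm)
    ultimately show ?case by blast
  qed
  then obtain K where "\<forall>As\<in>listset Ls. mat_norm R (mat_prod R As) \<le> K" by blast
  then show ?thesis
    unfolding set_prod_def using in_listset_pos_op[OF _ assms]
    by (intro pos_setI[where K = K]) (auto intro!: pos_op_prod)
qed

lemma pos_set_power: "pos_set R \<Sigma> \<Longrightarrow> pos_set R (set_power R \<Sigma> k)"
  unfolding set_power_def by (rule pos_set_prod) auto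

lemma set_norm_append_le:
  assumes "\<And>L. L \<in> set Ls \<union> set Ms \<Longrightarrow> pos_set R L"
  shows "set_norm R (set_prod R (Ls @ Ms)) \<le> set_norm R (set_prod R Ls) * set_norm R (set_prod R Ms)"
proof (rule set_norm_least)
  have ps: "pos_set R (set_prod R Ls)" "pos_set R (set_prod R Ms)"
    using assms by (auto intro!: pos_set_prod)
  show "0 \<le> set_norm R (set_prod R Ls) * set_norm R (set_prod R Ms)"
    using ps by (intro mult_nonneg_nonneg pos_set_norm)
  fix A assume "A \<in> set_prod R (Ls @ Ms)"
  then obtain As Bs where A: "A = mat_prod R (As @ Bs)" "As \<in> listset Ls" "Bs \<in> listset Ms"
    by (auto simp: set_prod_def listset_append)
  have p: "pos_op R C" if "C \<in> set As \<union> set Bs" for C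
    using that in_listset_pos_op[OF A(2)] in_listset_pos_op[OF A(3)] assms by blast
  have "mat_norm R A \<le> mat_norm R (mat_prod R As) * mat_norm R (mat_prod R Bs)"
    unfolding A by (rule mat_norm_append_le[OF p])
  also have "\<dots> \<le> set_norm R (set_prod R Ls) * set_norm R (set_prod R Ms)"
    using A p
    by (intro mult_mono pos_set_norm(2)[OF ps(1)] pos_set_norm(2)[OF ps(2)] pos_set_norm(3)[OF ps(1)]
        pos_op_norm(3) pos_op_prod) (auto simp: set_prod_def)
  finally show "mat_norm R A \<le> set_norm R (set_prod R Ls) * set_norm R (set_prod R Ms)" .
qed

lemma listset_replicate_listset:
  "listset (concat (replicate k Ls)) = concat ` listset (replicate k (listset Ls))"
proof (induction k)
  case (Suc k)
  show ?case
    unfolding replicate_Suc concat.simps listset_append Suc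
    by (auto simp: set_Cons_def image_iff) (metis concat.simps(2))+
qed auto

lemma listset_map_image: "listset (map ((`) f) Ls) = map f ` listset Ls"
proof (induction Ls)
  case (Cons L Ls)
  show ?case
  proof (rule set_eqI)
    fix As
    show "As \<in> listset (map ((`) f) (L # Ls)) \<longleftrightarrow> As \<in> map f ` listset (L # Ls)"
      using Cons by (cases As) (auto simp: set_Cons_def image_iff Bex_def, (metis list.simps(9))?)
  qed
qed auto

text \<open>Flattens a power of a product to one long list of factors, on which cyclic permutation
  and reversal become list operations. The sets agree only as sets of operators because
  reassociation is valid only over R.\<close>

lemma set_power_set_prod:
  assumes "\<And>L. L \<in> set Ls \<Longrightarrow> pos_set R L"
  shows "matrix_op R ` set_power R (set_prod R Ls) k = matrix_op R ` set_prod R (concat (replicate k Ls))"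
proof -
  have "set_power R (set_prod R Ls) k = (\<lambda>Ass. mat_prod R (map (mat_prod R) Ass)) ` listset (replicate k (listset Ls))"
    unfolding set_power_def set_prod_def using listset_map_image[of "mat_prod R" "replicate k (listset Ls)"]
    by (simp add: image_image)
  also have "matrix_op R ` \<dots> = (\<lambda>Ass. matrix_op R (mat_prod R (concat Ass))) ` listset (replicate k (listset Ls))"
    unfolding image_image
  proof (intro image_cong refl mat_prod_concat)
    fix Ass As A assume *: "Ass \<in> listset (replicate k (listset Ls))" "As \<in> set Ass" "A \<in> set As"
    then have "As \<in> listset Ls"
      by (auto simp: in_listset_iff[of Ass] list_all2_conv_all_nth in_set_conv_nth)
    then show "pos_op R A" using in_listset_pos_op assms *(3) by blast
  qed
  finally show ?thesis
    by (simp add: set_prod_def listset_replicate_listset image_image)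
qed

section \<open>The joint spectral radius of a bounded set\<close>

lemma joint_spectral_radius:
  assumes "pos_set R \<Sigma>"
  shows "0 \<le> joint_spectral_radius R \<Sigma>"
    and "(\<lambda>k. root k (set_norm R (set_power R \<Sigma> k))) \<longlonglongrightarrow> joint_spectral_radius R \<Sigma>"
    and "1 \<le> k \<Longrightarrow> joint_spectral_radius R \<Sigma> ^ k \<le> set_norm R (set_power R \<Sigma> k)"
    and "joint_spectral_radius R \<Sigma> < q \<Longrightarrow> \<exists>C>0. \<forall>k. set_norm R (set_power R \<Sigma> k) \<le> C * q ^ k"
proof -
  define a where "a k = set_norm R (set_power R \<Sigma> k)" for k
  have a0: "0 \<le> a k" for k unfolding a_def by (intro pos_set_norm pos_set_power assms)
  have sub: "a (j + k) \<le> a j * a k" for j k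
    unfolding a_def set_power_def replicate_add using assms by (intro set_norm_append_le) auto
  obtain L where L: "0 \<le> L" "(\<lambda>k. root k (a k)) \<longlonglongrightarrow> L" "\<And>k. 1 \<le> k \<Longrightarrow> L ^ k \<le> a k"
    "\<And>q. L < q \<Longrightarrow> \<exists>C>0. \<forall>k. a k \<le> C * q ^ k"
    using submult_root_tendsto[OF a0 sub] by blast
  have "joint_spectral_radius R \<Sigma> = L"
    unfolding joint_spectral_radius_def a_def[symmetric] using L(2) by (rule limI)
  then show "0 \<le> joint_spectral_radius R \<Sigma>"
    and "(\<lambda>k. root k (set_norm R (set_power R \<Sigma> k))) \<longlonglongrightarrow> joint_spectral_radius R \<Sigma>"
    and "1 \<le> k \<Longrightarrow> joint_spectral_radius R \<Sigma> ^ k \<le> set_norm R (set_power R \<Sigma> k)"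
    and "joint_spectral_radius R \<Sigma> < q \<Longrightarrow> \<exists>C>0. \<forall>k. set_norm R (set_power R \<Sigma> k) \<le> C * q ^ k"
    using L by (auto simp: a_def)
qed

lemma joint_spectral_radius_le:
  assumes "pos_set R \<Sigma>" "0 < C" "0 \<le> q"
    and "\<And>k. 1 \<le> k \<Longrightarrow> set_norm R (set_power R \<Sigma> k) \<le> C * q ^ k"
  shows "joint_spectral_radius R \<Sigma> \<le> q"
  using assms(4)
  by (intro root_tendsto_le[OF joint_spectral_radius(2)[OF assms(1)] assms(2,3)] eventually_sequentiallyI[of 1])

lemma set_norm_cong:
  assumes "matrix_op R ` \<Sigma> = matrix_op R ` \<Sigma>'"
  shows "set_norm R \<Sigma> = set_norm R \<Sigma>'"
proof -
  have "mat_norm R ` X = operator_norm R ` matrix_op R ` X" for X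
    by (simp add: mat_norm_def image_image)
  then show ?thesis by (simp add: set_norm_def assms)
qed

lemma set_norm_power_prod:
  assumes "\<And>L. L \<in> set Ls \<Longrightarrow> pos_set R L"
  shows "set_norm R (set_power R (set_prod R Ls) k) = set_norm R (set_prod R (concat (replicate k Ls)))"
  by (rule set_norm_cong) (rule set_power_set_prod[OF assms])

lemma concat_replicate_append:
  "concat (replicate (Suc k) (xs @ ys)) = xs @ concat (replicate k (ys @ xs)) @ ys"
  by (induction k) auto

text \<open>The k-th power of one product is the (k-1)-st power of the other between two outer
  pieces. These cost a factor independent of k, which disappears under the k-th root.\<close>

lemma joint_spectral_radius_commute_le:
  assumes "\<And>L. L \<in> set Ls \<union> set Ms \<Longrightarrow> pos_set R L"
  shows "joint_spectral_radius R (set_prod R (Ls @ Ms)) \<le> joint_spectral_radius R (set_prod R (Ms @ Ls))"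
proof (rule dense_ge)
  fix q assume q: "joint_spectral_radius R (set_prod R (Ms @ Ls)) < q"
  have ps: "pos_set R (set_prod R Ls')" if "set Ls' \<subseteq> set Ls \<union> set Ms" for Ls'
    using that assms by (intro pos_set_prod) auto
  have nn: "0 \<le> set_norm R (set_prod R Ls')" if "set Ls' \<subseteq> set Ls \<union> set Ms" for Ls'
    using ps[OF that] by (rule pos_set_norm)
  have q0: "0 < q" using q joint_spectral_radius(1)[OF ps[of "Ms @ Ls"]] by auto
  obtain C where C: "C > 0" "\<And>k. set_norm R (set_power R (set_prod R (Ms @ Ls)) k) \<le> C * q ^ k"
    using joint_spectral_radius(4)[OF ps q] by auto
  define D where "D = set_norm R (set_prod R Ls) * set_norm R (set_prod R Ms)"
  have D: "0 \<le> D" unfolding D_def by (intro mult_nonneg_nonneg nn) auto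
  show "joint_spectral_radius R (set_prod R (Ls @ Ms)) \<le> q"
  proof (rule joint_spectral_radius_le)
    fix k :: nat assume "1 \<le> k"
    then obtain l where k: "k = Suc l" by (cases k) auto
    have *: "\<And>L. L \<in> set (concat (replicate l (Ms @ Ls))) \<Longrightarrow> L \<in> set Ls \<union> set Ms" for l
      by (induction l) auto
    have "set_norm R (set_power R (set_prod R (Ls @ Ms)) k) =
        set_norm R (set_prod R (Ls @ concat (replicate l (Ms @ Ls)) @ Ms))"
      unfolding k using assms by (subst set_norm_power_prod) (auto simp: concat_replicate_append simp del: replicate_Suc)
    also have "\<dots> \<le> set_norm R (set_prod R Ls) * set_norm R (set_prod R (concat (replicate l (Ms @ Ls)) @ Ms))"
      using assms * by (intro set_norm_append_le) (auto 4 4)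
    also have "\<dots> \<le> set_norm R (set_prod R Ls) *
        (set_norm R (set_prod R (concat (replicate l (Ms @ Ls)))) * set_norm R (set_prod R Ms))"
      using assms * by (intro mult_left_mono nn set_norm_append_le) (auto 4 4)
    also have "\<dots> = D * set_norm R (set_power R (set_prod R (Ms @ Ls)) l)"
      using assms by (subst set_norm_power_prod) (auto simp: D_def mult_ac)
    \<comment> \<open>\<open>D + 1\<close> replaces D because D may be 0 and the constant must be
      positive; the later division by q accounts for the exponent l = k - 1.\<close>
    also have "\<dots> \<le> (D + 1) * (C * q ^ l)"
      using D C q0 by (intro mult_mono C pos_set_norm(3) pos_set_power ps) auto
    also have "\<dots> = (D + 1) * C / q * q ^ k" using q0 by (simp add: k)
    finally show "set_norm R (set_power R (set_prod R (Ls @ Ms)) k) \<le> (D + 1) * C / q * q ^ k" .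
  qed (use C D q0 ps[of "Ls @ Ms"] in auto)
qed

lemma joint_spectral_radius_commute:
  assumes "\<And>L. L \<in> set Ls \<union> set Ms \<Longrightarrow> pos_set R L"
  shows "joint_spectral_radius R (set_prod R (Ls @ Ms)) = joint_spectral_radius R (set_prod R (Ms @ Ls))"
  using assms by (intro antisym joint_spectral_radius_commute_le) auto

section \<open>The spectral radius of a positive operator\<close>

lemma matrix_op_add:
  assumes "pos_op R A" "x \<in> l2 R" "y \<in> l2 R"
  shows "matrix_op R A (\<lambda>i. x i + y i) = (\<lambda>i. matrix_op R A x i + matrix_op R A y i)"
  using assms unfolding matrix_op_def pos_op_def defines_operator_def
  by (auto simp: algebra_simps infsum_add)

lemma matrix_op_scale: "matrix_op R A (\<lambda>i. c * x i) = (\<lambda>i. c * matrix_op R A x i)"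
proof
  fix i
  have "(\<Sum>\<^sub>\<infinity>j\<in>R. complex_of_real (A i j) * (c * x j)) = (\<Sum>\<^sub>\<infinity>j\<in>R. c * (complex_of_real (A i j) * x j))"
    by (simp add: mult_ac)
  then show "matrix_op R A (\<lambda>i. c * x i) i = c * matrix_op R A x i"
    by (simp add: matrix_op_def infsum_cmult_right')
qed

lemma matrix_op_diff:
  assumes "pos_op R A" "x \<in> l2 R" "y \<in> l2 R"
  shows "matrix_op R A (\<lambda>i. x i - y i) = (\<lambda>i. matrix_op R A x i - matrix_op R A y i)"
  using matrix_op_add[OF assms(1,2) l2_scale[OF assms(3), of "-1"]] matrix_op_scale[of R A "-1" y]
  by simp

lemma matrix_op_sum:
  assumes "pos_op R A" "finite S" "\<And>k. k \<in> S \<Longrightarrow> v k \<in> l2 R"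
  shows "matrix_op R A (\<lambda>i. \<Sum>k\<in>S. v k i) = (\<lambda>i. \<Sum>k\<in>S. matrix_op R A (v k) i)"
  using assms(2,3)
proof (induction S rule: finite_induct)
  case empty
  show ?case using matrix_op_scale[of R A 0 "\<lambda>_. 0"] by simp
next
  case (insert k S)
  have "matrix_op R A (\<lambda>i. v k i + (\<Sum>k\<in>S. v k i)) =
      (\<lambda>i. matrix_op R A (v k) i + matrix_op R A (\<lambda>i. \<Sum>k\<in>S. v k i) i)"
    using insert.prems insert.hyps by (intro matrix_op_add[OF assms(1)] l2_sum(1)) auto
  then show ?case using insert by simp
qed

text \<open>The sum minus a partial sum is again a series, with norm at most a tail of the norms.
  Boundedness of the operator sends the image of this tail to 0 in every entry.\<close>

lemma matrix_op_series:
  assumes A: "pos_op R A" and v: "\<And>k. v k \<in> l2 R" and s: "summable (\<lambda>k. l2_norm R (v k))"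
  shows "(\<lambda>k. matrix_op R A (v k) i) sums matrix_op R A (\<lambda>i. \<Sum>k. v k i) i"
proof -
  define X where "X = (\<lambda>i. \<Sum>k. v k i)"
  define K where "K = mat_norm R A"
  define e where "e n = (\<Sum>k. l2_norm R (v (k + n)))" for n
  have X: "X \<in> l2 R" unfolding X_def by (rule l2_series[OF v s])
  have "e n = (\<Sum>k. l2_norm R (v k)) - (\<Sum>k<n. l2_norm R (v k))" for n
    unfolding e_def by (rule suminf_minus_initial_segment[OF s])
  then have "e \<longlonglongrightarrow> (\<Sum>k. l2_norm R (v k)) - (\<Sum>k. l2_norm R (v k))"
    using tendsto_diff[OF tendsto_const summable_LIMSEQ[OF s]] by presburger
  then have e: "(\<lambda>n. K * e n) \<longlonglongrightarrow> 0"
    using tendsto_mult[OF tendsto_const[of K]] by fastforce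
  have le: "cmod ((\<Sum>k<n. matrix_op R A (v k) i) - matrix_op R A X i) \<le> K * e n" for n
  proof -
    define Y where "Y = (\<lambda>i. \<Sum>k<n. v k i)"
    have Y: "Y \<in> l2 R" unfolding Y_def by (intro l2_sum v) auto
    have XY: "(\<lambda>i. X i - Y i) = (\<lambda>i. \<Sum>k. v (k + n) i)"
    proof
      fix i
      show "X i - Y i = (\<Sum>k. v (k + n) i)"
        unfolding X_def Y_def by (rule suminf_minus_initial_segment[OF l2_series(1)[OF v s], symmetric])
    qed
    have s': "summable (\<lambda>k. l2_norm R (v (k + n)))" using s by (rule summable_ignore_initial_segment)
    have "(\<Sum>k<n. matrix_op R A (v k) i) - matrix_op R A X i = - matrix_op R A (\<lambda>i. X i - Y i) i"
      unfolding matrix_op_diff[OF A X Y] by (simp add: Y_def matrix_op_sum A v)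
    then have "cmod ((\<Sum>k<n. matrix_op R A (v k) i) - matrix_op R A X i) = cmod (matrix_op R A (\<lambda>i. X i - Y i) i)"
      by simp
    also have "\<dots> \<le> l2_norm R (matrix_op R A (\<lambda>i. X i - Y i))"
      by (intro l2_entry_le pos_op_norm A l2_diff X Y)
    also have "\<dots> \<le> K * l2_norm R (\<lambda>i. X i - Y i)"
      unfolding K_def by (intro pos_op_norm A l2_diff X Y)
    also have "\<dots> \<le> K * e n"
      unfolding XY e_def K_def by (intro mult_left_mono l2_series(3) v s' pos_op_norm(3) A)
    finally show ?thesis .
  qed
  have "(\<lambda>n. (\<Sum>k<n. matrix_op R A (v k) i) - matrix_op R A X i) \<longlonglongrightarrow> 0"
    using le by (intro Lim_null_comparison[OF _ e]) auto
  then show ?thesis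
    unfolding sums_def X_def[symmetric] by (simp add: LIM_zero_iff)
qed

lemma matrix_op_one: "x \<in> l2 R \<Longrightarrow> matrix_op R mat_one x = x"
proof
  fix i assume x: "x \<in> l2 R"
  have "(\<Sum>\<^sub>\<infinity>j\<in>R. complex_of_real (mat_one i j) * x j) = x i" if "i \<in> R"
  proof -
    have "(\<Sum>\<^sub>\<infinity>j\<in>R. complex_of_real (mat_one i j) * x j) = (\<Sum>\<^sub>\<infinity>j\<in>{i}. complex_of_real (mat_one i j) * x j)"
      using that by (intro infsum_cong_neutral) (auto simp: mat_one_def)
    then show ?thesis by (simp add: mat_one_def)
  qed
  then show "matrix_op R mat_one x i = x i"
    using l2_outside[OF x] by (simp add: matrix_op_def)
qed

abbreviation mat_pow :: "nat set \<Rightarrow> matrix \<Rightarrow> nat \<Rightarrow> matrix" where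
  "mat_pow R A k \<equiv> mat_prod R (replicate k A)"

lemma pos_op_pow: "pos_op R A \<Longrightarrow> pos_op R (mat_pow R A k)"
  by (rule pos_op_prod) auto

lemma matrix_op_pow:
  assumes "pos_op R A" "x \<in> l2 R"
  shows "matrix_op R (mat_pow R A k) x = (matrix_op R A ^^ k) x"
  using assms(2)
proof (induction k)
  case (Suc k)
  then show ?case by (simp add: matrix_op_mult assms(1) pos_op_pow)
qed (simp add: matrix_op_one)

lemma l2_pow: "pos_op R A \<Longrightarrow> x \<in> l2 R \<Longrightarrow> (matrix_op R A ^^ k) x \<in> l2 R"
  by (metis matrix_op_pow pos_op_norm(1) pos_op_pow)

lemma matrix_op_nonneg:
  assumes "pos_op R A" "x \<in> l2 R" "\<And>i. x i \<in> \<real>\<^sub>\<ge>\<^sub>0"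
  shows "matrix_op R A x i \<in> \<real>\<^sub>\<ge>\<^sub>0"
proof (cases "i \<in> R")
  case True
  have s: "(\<lambda>j. complex_of_real (A i j) * x j) summable_on R"
    using assms True by (auto simp: pos_op_def defines_operator_def)
  have "0 \<le> A i j" if "j \<in> R" for j
    using assms True that by (auto simp: pos_op_def nonneg_matrix_def)
  moreover have "0 \<le> Re (x j)" "Im (x j) = 0" for j
    using assms(3)[of j] by (auto simp: complex_nonneg_Reals_iff)
  ultimately have "0 \<le> (\<Sum>\<^sub>\<infinity>j\<in>R. Re (complex_of_real (A i j) * x j))"
    "(\<Sum>\<^sub>\<infinity>j\<in>R. Im (complex_of_real (A i j) * x j)) = 0"
    by (auto intro!: infsum_nonneg infsum_0)
  then show ?thesis
    unfolding complex_nonneg_Reals_iff infsum_Re[OF s] infsum_Im[OF s]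
    using True by (simp add: matrix_op_def)
qed (simp add: matrix_op_def)

lemma pow_nonneg:
  assumes "pos_op R A" "x \<in> l2 R" "\<And>i. x i \<in> \<real>\<^sub>\<ge>\<^sub>0"
  shows "(matrix_op R A ^^ k) x i \<in> \<real>\<^sub>\<ge>\<^sub>0"
  using matrix_op_nonneg[OF pos_op_pow[OF assms(1)] assms(2,3)] by (simp add: matrix_op_pow assms)

lemma cmod_le_add_nonneg:
  "z \<in> \<real>\<^sub>\<ge>\<^sub>0 \<Longrightarrow> w \<in> \<real>\<^sub>\<ge>\<^sub>0 \<Longrightarrow> cmod z \<le> cmod (z + w)"
  by (auto simp: complex_nonneg_Reals_iff cmod_def)

text \<open>The modulus of A x is at most A applied to the moduli of x, so nonnegative vectors
  already determine the norm. The resolvent comparison in \<open>growth_rate_in_spectrum\<close>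
  controls the powers only on such vectors.\<close>

lemma mat_norm_le_nonneg:
  assumes A: "pos_op R A" and K: "0 \<le> K"
    and le: "\<And>x. x \<in> l2 R \<Longrightarrow> (\<And>i. x i \<in> \<real>\<^sub>\<ge>\<^sub>0) \<Longrightarrow> l2_norm R (matrix_op R A x) \<le> K * l2_norm R x"
  shows "mat_norm R A \<le> K"
  unfolding mat_norm_def operator_norm_def
proof (rule cSUP_least)
  show "l2 R \<noteq> {}" using l2_zero by blast
  fix x assume x: "x \<in> l2 R"
  define u where "u = (\<lambda>i. complex_of_real (cmod (x i)))"
  have u: "u \<in> l2 R" "l2_norm R u = l2_norm R x" unfolding u_def
    by (rule l2_cmod[OF x]) (rule l2_norm_cmod)
  have A': "nonneg_matrix R A" "defines_operator R A" using A by (auto simp: pos_op_def)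
  have "cmod (matrix_op R A x i) \<le> cmod (matrix_op R A u i)" for i
  proof (cases "i \<in> R")
    case True
    note das = defines_operator_abs_summable[OF A' x True]
    have "cmod (matrix_op R A x i) \<le> (\<Sum>\<^sub>\<infinity>j\<in>R. norm (complex_of_real (A i j) * x j))"
      using True norm_infsum_bound[OF das(1)] by (simp add: matrix_op_def)
    also have "\<dots> = (\<Sum>\<^sub>\<infinity>j\<in>R. A i j * cmod (x j))"
      using A' True by (intro infsum_cong) (auto simp: norm_mult nonneg_matrix_def)
    finally show ?thesis using das(2) by (simp add: u_def)
  qed (simp add: matrix_op_def)
  then have "l2_norm R (matrix_op R A x) \<le> l2_norm R (matrix_op R A u)"
    by (intro l2_mono(2) pos_op_norm(1) A u)
  also have "\<dots> \<le> K * l2_norm R x"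
    using le[OF u(1)] u(2) by (simp add: u_def)
  finally show "l2_norm R (matrix_op R A x) / l2_norm R x \<le> K"
    using K by (cases "l2_norm R x = 0") (auto simp: divide_le_eq less_le)
qed

section \<open>The Neumann series as resolvent outside the growth rate\<close>

definition neumann :: "nat set \<Rightarrow> matrix \<Rightarrow> complex \<Rightarrow> (nat \<Rightarrow> complex) \<Rightarrow> nat \<Rightarrow> complex" where
  "neumann R A z x = (\<lambda>i. \<Sum>k. (matrix_op R A ^^ k) x i / z ^ Suc k)"

context
  fixes R A z C q
  assumes A: "pos_op R A" and C: "0 < C" and q: "0 \<le> q" "q < cmod z"
    and growth: "\<And>k. mat_norm R (mat_pow R A k) \<le> C * q ^ k"
begin

lemma neumann_term:
  assumes x: "x \<in> l2 R"
  shows "(\<lambda>i. (matrix_op R A ^^ k) x i / z ^ Suc k) \<in> l2 R"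
    and "l2_norm R (\<lambda>i. (matrix_op R A ^^ k) x i / z ^ Suc k) \<le> C / cmod z * l2_norm R x * (q / cmod z) ^ k"
proof -
  show "(\<lambda>i. (matrix_op R A ^^ k) x i / z ^ Suc k) \<in> l2 R"
    using l2_scale[OF l2_pow[OF A x], of "1 / z ^ Suc k"] by simp
  have "l2_norm R ((matrix_op R A ^^ k) x) \<le> mat_norm R (mat_pow R A k) * l2_norm R x"
    using pos_op_norm(2)[OF pos_op_pow[OF A] x] by (simp add: matrix_op_pow[OF A x])
  also have "\<dots> \<le> C * q ^ k * l2_norm R x" by (intro mult_right_mono growth) auto
  finally have "l2_norm R ((matrix_op R A ^^ k) x) / cmod z ^ Suc k \<le> C * q ^ k * l2_norm R x / cmod z ^ Suc k"
    by (intro divide_right_mono) auto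
  also have "\<dots> = C / cmod z * l2_norm R x * (q / cmod z) ^ k"
    by (simp add: power_divide)
  finally show "l2_norm R (\<lambda>i. (matrix_op R A ^^ k) x i / z ^ Suc k) \<le> C / cmod z * l2_norm R x * (q / cmod z) ^ k"
    using l2_norm_scale[of R "1 / z ^ Suc k" "(matrix_op R A ^^ k) x"]
    by (simp add: norm_divide norm_power norm_mult)
qed

lemma neumann_geometric: "summable (\<lambda>k. (q / cmod z) ^ k)"
  using q by (intro summable_geometric) (auto simp: divide_less_eq)

lemma neumann_summable:
  assumes x: "x \<in> l2 R"
  shows "summable (\<lambda>k. l2_norm R (\<lambda>i. (matrix_op R A ^^ k) x i / z ^ Suc k))"
  by (rule summable_comparison_test'[OF summable_mult[OF neumann_geometric, of "C / cmod z * l2_norm R x"]])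
    (use neumann_term(2)[OF x] in simp)

lemmas neumann_series = l2_series[OF neumann_term(1) neumann_summable]

lemma neumann_l2: "x \<in> l2 R \<Longrightarrow> neumann R A z x \<in> l2 R"
  unfolding neumann_def by (rule neumann_series)

lemma neumann_norm_le:
  assumes x: "x \<in> l2 R"
  shows "l2_norm R (neumann R A z x) \<le> (C / cmod z * (\<Sum>k. (q / cmod z) ^ k)) * l2_norm R x"
proof -
  have "l2_norm R (neumann R A z x) \<le> (\<Sum>k. l2_norm R (\<lambda>i. (matrix_op R A ^^ k) x i / z ^ Suc k))"
    unfolding neumann_def by (rule neumann_series(3)[OF x x])
  also have "\<dots> \<le> (\<Sum>k. C / cmod z * l2_norm R x * (q / cmod z) ^ k)"
    by (intro suminf_le neumann_term(2) x neumann_summable summable_mult neumann_geometric)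
  also have "\<dots> = (C / cmod z * (\<Sum>k. (q / cmod z) ^ k)) * l2_norm R x"
    by (subst suminf_mult[OF neumann_geometric]) simp
  finally show ?thesis .
qed

lemma pow_add:
  assumes "x \<in> l2 R" "y \<in> l2 R"
  shows "(matrix_op R A ^^ k) (\<lambda>i. x i + y i) = (\<lambda>i. (matrix_op R A ^^ k) x i + (matrix_op R A ^^ k) y i)"
  using matrix_op_add[OF pos_op_pow[OF A] assms, of k] assms by (simp add: matrix_op_pow[OF A] l2_add)

lemma pow_scale:
  assumes "x \<in> l2 R"
  shows "(matrix_op R A ^^ k) (\<lambda>i. c * x i) = (\<lambda>i. c * (matrix_op R A ^^ k) x i)"
  using matrix_op_scale[of R "mat_pow R A k" c x] assms by (simp add: matrix_op_pow[OF A] l2_scale)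

lemma neumann_add:
  assumes "x \<in> l2 R" "y \<in> l2 R"
  shows "neumann R A z (\<lambda>i. x i + y i) = (\<lambda>i. neumann R A z x i + neumann R A z y i)"
  unfolding neumann_def pow_add[OF assms] add_divide_distrib
  by (rule ext) (rule suminf_add[OF neumann_series(1)[OF assms(1) assms(1)]
      neumann_series(1)[OF assms(2) assms(2)], symmetric])

lemma neumann_scale:
  assumes "x \<in> l2 R"
  shows "neumann R A z (\<lambda>i. c * x i) = (\<lambda>i. c * neumann R A z x i)"
  unfolding neumann_def pow_scale[OF assms] times_divide_eq_right[symmetric]
  by (rule ext) (rule suminf_mult[OF neumann_series(1)[OF assms assms]])

lemma neumann_right:
  assumes x: "x \<in> l2 R"
  shows "matrix_op R A (neumann R A z x) = (\<lambda>i. z * neumann R A z x i - x i)"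
proof
  fix i
  have z: "z \<noteq> 0" using q by auto
  define v where "v k = (\<lambda>i. (matrix_op R A ^^ k) x i / z ^ Suc k)" for k
  have step: "matrix_op R A (v k) i = z * v (Suc k) i" for k
    using matrix_op_scale[of R A "1 / z ^ Suc k" "(matrix_op R A ^^ k) x"] z
    by (simp add: v_def fun_eq_iff)
  have "(\<lambda>k. v k i) sums neumann R A z x i"
    unfolding neumann_def v_def by (intro summable_sums neumann_series(1) x)
  then have "(\<lambda>k. v (Suc k) i) sums (neumann R A z x i - v 0 i)"
    using sums_Suc_iff[of "\<lambda>k. v k i"] by simp
  then have "(\<lambda>k. matrix_op R A (v k) i) sums (z * (neumann R A z x i - v 0 i))"
    unfolding step by (rule sums_mult)
  moreover have "(\<lambda>k. matrix_op R A (v k) i) sums matrix_op R A (neumann R A z x) i"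
    unfolding neumann_def v_def by (rule matrix_op_series[OF A neumann_term(1)[OF x] neumann_summable[OF x]])
  ultimately have "matrix_op R A (neumann R A z x) i = z * (neumann R A z x i - v 0 i)"
    by (rule sums_unique2[symmetric])
  then show "matrix_op R A (neumann R A z x) i = z * neumann R A z x i - x i"
    using z by (simp add: v_def right_diff_distrib)
qed

lemma neumann_left:
  assumes x: "x \<in> l2 R"
  shows "neumann R A z (matrix_op R A x) = (\<lambda>i. z * neumann R A z x i - x i)"
proof
  fix i
  have z: "z \<noteq> 0" using q by auto
  define v where "v k = (matrix_op R A ^^ k) x i / z ^ Suc k" for k
  have "v sums neumann R A z x i"
    unfolding neumann_def v_def by (intro summable_sums neumann_series(1) x)
  then have "(\<lambda>k. v (Suc k)) sums (neumann R A z x i - v 0)"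
    using sums_Suc_iff[of v] by simp
  then have "(\<lambda>k. z * v (Suc k)) sums (z * (neumann R A z x i - v 0))"
    by (rule sums_mult)
  moreover have "z * v (Suc k) = (matrix_op R A ^^ k) (matrix_op R A x) i / z ^ Suc k" for k
    using z by (simp add: v_def funpow_swap1)
  ultimately have "neumann R A z (matrix_op R A x) i = z * (neumann R A z x i - v 0)"
    unfolding neumann_def by (simp add: sums_iff)
  then show "neumann R A z (matrix_op R A x) i = z * neumann R A z x i - x i"
    using z by (simp add: v_def right_diff_distrib)
qed

lemma neumann_diff:
  assumes "x \<in> l2 R" "y \<in> l2 R"
  shows "neumann R A z (\<lambda>i. x i - y i) = (\<lambda>i. neumann R A z x i - neumann R A z y i)"
  using neumann_add[OF assms(1) l2_scale[OF assms(2), of "-1"]] neumann_scale[OF assms(2), of "-1"] by simp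

lemma not_in_spectrum: "z \<notin> spectrum R (matrix_op R A)"
proof -
  have bo: "bounded_operator R (neumann R A z)"
    unfolding bounded_operator_def
    using neumann_l2 neumann_add neumann_scale neumann_norm_le by blast
  have "\<forall>x\<in>l2 R. neumann R A z (\<lambda>i. z * x i - matrix_op R A x i) = x \<and>
      (\<lambda>i. z * neumann R A z x i - matrix_op R A (neumann R A z x) i) = x"
    by (simp add: neumann_diff neumann_scale neumann_left neumann_right l2_scale pos_op_norm(1)[OF A])
  with bo show ?thesis unfolding spectrum_def by blast
qed

end

section \<open>Gelfand's formula for positive operators\<close>

lemma set_power_singleton: "set_power R {A} k = {mat_pow R A k}"
proof -
  have "listset (replicate k {A}) = {replicate k A}"
    by (induction k) (auto simp: set_Cons_def)
  then show ?thesis by (simp add: set_power_def set_prod_def)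
qed

lemma set_norm_singleton: "pos_op R A \<Longrightarrow> set_norm R {A} = mat_norm R A"
  by (intro antisym set_norm_least pos_set_norm(2)[OF pos_set_singleton] pos_op_norm(3)) auto

lemma set_norm_power_singleton: "pos_op R A \<Longrightarrow> set_norm R (set_power R {A} k) = mat_norm R (mat_pow R A k)"
  unfolding set_power_singleton by (intro set_norm_singleton pos_op_pow)

text \<open>A resolvent estimate at \<open>s < g\<close>, the growth rate of the powers: since the resolvent at
  \<open>t > g\<close> is positive, it may be applied to the partial sums \<open>y\<close> of the Neumann series at \<open>s\<close>, for
  which \<open>(t - A) y \<le> (t - s) y + x\<close>. If the resolvent stays bounded as \<open>t\<close> decreases
  to \<open>g\<close>, this bounds \<open>y\<close> uniformly, against the choice of \<open>g\<close>.\<close>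

lemma growth_rate_in_spectrum:
  assumes A: "pos_op R A" and R: "R \<noteq> {}"
  shows "complex_of_real (joint_spectral_radius R {A}) \<in> spectrum R (matrix_op R A)"
proof (rule ccontr)
  define g where "g = joint_spectral_radius R {A}"
  define T where "T = matrix_op R A"
  have pos: "pos_set R {A}" using A by (rule pos_set_singleton)
  have g0: "0 \<le> g" unfolding g_def by (rule joint_spectral_radius(1)[OF pos])
  have growth: "\<exists>C>0. \<forall>k. mat_norm R (mat_pow R A k) \<le> C * q ^ k" if "g < q" for q
    using joint_spectral_radius(4)[OF pos that[unfolded g_def]] by (simp add: set_norm_power_singleton A)
  have Tl2: "T x \<in> l2 R" if "x \<in> l2 R" for x unfolding T_def using pos_op_norm(1)[OF A that] .
  have Tkl2: "(T ^^ k) x \<in> l2 R" if "x \<in> l2 R" for x k unfolding T_def using l2_pow[OF A that] .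
  assume "complex_of_real (joint_spectral_radius R {A}) \<notin> spectrum R (matrix_op R A)"
  then obtain S where S: "bounded_operator R S"
    and S': "\<And>x. x \<in> l2 R \<Longrightarrow> S (\<lambda>i. complex_of_real g * x i - T x i) = x"
    unfolding spectrum_def g_def T_def by auto
  obtain K0 where K0: "\<And>x. x \<in> l2 R \<Longrightarrow> l2_norm R (S x) \<le> K0 * l2_norm R x"
    using S unfolding bounded_operator_def by blast
  define K where "K = max K0 1"
  have K: "0 < K" "l2_norm R (S x) \<le> K * l2_norm R x" if "x \<in> l2 R" for x
  proof -
    show "0 < K" by (simp add: K_def)
    have "K0 * l2_norm R x \<le> K * l2_norm R x" unfolding K_def by (intro mult_right_mono) auto
    then show "l2_norm R (S x) \<le> K * l2_norm R x" using K0[OF that] by linarith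
  qed
  have K1: "0 < K" by (simp add: K_def)
  show False
  proof (cases "g = 0")
    \<comment> \<open>There is no positive s below g in this case. Instead S inverts the negative of
      T, so the k-th power of T shrinks a vector at most by the factor \<open>K ^ k\<close>. Growth
      rate 0 makes the powers smaller than \<open>C * (1 / (2 * K)) ^ k\<close>, which a single unit
      vector refutes.\<close>
    case True
    have expand: "l2_norm R x \<le> K * l2_norm R (T x)" if "x \<in> l2 R" for x
      using K(2)[OF l2_scale[OF Tl2[OF that], of "-1"]] S'[OF that] l2_norm_scale[of R "-1" "T x"] True
      by simp
    have expand_pow: "l2_norm R x \<le> K ^ k * l2_norm R ((T ^^ k) x)" if "x \<in> l2 R" for x k
    proof (induction k)
      case (Suc k)
      have "l2_norm R x \<le> K ^ k * l2_norm R ((T ^^ k) x)" by (rule Suc)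
      also have "\<dots> \<le> K ^ k * (K * l2_norm R ((T ^^ Suc k) x))"
        using expand[OF Tkl2[OF that, of k]] K1 by (intro mult_left_mono) auto
      finally show ?case by (simp add: mult_ac)
    qed simp
    obtain r where r: "r \<in> R" using R by blast
    define e where "e = (\<lambda>i. if i \<in> {r} then complex_of_real 1 else 0)"
    have e: "e \<in> l2 R" "l2_norm R e = 1"
      unfolding e_def using l2_finite_support[of "{r}" R "\<lambda>_. 1"] r by auto
    obtain C where C: "C > 0" "\<And>k. mat_norm R (mat_pow R A k) \<le> C * (1 / (2 * K)) ^ k"
      using growth[of "1 / (2 * K)"] True K1 by auto
    have "1 \<le> C * (1 / 2) ^ k" for k
    proof -
      have "1 \<le> K ^ k * l2_norm R ((T ^^ k) e)" using expand_pow[OF e(1)] e(2) by simp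
      also have "\<dots> \<le> K ^ k * (mat_norm R (mat_pow R A k) * l2_norm R e)"
        using pos_op_norm(2)[OF pos_op_pow[OF A] e(1), of k] K1
        by (intro mult_left_mono) (auto simp: matrix_op_pow[OF A e(1)] T_def)
      also have "\<dots> \<le> K ^ k * (C * (1 / (2 * K)) ^ k)"
        using C(2)[of k] K1 e by (intro mult_left_mono) auto
      also have "\<dots> = C * (1 / 2) ^ k" using K1 by (simp add: power_divide power_mult_distrib)
      finally show ?thesis .
    qed
    moreover have "(\<lambda>k. C * (1 / 2) ^ k) \<longlonglongrightarrow> C * 0"
      by (intro tendsto_intros LIMSEQ_realpow_zero) auto
    ultimately show False
      using LIMSEQ_le_const[of "\<lambda>k. C * (1 / 2) ^ k" 0 1] by auto
  next
    case False
    then have gpos: "0 < g" using g0 by simp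
    \<comment> \<open>Chosen so that (t - g) * K = 1/8 and (t - s) * K \<le> 1/4. Both numbers are
      small enough for a term on the right to be absorbed on the left: the first in
      \<open>N_bound\<close>, the second in the bound on the partial sums y.\<close>
    define h where "h = 1 / (8 * K)"
    have h: "0 < h" "h * K = 1 / 8" using K1 by (auto simp: h_def)
    define t where "t = g + h"
    \<comment> \<open>The alternative g / 2 keeps s positive when h is at least g.\<close>
    define s where "s = max (g / 2) (g - h)"
    have s: "0 < s" "s < g" and t: "g < t" using gpos h by (auto simp: s_def t_def)
    have "(t - s) * K \<le> (2 * h) * K" using K1 by (intro mult_right_mono) (auto simp: s_def t_def)
    then have ts: "s < t" "(t - s) * K \<le> 1 / 4" "(t - g) * K = 1 / 8"
      using h s t by (auto simp: t_def)
    obtain C where C: "C > 0" "\<And>k. mat_norm R (mat_pow R A k) \<le> C * ((g + t) / 2) ^ k"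
      using growth[of "(g + t) / 2"] t by auto
    have q: "0 \<le> (g + t) / 2" "(g + t) / 2 < cmod (complex_of_real t)" using g0 t by auto
    define N where "N = neumann R A (complex_of_real t)"
    note neu = neumann_l2[OF A C(1) q C(2)] neumann_add[OF A C(1) q C(2)]
      neumann_diff[OF A C(1) q C(2)] neumann_scale[OF A C(1) q C(2)]
    \<comment> \<open>Perturbation from g to t: w = N y solves (g - T) w = y - (t - g) w, and the
      bounded inverse S of g - T applies to the right side.\<close>
    have N_bound: "l2_norm R (N y) \<le> 2 * K * l2_norm R y" if y: "y \<in> l2 R" for y
    proof -
      define w where "w = N y"
      have w: "w \<in> l2 R" unfolding w_def N_def by (rule neu(1)[OF y])
      have Tw: "T w = (\<lambda>i. t * w i - y i)"
        unfolding w_def N_def T_def by (rule neumann_right[OF A C(1) q C(2) y])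
      have "w = S (\<lambda>i. g * w i - T w i)" using S'[OF w] by simp
      also have "(\<lambda>i. g * w i - T w i) = (\<lambda>i. y i - complex_of_real (t - g) * w i)"
        by (simp add: Tw algebra_simps)
      finally have "l2_norm R w \<le> K * l2_norm R (\<lambda>i. y i - complex_of_real (t - g) * w i)"
        using K(2)[OF l2_diff(1)[OF y l2_scale[OF w]]] by metis
      also have "\<dots> \<le> K * (l2_norm R y + (t - g) * l2_norm R w)"
        using l2_diff(2)[OF y l2_scale[OF w, of "complex_of_real (t - g)"]] t K1
        by (intro mult_left_mono) (auto simp: l2_norm_scale simp flip: of_real_diff)
      also have "\<dots> = K * l2_norm R y + ((t - g) * K) * l2_norm R w" by (simp add: algebra_simps)
      finally have "l2_norm R w \<le> K * l2_norm R y + (1 / 8) * l2_norm R w" unfolding ts(3) .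
      moreover have "0 \<le> K * l2_norm R y" using K1 by simp
      ultimately show ?thesis unfolding w_def by simp
    qed
    have N_nonneg: "N y i \<in> \<real>\<^sub>\<ge>\<^sub>0" if y: "y \<in> l2 R" "\<And>i. y i \<in> \<real>\<^sub>\<ge>\<^sub>0" for y i
    proof -
      have sm: "summable (\<lambda>k. (matrix_op R A ^^ k) y i / complex_of_real t ^ Suc k)"
        by (rule neumann_series(1)[OF A C(1) q C(2) y(1) y(1)])
      have pos_term: "(matrix_op R A ^^ k) y i / complex_of_real t ^ Suc k \<in> \<real>\<^sub>\<ge>\<^sub>0" for k
        using pow_nonneg[OF A y] g0 t
        by (intro nonneg_Reals_divide_I) (auto simp flip: of_real_power of_real_mult)
      then have parts: "0 \<le> Re ((matrix_op R A ^^ k) y i / complex_of_real t ^ Suc k)"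
        "Im ((matrix_op R A ^^ k) y i / complex_of_real t ^ Suc k) = 0" for k
        by (simp_all only: complex_nonneg_Reals_iff)
      show ?thesis
        unfolding N_def neumann_def complex_nonneg_Reals_iff Re_suminf[OF sm] Im_suminf[OF sm] parts(2)
        using suminf_nonneg[OF summable_Re[OF sm] parts(1)] by simp
    qed
    have pow_le: "l2_norm R ((T ^^ n) x) \<le> 4 * K * s ^ Suc n * l2_norm R x"
      if x: "x \<in> l2 R" "\<And>i. x i \<in> \<real>\<^sub>\<ge>\<^sub>0" for x n
    proof -
      define c where "c k = complex_of_real (1 / s ^ Suc k)" for k
      have c: "c k \<in> \<real>\<^sub>\<ge>\<^sub>0" "s * c (Suc k) = c k" "s * c 0 = 1" for k
        unfolding c_def of_real_mult[symmetric] of_real_eq_iff using s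
        by (simp_all del: of_real_divide)
      define y where "y = (\<lambda>i. \<Sum>k\<le>n. c k * (T ^^ k) x i)"
      define p where "p = (\<lambda>i. c n * (T ^^ Suc n) x i)"
      have Tpos: "(T ^^ k) x i \<in> \<real>\<^sub>\<ge>\<^sub>0" for k i unfolding T_def using pow_nonneg[OF A x] .
      have sum_nn: "(\<Sum>k\<in>J. f k) \<in> \<real>\<^sub>\<ge>\<^sub>0" if "\<And>k. f k \<in> \<real>\<^sub>\<ge>\<^sub>0" for J :: "nat set" and f :: "nat \<Rightarrow> complex"
        using that by (induction J rule: infinite_finite_induct) auto
      have y: "y \<in> l2 R" "\<And>i. y i \<in> \<real>\<^sub>\<ge>\<^sub>0"
        unfolding y_def using Tpos c by (auto intro!: l2_sum l2_scale Tkl2 x sum_nn nonneg_Reals_mult_I)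
      have p: "p \<in> l2 R" "\<And>i. p i \<in> \<real>\<^sub>\<ge>\<^sub>0"
        unfolding p_def using Tpos[of "Suc n"] c by (auto intro!: l2_scale Tkl2[of _ "Suc n"] x nonneg_Reals_mult_I simp del: funpow.simps)
      have Ty: "T y = (\<lambda>i. \<Sum>k\<le>n. c k * (T ^^ Suc k) x i)"
        unfolding y_def T_def using x A l2_pow[OF A x(1)]
        by (subst matrix_op_sum) (auto intro!: l2_scale simp: matrix_op_scale)
      have sy: "s * y i - T y i = x i - p i" for i
      proof -
        have "s * y i = (\<Sum>k\<le>n. s * c k * (T ^^ k) x i)"
          by (simp add: y_def sum_distrib_left mult.assoc)
        also have "\<dots> - T y i = x i - p i"
          unfolding Ty p_def
        proof (induction n)
          case 0
          then show ?case using c(3) by simp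
        next
          case (Suc n)
          have "(\<Sum>k\<le>Suc n. s * c k * (T ^^ k) x i) - (\<Sum>k\<le>Suc n. c k * (T ^^ Suc k) x i) =
              ((\<Sum>k\<le>n. s * c k * (T ^^ k) x i) - (\<Sum>k\<le>n. c k * (T ^^ Suc k) x i)) +
              s * c (Suc n) * (T ^^ Suc n) x i - c (Suc n) * (T ^^ Suc (Suc n)) x i"
            by (simp del: funpow.simps)
          then show ?case unfolding Suc c(2) by (simp del: funpow.simps)
        qed
        finally show ?thesis .
      qed
      define w where "w = (\<lambda>i. complex_of_real (t - s) * y i + x i)"
      have eq: "(\<lambda>i. t * y i - T y i) = (\<lambda>i. w i - p i)"
      proof
        fix i
        have "t * y i - T y i = complex_of_real (t - s) * y i + (s * y i - T y i)"
          by (simp add: algebra_simps)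
        then show "t * y i - T y i = w i - p i" unfolding sy w_def by simp
      qed
      have w: "w \<in> l2 R" unfolding w_def by (intro l2_add l2_scale y x)
      have "y = N (\<lambda>i. t * y i - T y i)"
        unfolding N_def T_def using neu(3)[OF l2_scale[OF y(1)] pos_op_norm(1)[OF A y(1)]]
        by (simp add: neu(4)[OF y(1)] neumann_left[OF A C(1) q C(2) y(1)])
      also have "\<dots> = (\<lambda>i. N w i - N p i)"
        unfolding eq N_def by (rule neu(3)[OF w p(1)])
      finally have "y i + N p i = N w i" for i by (metis diff_add_cancel)
      then have "cmod (y i) \<le> cmod (N w i)" for i
        using cmod_le_add_nonneg[OF y(2) N_nonneg[OF p]] by metis
      then have "l2_norm R y \<le> l2_norm R (N w)"
        by (intro l2_mono(2)) (auto simp: N_def intro!: neu(1) w)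
      also have "\<dots> \<le> 2 * K * l2_norm R w" by (rule N_bound[OF w])
      also have "\<dots> \<le> 2 * K * ((t - s) * l2_norm R y + l2_norm R x)"
        using l2_add(2)[OF l2_scale[OF y(1), of "complex_of_real (t - s)"] x(1)] ts K1
        unfolding w_def by (intro mult_left_mono) (auto simp: l2_norm_scale simp flip: of_real_diff)
      also have "\<dots> = 2 * ((t - s) * K) * l2_norm R y + 2 * K * l2_norm R x" by (simp add: algebra_simps)
      also have "\<dots> \<le> 2 * (1 / 4) * l2_norm R y + 2 * K * l2_norm R x"
        by (intro add_right_mono mult_right_mono mult_left_mono ts(2)) auto
      finally have ybound: "l2_norm R y \<le> 4 * K * l2_norm R x" by simp
      \<comment> \<open>All summands of y are nonnegative, so the last one alone is dominated by y.
        This turns the bound on y into a bound on the n-th power.\<close>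
      have "cmod (c n * (T ^^ n) x i) \<le> cmod (y i)" for i
      proof -
        have "y i = c n * (T ^^ n) x i + (\<Sum>k<n. c k * (T ^^ k) x i)"
          by (simp add: y_def lessThan_Suc_atMost[symmetric])
        then show ?thesis
          using cmod_le_add_nonneg[of "c n * (T ^^ n) x i" "\<Sum>k<n. c k * (T ^^ k) x i"] Tpos c(1)
          by (simp add: sum_nn nonneg_Reals_mult_I)
      qed
      then have "l2_norm R (\<lambda>i. c n * (T ^^ n) x i) \<le> l2_norm R y" by (intro l2_mono(2) y)
      then have "l2_norm R ((T ^^ n) x) / s ^ Suc n \<le> 4 * K * l2_norm R x"
        unfolding l2_norm_scale c_def norm_of_real using ybound s by simp
      then show ?thesis using s by (simp add: divide_le_eq mult_ac)
    qed
    have "mat_norm R (mat_pow R A n) \<le> (4 * K * s) * s ^ n" for n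
      using pow_le[of _ n] s K1
      by (intro mat_norm_le_nonneg pos_op_pow A) (auto simp: matrix_op_pow A T_def mult_ac)
    then have "g \<le> s"
      unfolding g_def using s K1 A
      by (intro joint_spectral_radius_le[OF pos, of "4 * K * s"]) (auto simp: set_norm_power_singleton)
    then show False using s by simp
  qed
qed

text \<open>The Neumann series removes every z of modulus above the growth rate from the spectrum,
  and the growth rate itself belongs to it. Thus the supremum is a maximum. For empty R the spectrum
  would be empty and its supremum unspecified.\<close>

lemma mat_rho_eq:
  assumes A: "pos_op R A" and R: "R \<noteq> {}"
  shows "mat_rho R A = joint_spectral_radius R {A}"
  unfolding mat_rho_def spectral_radius_def
proof (rule cSup_eq_maximum)
  let ?g = "joint_spectral_radius R {A}"
  have pos: "pos_set R {A}" using A by (rule pos_set_singleton)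
  have g0: "0 \<le> ?g" by (rule joint_spectral_radius(1)[OF pos])
  show "?g \<in> cmod ` spectrum R (matrix_op R A)"
    using growth_rate_in_spectrum[OF assms] g0 by (intro image_eqI[where x = "complex_of_real ?g"]) auto
  fix y assume "y \<in> cmod ` spectrum R (matrix_op R A)"
  then obtain z where z: "z \<in> spectrum R (matrix_op R A)" "y = cmod z" by blast
  show "y \<le> ?g"
  proof (rule ccontr)
    assume "\<not> y \<le> ?g"
    then have q: "?g < (?g + cmod z) / 2" "(?g + cmod z) / 2 < cmod z" using z by auto
    obtain C where "C > 0" "\<And>k. mat_norm R (mat_pow R A k) \<le> C * ((?g + cmod z) / 2) ^ k"
      using joint_spectral_radius(4)[OF pos q(1)] by (auto simp: set_norm_power_singleton A)
    then have "z \<notin> spectrum R (matrix_op R A)"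
      using q g0 by (intro not_in_spectrum[OF A, where q = "(?g + cmod z) / 2"]) auto
    then show False using z by blast
  qed
qed

section \<open>Both spectral radii of a set as an upper limit\<close>

text \<open>Taking \<open>mat_rho R\<close> for f gives the generalized spectral radius and
  \<open>mat_norm R\<close> the joint one, whose limit is also an upper limit.\<close>

definition limsup_radius :: "nat set \<Rightarrow> (matrix \<Rightarrow> real) \<Rightarrow> matrix set \<Rightarrow> real" where
  "limsup_radius R f \<Sigma> = real_of_ereal
     (limsup (\<lambda>k. ereal (root k (nonneg_Sup (f ` set_power R \<Sigma> k)))))"

lemma gen_spectral_radius_eq: "gen_spectral_radius R = limsup_radius R (mat_rho R)"
  by (rule ext) (simp add: gen_spectral_radius_def limsup_radius_def)

lemma joint_spectral_radius_eq:
  assumes "pos_set R \<Sigma>"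
  shows "joint_spectral_radius R \<Sigma> = limsup_radius R (mat_norm R) \<Sigma>"
proof -
  have "((\<lambda>k. ereal (root k (set_norm R (set_power R \<Sigma> k)))) \<longlongrightarrow> ereal (joint_spectral_radius R \<Sigma>)) sequentially"
    using joint_spectral_radius(2)[OF assms] by simp
  from lim_imp_Limsup[OF _ this] show ?thesis
    by (simp add: limsup_radius_def set_norm_def)
qed

lemma concat_replicate_Suc: "concat (replicate (Suc k) xs) = concat (replicate k xs) @ xs"
  by (induction k) auto

lemma set_hadamard_eq:
  "set_hadamard m (\<lambda>_. \<alpha>) P = {hadamard m \<alpha> A | A. \<forall>j\<in>{1..m}. A j \<in> P j}"
  by (simp add: set_hadamard_def hadamard_def)

lemma pos_set_hadamard:
  assumes m: "1 \<le> m" and \<alpha>: "1 / real m \<le> \<alpha>" and P: "\<And>j. j \<in> {1..m} \<Longrightarrow> pos_set R (P j)"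
  shows "pos_set R (set_hadamard m (\<lambda>_. \<alpha>) P)"
proof (rule pos_setI)
  have \<alpha>0: "0 \<le> \<alpha>" using \<alpha> m by (meson divide_nonneg_nonneg of_nat_0_le_iff order_trans zero_le_one)
  fix B assume "B \<in> set_hadamard m (\<lambda>_. \<alpha>) P"
  then obtain A where A: "B = hadamard m \<alpha> A" "\<And>j. j \<in> {1..m} \<Longrightarrow> A j \<in> P j"
    by (auto simp: set_hadamard_eq)
  have pos: "pos_op R (A j)" if "j \<in> {1..m}" for j
    using pos_set_norm(1)[OF P[OF that] A(2)[OF that]] .
  show "pos_op R B" unfolding A by (rule hadamard_norm(1)[OF m \<alpha> pos])
  have "mat_norm R B \<le> (\<Prod>j=1..m. mat_norm R (A j) powr \<alpha>)"
    unfolding A by (rule hadamard_norm(2)[OF m \<alpha> pos])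
  also have "\<dots> \<le> (\<Prod>j=1..m. set_norm R (P j) powr \<alpha>)"
  proof (intro prod_mono conjI powr_mono2 \<alpha>0)
    fix j assume j: "j \<in> {1..m}"
    show "0 \<le> mat_norm R (A j)" by (rule pos_op_norm(3)[OF pos[OF j]])
    show "mat_norm R (A j) \<le> set_norm R (P j)" by (rule pos_set_norm(2)[OF P[OF j] A(2)[OF j]])
  qed auto
  finally show "mat_norm R B \<le> (\<Prod>j=1..m. set_norm R (P j) powr \<alpha>)" .
qed

lemma listset_rev: "listset (rev Ls) = rev ` listset Ls"
proof (rule set_eqI)
  fix As
  show "As \<in> listset (rev Ls) \<longleftrightarrow> As \<in> rev ` listset Ls"
    by (metis (no_types, lifting) image_iff in_listset_iff list_all2_rev rev_rev_ident)
qed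

lemma set_adjoint_adjoint [simp]: "set_adjoint (set_adjoint \<Sigma>) = \<Sigma>"
  by (simp add: set_adjoint_def image_image)

lemma pos_set_adjoint:
  assumes "pos_set R \<Sigma>"
  shows "pos_set R (set_adjoint \<Sigma>)"
  using pos_set_norm[OF assms] pos_op_adjoint
  by (intro pos_setI[where K = "set_norm R \<Sigma>"]) (auto simp: set_adjoint_def)

text \<open>Collects what the norm and the spectral radius of a matrix share, so that the estimates
  for sets are proved once. The norm is the first instance; its conclusion for singletons provides
  \<open>f_hadamard\<close> for the second, the spectral radius.\<close>

locale operator_size =
  fixes R :: "nat set" and f :: "matrix \<Rightarrow> real"
  assumes f_nonneg: "pos_op R A \<Longrightarrow> 0 \<le> f A"
    and f_le_norm: "pos_op R A \<Longrightarrow> f A \<le> mat_norm R A"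
    and f_cong: "matrix_op R A = matrix_op R B \<Longrightarrow> f A = f B"
    and f_mono: "mat_le R A B \<Longrightarrow> pos_op R B \<Longrightarrow> f A \<le> f B"
    and f_hadamard: "1 \<le> m \<Longrightarrow> 1 / real m \<le> \<alpha> \<Longrightarrow> (\<And>j. j \<in> {1..m} \<Longrightarrow> pos_op R (M j)) \<Longrightarrow>
      f (hadamard m \<alpha> M) \<le> (\<Prod>j=1..m. f (M j) powr \<alpha>)"
    and f_adjoint: "pos_op R A \<Longrightarrow> f (mat_adjoint A) = f A"
begin

definition f_sup :: "matrix set \<Rightarrow> real" where
  "f_sup \<Sigma> = nonneg_Sup (f ` \<Sigma>)"

lemma f_sup_bdd:
  assumes "pos_set R \<Sigma>"
  shows "bdd_above (f ` \<Sigma>)"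
proof (rule bdd_aboveI2)
  fix A assume "A \<in> \<Sigma>"
  then show "f A \<le> set_norm R \<Sigma>"
    using f_le_norm[of A] pos_set_norm(1,2)[OF assms, of A] by linarith
qed

lemma f_sup_upper: "pos_set R \<Sigma> \<Longrightarrow> A \<in> \<Sigma> \<Longrightarrow> f A \<le> f_sup \<Sigma>"
  unfolding f_sup_def by (intro nonneg_Sup_upper f_sup_bdd) auto

lemma f_sup_nonneg: "pos_set R \<Sigma> \<Longrightarrow> 0 \<le> f_sup \<Sigma>"
  unfolding f_sup_def by (intro nonneg_Sup_nonneg f_sup_bdd)

lemma f_sup_least: "0 \<le> K \<Longrightarrow> (\<And>A. A \<in> \<Sigma> \<Longrightarrow> f A \<le> K) \<Longrightarrow> f_sup \<Sigma> \<le> K"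
  unfolding f_sup_def by (rule nonneg_Sup_least) auto

lemma f_sup_le_norm:
  assumes "pos_set R \<Sigma>"
  shows "f_sup \<Sigma> \<le> set_norm R \<Sigma>"
proof (rule f_sup_least)
  show "0 \<le> set_norm R \<Sigma>" using assms by (rule pos_set_norm)
  show "f A \<le> set_norm R \<Sigma>" if "A \<in> \<Sigma>" for A
    using f_le_norm[of A] pos_set_norm(1,2)[OF assms that] by linarith
qed

lemma f_image_cong:
  assumes "matrix_op R ` \<Sigma> = matrix_op R ` \<Sigma>'"
  shows "f ` \<Sigma> = f ` \<Sigma>'"
proof -
  have "f ` X \<subseteq> f ` Y" if *: "matrix_op R ` X = matrix_op R ` Y" for X Y
  proof
    fix v assume "v \<in> f ` X"
    then obtain A where A: "A \<in> X" "v = f A" by blast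
    have "matrix_op R A \<in> matrix_op R ` Y" using A(1) unfolding *[symmetric] by blast
    then obtain B where "B \<in> Y" "matrix_op R A = matrix_op R B" by blast
    then show "v \<in> f ` Y" using A(2) f_cong by blast
  qed
  then show ?thesis using assms by (intro antisym) simp_all
qed

abbreviation rad :: "matrix set \<Rightarrow> real" where
  "rad \<equiv> limsup_radius R f"

definition root_sup :: "matrix set \<Rightarrow> nat \<Rightarrow> real" where
  "root_sup \<Sigma> k = root k (f_sup (set_power R \<Sigma> k))"

lemma rad_eq: "rad \<Sigma> = real_of_ereal (limsup (\<lambda>k. ereal (root_sup \<Sigma> k)))"
  by (simp add: limsup_radius_def root_sup_def f_sup_def)

lemma root_sup_nonneg: "pos_set R \<Sigma> \<Longrightarrow> 0 \<le> root_sup \<Sigma> k"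
  unfolding root_sup_def by (intro real_root_ge_zero f_sup_nonneg pos_set_power)

text \<open>\<open>real_of_ereal\<close> sends infinite values to 0, so the real number carries
  information only once the upper limit is finite. The joint spectral radius plus 1 bounds
  it.\<close>

lemma limsup_eq_rad:
  assumes "pos_set R \<Sigma>"
  shows "limsup (\<lambda>k. ereal (root_sup \<Sigma> k)) = ereal (rad \<Sigma>)"
    and "0 \<le> rad \<Sigma>"
proof -
  define J where "J = joint_spectral_radius R \<Sigma>"
  have "\<forall>\<^sub>F k in sequentially. root k (set_norm R (set_power R \<Sigma> k)) < J + 1"
    using joint_spectral_radius(2)[OF assms] by (rule order_tendstoD) (simp add: J_def)
  then have "\<forall>\<^sub>F k in sequentially. ereal (root_sup \<Sigma> k) \<le> ereal (J + 1)"
    using eventually_ge_at_top[of 1]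
  proof eventually_elim
    case (elim k)
    have "root_sup \<Sigma> k \<le> root k (set_norm R (set_power R \<Sigma> k))"
      unfolding root_sup_def using elim by (simp add: f_sup_le_norm pos_set_power assms)
    then show ?case using elim by simp
  qed
  then have "limsup (\<lambda>k. ereal (root_sup \<Sigma> k)) \<le> ereal (J + 1)" by (rule Limsup_bounded)
  moreover have "0 \<le> limsup (\<lambda>k. ereal (root_sup \<Sigma> k))"
    using root_sup_nonneg[OF assms] by (intro le_Limsup) auto
  ultimately show "limsup (\<lambda>k. ereal (root_sup \<Sigma> k)) = ereal (rad \<Sigma>)" "0 \<le> rad \<Sigma>"
    unfolding rad_eq by (cases "limsup (\<lambda>k. ereal (root_sup \<Sigma> k))"; simp)+
qed

lemma rad_le:
  assumes "pos_set R \<Sigma>" "\<forall>\<^sub>F k in sequentially. root_sup \<Sigma> k \<le> q"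
  shows "rad \<Sigma> \<le> q"
proof -
  have "limsup (\<lambda>k. ereal (root_sup \<Sigma> k)) \<le> ereal q"
    using assms(2) by (intro Limsup_bounded) simp
  then show ?thesis by (simp add: limsup_eq_rad[OF assms(1)])
qed

lemma rad_less_eventually:
  assumes "pos_set R \<Sigma>" "rad \<Sigma> < q"
  shows "\<forall>\<^sub>F k in sequentially. root_sup \<Sigma> k < q"
proof -
  have "limsup (\<lambda>k. ereal (root_sup \<Sigma> k)) < ereal q"
    using assms by (simp add: limsup_eq_rad)
  from Limsup_lessD[OF this] show ?thesis by simp
qed

lemma le_rad:
  assumes "pos_set R \<Sigma>" "\<And>k. 1 \<le> k \<Longrightarrow> c \<le> root_sup \<Sigma> k"
  shows "c \<le> rad \<Sigma>"
proof -
  have "ereal c \<le> limsup (\<lambda>k. ereal (root_sup \<Sigma> k))"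
    using assms(2) by (intro le_Limsup eventually_sequentiallyI[of 1]) auto
  then show ?thesis by (simp add: limsup_eq_rad[OF assms(1)])
qed

text \<open>Each of the k factors comes with m Hadamard factors. Domination by
  \<open>hadamard_prod_le\<close> regroups them into m products of length k, the j-th of which lies
  in the k-th power of P j, so the suprema can be taken separately.\<close>

lemma f_sup_hadamard_power_le:
  assumes m: "1 \<le> m" and \<alpha>: "1 / real m \<le> \<alpha>" and P: "\<And>j. j \<in> {1..m} \<Longrightarrow> pos_set R (P j)"
  shows "f_sup (set_power R (set_hadamard m (\<lambda>_. \<alpha>) P) k) \<le> (\<Prod>j=1..m. f_sup (set_power R (P j) k) powr \<alpha>)"
proof (rule f_sup_least)
  have \<alpha>0: "0 \<le> \<alpha>" using \<alpha> m by (meson divide_nonneg_nonneg of_nat_0_le_iff order_trans zero_le_one)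
  show "0 \<le> (\<Prod>j=1..m. f_sup (set_power R (P j) k) powr \<alpha>)" by (intro prod_nonneg) auto
  fix B assume "B \<in> set_power R (set_hadamard m (\<lambda>_. \<alpha>) P) k"
  then obtain Hs where Hs: "B = mat_prod R Hs" "length Hs = k"
    "\<And>t. t < k \<Longrightarrow> Hs ! t \<in> set_hadamard m (\<lambda>_. \<alpha>) P"
    by (auto simp: set_power_def set_prod_def in_listset_iff list_all2_conv_all_nth)
  then have "\<forall>t. \<exists>A. t < k \<longrightarrow> Hs ! t = hadamard m \<alpha> A \<and> (\<forall>j\<in>{1..m}. A j \<in> P j)"
    by (auto simp: set_hadamard_eq)
  then obtain A where A: "\<And>t. t < k \<Longrightarrow> Hs ! t = hadamard m \<alpha> (A t)"
    "\<And>t j. t < k \<Longrightarrow> j \<in> {1..m} \<Longrightarrow> A t j \<in> P j"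
    by metis
  have HsA: "Hs = map (\<lambda>t. hadamard m \<alpha> (A t)) [0..<k]"
    using Hs(2) A(1) by (intro nth_equalityI) auto
  have pos: "pos_op R (A t j)" if "t \<in> set [0..<k]" "j \<in> {1..m}" for t j
    using that by (intro pos_set_norm(1)[OF P A(2)]) auto
  define C where "C j = mat_prod R (map (\<lambda>t. A t j) [0..<k])" for j
  have C: "C j \<in> set_power R (P j) k" "pos_op R (C j)" if "j \<in> {1..m}" for j
  proof -
    show "C j \<in> set_power R (P j) k"
      unfolding C_def set_power_def set_prod_def using A(2) that
      by (intro imageI) (auto simp: in_listset_iff list_all2_conv_all_nth)
    show "pos_op R (C j)" unfolding C_def using pos that by (intro pos_op_prod) auto
  qed
  have "f B \<le> f (hadamard m \<alpha> C)"
    unfolding Hs(1) HsA C_def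
    using pos C(2) by (intro f_mono hadamard_prod_le hadamard_norm(1) m \<alpha>) (auto simp: C_def)
  also have "\<dots> \<le> (\<Prod>j=1..m. f (C j) powr \<alpha>)" by (rule f_hadamard[OF m \<alpha> C(2)])
  also have "\<dots> \<le> (\<Prod>j=1..m. f_sup (set_power R (P j) k) powr \<alpha>)"
  proof (intro prod_mono conjI powr_mono2 \<alpha>0)
    fix j assume j: "j \<in> {1..m}"
    show "0 \<le> f (C j)" by (rule f_nonneg[OF C(2)[OF j]])
    show "f (C j) \<le> f_sup (set_power R (P j) k)" by (rule f_sup_upper[OF pos_set_power[OF P[OF j]] C(1)[OF j]])
  qed auto
  finally show "f B \<le> (\<Prod>j=1..m. f_sup (set_power R (P j) k) powr \<alpha>)" .
qed

text \<open>To bound the upper limit of the product, every factor is eventually replaced by its own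
  upper limit plus e. There are only finitely many factors, so one threshold serves them all, and e
  tends to 0 at the end.\<close>

lemma rad_hadamard_le:
  assumes m: "1 \<le> m" and \<alpha>: "1 / real m \<le> \<alpha>" and P: "\<And>j. j \<in> {1..m} \<Longrightarrow> pos_set R (P j)"
  shows "rad (set_hadamard m (\<lambda>_. \<alpha>) P) \<le> (\<Prod>j=1..m. rad (P j) powr \<alpha>)"
proof -
  have \<alpha>0: "0 < \<alpha>" using \<alpha> m by (meson divide_pos_pos less_le_trans of_nat_0_less_iff zero_less_one)
  let ?H = "set_hadamard m (\<lambda>_. \<alpha>) P"
  have posH: "pos_set R ?H" by (rule pos_set_hadamard[OF m \<alpha> P])
  have bound: "root_sup ?H k \<le> (\<Prod>j=1..m. root_sup (P j) k powr \<alpha>)" if k: "1 \<le> k" for k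
  proof -
    have "root_sup ?H k \<le> root k (\<Prod>j=1..m. f_sup (set_power R (P j) k) powr \<alpha>)"
      unfolding root_sup_def using k
      by (intro real_root_le_mono f_sup_hadamard_power_le m \<alpha> P) auto
    also have "\<dots> = (\<Prod>j=1..m. root k (f_sup (set_power R (P j) k) powr \<alpha>))"
    proof -
      have "root k (prod g S) = (\<Prod>j\<in>S. root k (g j))" if "finite S" for g :: "nat \<Rightarrow> real" and S
        using that k by (induction S rule: finite_induct) (auto simp: real_root_mult)
      then show ?thesis by simp
    qed
    also have "\<dots> = (\<Prod>j=1..m. root_sup (P j) k powr \<alpha>)"
    proof (rule prod.cong[OF refl])
      fix j assume j: "j \<in> {1..m}"
      define v where "v = f_sup (set_power R (P j) k)"
      have "0 \<le> v" unfolding v_def by (intro f_sup_nonneg pos_set_power P j)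
      then have "root k (v powr \<alpha>) = root k v powr \<alpha>"
        using k by (simp add: root_powr_inverse powr_powr mult.commute)
      then show "root k (f_sup (set_power R (P j) k) powr \<alpha>) = root_sup (P j) k powr \<alpha>"
        by (simp add: v_def root_sup_def)
    qed
    finally show ?thesis .
  qed
  have le: "rad ?H \<le> (\<Prod>j=1..m. (rad (P j) + e) powr \<alpha>)" if e: "0 < e" for e
  proof (rule rad_le[OF posH])
    have "\<forall>\<^sub>F k in sequentially. \<forall>j\<in>{1..m}. root_sup (P j) k < rad (P j) + e"
      using e by (intro eventually_ball_finite ballI rad_less_eventually P) auto
    then show "\<forall>\<^sub>F k in sequentially. root_sup ?H k \<le> (\<Prod>j=1..m. (rad (P j) + e) powr \<alpha>)"
      using eventually_ge_at_top[of 1]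
    proof eventually_elim
      case (elim k)
      have "root_sup ?H k \<le> (\<Prod>j=1..m. root_sup (P j) k powr \<alpha>)" using elim bound by blast
      also have "\<dots> \<le> (\<Prod>j=1..m. (rad (P j) + e) powr \<alpha>)"
        using elim \<alpha>0 by (intro prod_mono conjI powr_mono2 root_sup_nonneg P) (auto intro: less_imp_le)
      finally show ?case .
    qed
  qed
  show ?thesis
  proof (rule tendsto_lowerbound)
    \<comment> \<open>The base may tend to 0; \<open>powr\<close> still converges there because
      \<alpha> is positive and the base stays nonnegative.\<close>
    have "((\<lambda>e. (rad (P j) + e) powr \<alpha>) \<longlongrightarrow> (rad (P j) + 0) powr \<alpha>) (at_right 0)" if "j \<in> {1..m}" for j
      using \<alpha>0 limsup_eq_rad(2)[OF P[OF that]]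
      by (intro tendsto_powr2 tendsto_intros eventually_mono[OF eventually_at_right_less[of 0]]) auto
    then show "((\<lambda>e. \<Prod>j=1..m. (rad (P j) + e) powr \<alpha>) \<longlongrightarrow> (\<Prod>j=1..m. rad (P j) powr \<alpha>)) (at_right 0)"
      by (intro tendsto_prod) auto
    show "\<forall>\<^sub>F e in at_right 0. rad ?H \<le> (\<Prod>j=1..m. (rad (P j) + e) powr \<alpha>)"
      using eventually_at_right_less[of 0] by eventually_elim (rule le)
  qed simp
qed

lemma f_image_rev_adjoint:
  assumes "\<And>L. L \<in> set Ls \<Longrightarrow> pos_set R L"
  shows "f ` set_prod R (rev (map set_adjoint Ls)) = f ` set_prod R Ls"
proof -
  have adj: "map set_adjoint Ls = map ((`) mat_adjoint) Ls"
    by (simp add: set_adjoint_def)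
  have "f ` set_prod R (rev (map set_adjoint Ls)) =
      (\<lambda>As. f (mat_prod R (rev (map mat_adjoint As)))) ` listset Ls"
    unfolding set_prod_def listset_rev adj listset_map_image by (simp add: image_image)
  also have "\<dots> = (\<lambda>As. f (mat_prod R As)) ` listset Ls"
  proof (rule image_cong[OF refl])
    fix As assume "As \<in> listset Ls"
    then have pos: "\<And>A. A \<in> set As \<Longrightarrow> pos_op R A" using in_listset_pos_op assms by blast
    show "f (mat_prod R (rev (map mat_adjoint As))) = f (mat_prod R As)"
      using f_cong[OF mat_prod_rev_adjoint[OF pos]] f_adjoint[OF pos_op_prod[OF pos]] by simp
  qed
  finally show ?thesis by (simp add: set_prod_def image_image)
qed

lemma root_sup_set_prod:
  assumes "\<And>L. L \<in> set Ls \<Longrightarrow> pos_set R L"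
  shows "root_sup (set_prod R Ls) k = root k (nonneg_Sup (f ` set_prod R (concat (replicate k Ls))))"
proof -
  have "f ` set_power R (set_prod R Ls) k = f ` set_prod R (concat (replicate k Ls))"
    by (intro f_image_cong set_power_set_prod assms)
  then show ?thesis by (simp add: root_sup_def f_sup_def)
qed

text \<open>Reversal with adjoints commutes with repeating the list, and f does not see adjoints, so
  the two sequences of roots agree term by term.\<close>

lemma rad_rev_adjoint:
  assumes "\<And>L. L \<in> set Ls \<Longrightarrow> pos_set R L"
  shows "rad (set_prod R (rev (map set_adjoint Ls))) = rad (set_prod R Ls)"
proof -
  have rc: "concat (replicate k (rev (map set_adjoint Ls))) = rev (map set_adjoint (concat (replicate k Ls)))" for k
    by (simp add: rev_concat map_concat)
  have "root_sup (set_prod R (rev (map set_adjoint Ls))) k = root_sup (set_prod R Ls) k" for k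
  proof -
    have 1: "\<And>L. L \<in> set (rev (map set_adjoint Ls)) \<Longrightarrow> pos_set R L"
      using assms pos_set_adjoint by auto
    have 2: "\<And>L. L \<in> set (concat (replicate k Ls)) \<Longrightarrow> pos_set R L"
      using assms by auto
    have "root_sup (set_prod R (rev (map set_adjoint Ls))) k =
        root k (nonneg_Sup (f ` set_prod R (rev (map set_adjoint (concat (replicate k Ls))))))"
      using root_sup_set_prod[of "rev (map set_adjoint Ls)" k] 1 by (simp only: rc)
    also have "f ` set_prod R (rev (map set_adjoint (concat (replicate k Ls)))) = f ` set_prod R (concat (replicate k Ls))"
      by (rule f_image_rev_adjoint[OF 2])
    also have "root k (nonneg_Sup \<dots>) = root_sup (set_prod R Ls) k"
      by (rule root_sup_set_prod[symmetric]) (rule assms)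
    finally show ?thesis .
  qed
  then show ?thesis by (simp add: rad_eq)
qed

end

interpretation norm_size: operator_size R "mat_norm R" for R
proof
  show "1 \<le> m \<Longrightarrow> 1 / real m \<le> \<alpha> \<Longrightarrow> (\<And>j. j \<in> {1..m} \<Longrightarrow> pos_op R (M j)) \<Longrightarrow>
      mat_norm R (hadamard m \<alpha> M) \<le> (\<Prod>j=1..m. mat_norm R (M j) powr \<alpha>)" for m \<alpha> M
    by (rule hadamard_norm(2))
  show "matrix_op R A = matrix_op R B \<Longrightarrow> mat_norm R A = mat_norm R B" for A B
    by (rule mat_norm_cong)
  show "mat_le R A B \<Longrightarrow> pos_op R B \<Longrightarrow> mat_norm R A \<le> mat_norm R B" for A B
    by (rule mat_norm_mono(2))
qed (simp_all add: pos_op_norm(3) pos_op_adjoint(2))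

section \<open>Properties of the spectral radius of a matrix\<close>

text \<open>Obtained from growth rates instead of spectra: by Gelfand's formula it is
  \<open>joint_spectral_radius_commute\<close> for singletons.\<close>

lemma mat_rho_prod_commute:
  assumes "R \<noteq> {}" and pos: "\<And>A. A \<in> set As \<union> set Bs \<Longrightarrow> pos_op R A"
  shows "mat_rho R (mat_prod R (As @ Bs)) = mat_rho R (mat_prod R (Bs @ As))"
proof -
  have sing: "set_prod R (map (\<lambda>A. {A}) As) = {mat_prod R As}" for As
  proof -
    have "listset (map (\<lambda>A. {A}) As) = {As}"
      by (induction As) (auto simp: set_Cons_def)
    then show ?thesis by (simp add: set_prod_def)
  qed
  have "mat_rho R (mat_prod R (As @ Bs)) = joint_spectral_radius R (set_prod R (map (\<lambda>A. {A}) As @ map (\<lambda>A. {A}) Bs))"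
    unfolding map_append[symmetric] sing using assms by (intro mat_rho_eq pos_op_prod) auto
  also have "\<dots> = joint_spectral_radius R (set_prod R (map (\<lambda>A. {A}) Bs @ map (\<lambda>A. {A}) As))"
    using pos by (intro joint_spectral_radius_commute) (auto intro!: pos_set_singleton)
  also have "\<dots> = mat_rho R (mat_prod R (Bs @ As))"
    unfolding map_append[symmetric] sing using assms by (intro mat_rho_eq[symmetric] pos_op_prod) auto
  finally show ?thesis .
qed

lemma mat_pow_tendsto:
  assumes "pos_op R A" "R \<noteq> {}"
  shows "(\<lambda>k. root k (mat_norm R (mat_pow R A k))) \<longlonglongrightarrow> mat_rho R A"
  using joint_spectral_radius(2)[OF pos_set_singleton[OF assms(1)]]
  by (simp add: set_norm_power_singleton mat_rho_eq assms)

lemma mat_rho_nonneg: "pos_op R A \<Longrightarrow> R \<noteq> {} \<Longrightarrow> 0 \<le> mat_rho R A"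
  by (simp add: mat_rho_eq joint_spectral_radius(1) pos_set_singleton)

lemma mat_rho_power_le_norm:
  assumes "pos_op R A" "R \<noteq> {}" "1 \<le> k"
  shows "mat_rho R A ^ k \<le> mat_norm R (mat_pow R A k)"
  using joint_spectral_radius(3)[OF pos_set_singleton[OF assms(1)] assms(3)]
  by (simp add: set_norm_power_singleton mat_rho_eq assms)

lemma mat_rho_le_norm:
  assumes "pos_op R A" "R \<noteq> {}"
  shows "mat_rho R A \<le> mat_norm R A"
  using mat_rho_power_le_norm[OF assms, of 1] mat_norm_cong[OF mat_mult_one(1)[of R A]] by simp

lemma mat_pow_mono:
  assumes "mat_le R A B" "pos_op R B"
  shows "mat_le R (mat_pow R A k) (mat_pow R B k)"
  using assms by (induction k) (auto intro!: mat_mult_mono pos_op_pow mat_le_refl pos_op_one)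

lemma mat_rho_mono:
  assumes "mat_le R A B" "pos_op R B" "R \<noteq> {}"
  shows "mat_rho R A \<le> mat_rho R B"
proof (rule LIMSEQ_le)
  show "(\<lambda>k. root k (mat_norm R (mat_pow R A k))) \<longlonglongrightarrow> mat_rho R A"
    using mat_norm_mono(1)[OF assms(1,2)] assms(3) by (rule mat_pow_tendsto)
  show "(\<lambda>k. root k (mat_norm R (mat_pow R B k))) \<longlonglongrightarrow> mat_rho R B"
    using assms(2,3) by (rule mat_pow_tendsto)
  have "root k (mat_norm R (mat_pow R A k)) \<le> root k (mat_norm R (mat_pow R B k))" if "1 \<le> k" for k
    using that mat_norm_mono(2)[OF mat_pow_mono[OF assms(1,2)] pos_op_pow[OF assms(2)]] by simp
  then show "\<exists>N. \<forall>k\<ge>N. root k (mat_norm R (mat_pow R A k)) \<le> root k (mat_norm R (mat_pow R B k))" by blast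
qed

lemma mat_rho_hadamard:
  assumes R: "R \<noteq> {}" and m: "1 \<le> m" and \<alpha>: "1 / real m \<le> \<alpha>"
    and M: "\<And>j. j \<in> {1..m} \<Longrightarrow> pos_op R (M j)"
  shows "mat_rho R (hadamard m \<alpha> M) \<le> (\<Prod>j=1..m. mat_rho R (M j) powr \<alpha>)"
proof -
  have sing: "set_hadamard m (\<lambda>_. \<alpha>) (\<lambda>j. {M j}) = {hadamard m \<alpha> M}"
    unfolding set_hadamard_eq by (auto simp: hadamard_def)
  have rho: "limsup_radius R (mat_norm R) {A} = mat_rho R A" if "pos_op R A" for A
    using that R by (simp add: mat_rho_eq joint_spectral_radius_eq pos_set_singleton)
  have "limsup_radius R (mat_norm R) {hadamard m \<alpha> M} \<le> (\<Prod>j=1..m. limsup_radius R (mat_norm R) {M j} powr \<alpha>)"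
    using norm_size.rad_hadamard_le[of m \<alpha> R "\<lambda>j. {M j}"] m \<alpha> M by (simp add: sing pos_set_singleton)
  moreover have "limsup_radius R (mat_norm R) {hadamard m \<alpha> M} = mat_rho R (hadamard m \<alpha> M)"
    by (intro rho hadamard_norm(1) m \<alpha> M)
  moreover have "(\<Prod>j=1..m. limsup_radius R (mat_norm R) {M j} powr \<alpha>) = (\<Prod>j=1..m. mat_rho R (M j) powr \<alpha>)"
    by (intro prod.cong refl) (simp add: rho M)
  ultimately show ?thesis by simp
qed

lemma mat_rho_adjoint:
  assumes A: "pos_op R A" and R: "R \<noteq> {}"
  shows "mat_rho R (mat_adjoint A) = mat_rho R A"
proof (rule LIMSEQ_unique)
  have "mat_norm R (mat_pow R (mat_adjoint A) k) = mat_norm R (mat_pow R A k)" for k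
    using mat_norm_cong[OF mat_prod_rev_adjoint[of "replicate k A" R]] pos_op_adjoint(2)[OF pos_op_pow[OF A, of k]] A
    by simp
  then show "(\<lambda>k. root k (mat_norm R (mat_pow R A k))) \<longlonglongrightarrow> mat_rho R (mat_adjoint A)"
    using mat_pow_tendsto[OF pos_op_adjoint(1)[OF A] R] by simp
  show "(\<lambda>k. root k (mat_norm R (mat_pow R A k))) \<longlonglongrightarrow> mat_rho R A"
    by (rule mat_pow_tendsto[OF A R])
qed

section \<open>Powers, and selfadjoint operators\<close>

lemma mat_pow_pow:
  assumes "pos_op R A"
  shows "matrix_op R (mat_pow R (mat_pow R A k) j) = matrix_op R (mat_pow R A (j * k))"
proof -
  have "concat (replicate j (replicate k A)) = replicate (j * k) A"
    by (induction j) (simp_all add: replicate_add)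
  then show ?thesis
    using mat_prod_concat[of "replicate j (replicate k A)" R] assms by simp
qed

lemma mat_rho_power_le:
  assumes A: "pos_op R A" and R: "R \<noteq> {}" and k: "1 \<le> k"
  shows "mat_rho R A ^ k \<le> mat_rho R (mat_pow R A k)"
proof (rule LIMSEQ_le_const[OF mat_pow_tendsto[OF pos_op_pow[OF A] R]])
  have "mat_rho R A ^ k \<le> root j (mat_norm R (mat_pow R (mat_pow R A k) j))" if j: "1 \<le> j" for j
  proof -
    have "(mat_rho R A ^ k) ^ j \<le> mat_norm R (mat_pow R A (j * k))"
      using mat_rho_power_le_norm[OF A R, of "j * k"] j k by (simp add: power_mult[symmetric] mult.commute)
    then have "root j ((mat_rho R A ^ k) ^ j) \<le> root j (mat_norm R (mat_pow R A (j * k)))"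
      using j by simp
    then show ?thesis
      using j mat_rho_nonneg[OF A R] by (simp add: real_root_power_cancel mat_norm_cong[OF mat_pow_pow[OF A]])
  qed
  then show "\<exists>N. \<forall>j\<ge>N. mat_rho R A ^ k \<le> root j (mat_norm R (mat_pow R (mat_pow R A k) j))" by blast
qed

text \<open>Powers of H are selfadjoint too, so \<open>mat_norm_square_le\<close> can be iterated:
  the norm of H to the power \<open>2 ^ p\<close> is at most the norm of the \<open>2 ^ p\<close>-th
  power of H. Gelfand's formula along this subsequence gives the claim.\<close>

lemma mat_norm_le_rho_selfadjoint:
  assumes H: "pos_op R H" and sym: "matrix_op R (mat_adjoint H) = matrix_op R H" and R: "R \<noteq> {}"
  shows "mat_norm R H \<le> mat_rho R H"
proof -
  have H0: "0 \<le> mat_norm R H" using H by (rule pos_op_norm)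
  have symp: "matrix_op R (mat_adjoint (mat_pow R H k)) = matrix_op R (mat_pow R H k)" for k
  proof -
    have "matrix_op R (mat_pow R (mat_adjoint H) k) = matrix_op R (mat_pow R H k)"
      by (induction k) (auto intro!: mat_mult_cong sym)
    then show ?thesis using mat_prod_rev_adjoint[of "replicate k H" R] H by simp
  qed
  have pow: "mat_norm R H ^ (2 ^ p) \<le> mat_norm R (mat_pow R H (2 ^ p))" for p
  proof (induction p)
    case 0
    then show ?case by (simp add: mat_norm_cong[OF mat_mult_one(1)])
  next
    case (Suc p)
    define Q where "Q = mat_pow R H (2 ^ p)"
    have Q: "pos_op R Q" unfolding Q_def by (rule pos_op_pow[OF H])
    have "mat_norm R H ^ (2 ^ Suc p) = (mat_norm R H ^ (2 ^ p))\<^sup>2"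
      by (simp add: power_mult[symmetric] mult.commute)
    also have "\<dots> \<le> (mat_norm R Q)\<^sup>2" unfolding Q_def using H0 by (intro power_mono Suc) auto
    also have "\<dots> \<le> mat_norm R (mat_mult R (mat_adjoint Q) Q)" by (rule mat_norm_square_le[OF Q])
    also have "\<dots> = mat_norm R (mat_mult R Q Q)"
      unfolding Q_def by (intro mat_norm_cong mat_mult_cong symp refl)
    also have "\<dots> = mat_norm R (mat_prod R (replicate (2 ^ p) H @ replicate (2 ^ p) H))"
      unfolding Q_def using H by (intro mat_norm_cong mat_prod_append[symmetric]) auto
    also have "\<dots> = mat_norm R (mat_pow R H (2 ^ Suc p))"
      by (simp add: replicate_add[symmetric] mult_2)
    finally show ?case .
  qed
  have "strict_mono (\<lambda>p. 2 ^ p :: nat)" by (rule strict_monoI) simp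
  from LIMSEQ_subseq_LIMSEQ[OF mat_pow_tendsto[OF H R] this]
  have lim: "(\<lambda>p. root (2 ^ p) (mat_norm R (mat_pow R H (2 ^ p)))) \<longlonglongrightarrow> mat_rho R H"
    by (simp add: o_def)
  show ?thesis
  proof (rule LIMSEQ_le_const[OF lim])
    have "mat_norm R H \<le> root (2 ^ p) (mat_norm R (mat_pow R H (2 ^ p)))" for p
    proof -
      have "root (2 ^ p) (mat_norm R H ^ (2 ^ p)) \<le> root (2 ^ p) (mat_norm R (mat_pow R H (2 ^ p)))"
        using pow[of p] by simp
      then show ?thesis using H0 by (simp add: real_root_power_cancel)
    qed
    then show "\<exists>N. \<forall>p\<ge>N. mat_norm R H \<le> root (2 ^ p) (mat_norm R (mat_pow R H (2 ^ p)))" by blast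
  qed
qed

lemma mat_norm_power_le_rho:
  assumes N: "pos_op R N" and R: "R \<noteq> {}" and n: "even n" "0 < n"
  shows "mat_norm R N ^ n \<le> mat_rho R (mat_prod R (map (\<lambda>i. if even i then mat_adjoint N else N) [0..<n]))"
proof -
  obtain l where l: "n = 2 * l" "1 \<le> l" using n by (auto elim!: evenE)
  \<comment> \<open>H is written as the product of a two-element list, so that its powers flatten to
    the alternating list by \<open>mat_prod_concat\<close>.\<close>
  define H where "H = mat_prod R [mat_adjoint N, N]"
  have H: "pos_op R H" unfolding H_def using N pos_op_adjoint(1) by (intro pos_op_prod) auto
  have HN: "matrix_op R H = matrix_op R (mat_mult R (mat_adjoint N) N)"
    unfolding H_def mat_prod_Cons mat_prod_Nil by (intro mat_mult_cong mat_mult_one(1) refl)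
  have sym: "matrix_op R (mat_adjoint H) = matrix_op R H"
    using mat_adjoint_cong[OF HN] HN by (simp add: mat_adjoint_mult)
  have "(mat_norm R N)\<^sup>2 \<le> mat_norm R H"
    using mat_norm_square_le[OF N] mat_norm_cong[OF HN] by simp
  also have "\<dots> \<le> mat_rho R H" by (rule mat_norm_le_rho_selfadjoint[OF H sym R])
  finally have "((mat_norm R N)\<^sup>2) ^ l \<le> mat_rho R H ^ l" by (rule power_mono) simp
  also have "\<dots> \<le> mat_rho R (mat_pow R H l)" by (rule mat_rho_power_le[OF H R l(2)])
  also have "\<dots> = mat_rho R (mat_prod R (concat (replicate l [mat_adjoint N, N])))"
    using mat_prod_concat[of "replicate l [mat_adjoint N, N]" R] N pos_op_adjoint(1)
    by (intro mat_rho_cong) (auto simp: H_def)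
  also have "concat (replicate l [mat_adjoint N, N]) = map (\<lambda>i. if even i then mat_adjoint N else N) [0..<n]"
    unfolding l(1)
  proof (induction l)
    case (Suc l)
    show ?case unfolding concat_replicate_Suc Suc by simp
  qed simp
  finally show ?thesis by (simp add: l(1) power_mult)
qed

section \<open>Rotations of alternating products\<close>

text \<open>Cyclic invariance is assumed here because its two proofs differ. For the norm, commuting
  costs a constant that vanishes only in the limit; for the spectral radius, the sets of values on
  the k-th powers already coincide for every k.\<close>

locale spectral_size = operator_size +
  assumes nonempty: "R \<noteq> {}"
    and mat_rho_le: "pos_op R A \<Longrightarrow> mat_rho R A \<le> f A"
    and rad_commute: "(\<And>L. L \<in> set Ls \<union> set Ms \<Longrightarrow> pos_set R L) \<Longrightarrow>
      rad (set_prod R (Ls @ Ms)) = rad (set_prod R (Ms @ Ls))"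
begin

lemma rad_rotate:
  assumes "\<And>L. L \<in> set Ls \<Longrightarrow> pos_set R L"
  shows "rad (set_prod R (rotate d Ls)) = rad (set_prod R Ls)"
proof -
  let ?k = "d mod length Ls"
  have "rad (set_prod R (drop ?k Ls @ take ?k Ls)) = rad (set_prod R (take ?k Ls @ drop ?k Ls))"
    using assms by (intro rad_commute) (auto dest: in_set_takeD in_set_dropD)
  then show ?thesis by (simp add: rotate_drop_take)
qed

text \<open>The k-th power of S belongs to the k-th power of the set, and its size is at least the
  k-th power of the spectral radius of S. So the bound holds for every k \<ge> 1, not only in the
  limit.\<close>

lemma mat_rho_le_rad:
  assumes \<Sigma>: "pos_set R \<Sigma>" and S: "S \<in> \<Sigma>"
  shows "mat_rho R S \<le> rad \<Sigma>"
proof (rule le_rad[OF \<Sigma>])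
  have pos: "pos_op R S" using pos_set_norm(1)[OF \<Sigma> S] .
  fix k :: nat assume k: "1 \<le> k"
  have "mat_pow R S k \<in> set_power R \<Sigma> k"
    unfolding set_power_def set_prod_def using S
    by (intro imageI) (auto simp: in_listset_iff list_all2_conv_all_nth)
  then have "f (mat_pow R S k) \<le> f_sup (set_power R \<Sigma> k)"
    by (rule f_sup_upper[OF pos_set_power[OF \<Sigma>]])
  then have "mat_rho R S ^ k \<le> f_sup (set_power R \<Sigma> k)"
    using mat_rho_power_le[OF pos nonempty k] mat_rho_le[OF pos_op_pow[OF pos, of k]] by linarith
  then have "root k (mat_rho R S ^ k) \<le> root_sup \<Sigma> k"
    unfolding root_sup_def using k by simp
  then show "mat_rho R S \<le> root_sup \<Sigma> k"
    using k mat_rho_nonneg[OF pos nonempty] by (simp add: real_root_power_cancel)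
qed

end

lemma norm_spectral_size:
  assumes "R \<noteq> {}"
  shows "spectral_size R (mat_norm R)"
proof unfold_locales
  show "R \<noteq> {}" by fact
  show "pos_op R A \<Longrightarrow> mat_rho R A \<le> mat_norm R A" for A
    using mat_rho_le_norm assms by blast
  show "limsup_radius R (mat_norm R) (set_prod R (Ls @ Ms)) = limsup_radius R (mat_norm R) (set_prod R (Ms @ Ls))"
    if "\<And>L. L \<in> set Ls \<union> set Ms \<Longrightarrow> pos_set R L" for Ls Ms
  proof -
    have "pos_set R (set_prod R (Ls @ Ms))" "pos_set R (set_prod R (Ms @ Ls))"
      using that by (auto intro!: pos_set_prod)
    moreover have "joint_spectral_radius R (set_prod R (Ls @ Ms)) = joint_spectral_radius R (set_prod R (Ms @ Ls))"
      by (rule joint_spectral_radius_commute) (rule that)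
    ultimately show ?thesis by (simp only: joint_spectral_radius_eq)
  qed
qed

lemma rho_spectral_size:
  assumes R: "R \<noteq> {}"
  shows "spectral_size R (mat_rho R)"
proof -
  interpret operator_size R "mat_rho R"
  proof
    show "pos_op R A \<Longrightarrow> 0 \<le> mat_rho R A" for A using R mat_rho_nonneg by blast
    show "pos_op R A \<Longrightarrow> mat_rho R A \<le> mat_norm R A" for A using R mat_rho_le_norm by blast
    show "matrix_op R A = matrix_op R B \<Longrightarrow> mat_rho R A = mat_rho R B" for A B by (rule mat_rho_cong)
    show "mat_le R A B \<Longrightarrow> pos_op R B \<Longrightarrow> mat_rho R A \<le> mat_rho R B" for A B
      using R by (intro mat_rho_mono)
    show "1 \<le> m \<Longrightarrow> 1 / real m \<le> \<alpha> \<Longrightarrow> (\<And>j. j \<in> {1..m} \<Longrightarrow> pos_op R (M j)) \<Longrightarrow>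
      mat_rho R (hadamard m \<alpha> M) \<le> (\<Prod>j=1..m. mat_rho R (M j) powr \<alpha>)" for m \<alpha> M
      by (rule mat_rho_hadamard[OF R])
    show "pos_op R A \<Longrightarrow> mat_rho R (mat_adjoint A) = mat_rho R A" for A using R by (intro mat_rho_adjoint)
  qed
  show ?thesis
  proof unfold_locales
    show "R \<noteq> {}" by fact
    fix Ls Ms assume *: "\<And>L. L \<in> set Ls \<union> set Ms \<Longrightarrow> pos_set R L"
    have swap: "mat_rho R ` set_prod R (Xs @ Ys) \<subseteq> mat_rho R ` set_prod R (Ys @ Xs)"
      if pos: "\<And>L. L \<in> set Xs \<union> set Ys \<Longrightarrow> pos_set R L" for Xs Ys
    proof
      fix v assume "v \<in> mat_rho R ` set_prod R (Xs @ Ys)"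
      then obtain As Bs where AB: "v = mat_rho R (mat_prod R (As @ Bs))" "As \<in> listset Xs" "Bs \<in> listset Ys"
        by (auto simp: set_prod_def listset_append)
      have "v = mat_rho R (mat_prod R (Bs @ As))"
        unfolding AB(1) using in_listset_pos_op[OF AB(2)] in_listset_pos_op[OF AB(3)] pos
        by (intro mat_rho_prod_commute R) blast
      then show "v \<in> mat_rho R ` set_prod R (Ys @ Xs)"
        using AB by (auto simp: set_prod_def listset_append)
    qed
    have "root_sup (set_prod R (Ls @ Ms)) k = root_sup (set_prod R (Ms @ Ls)) k" for k
    proof (cases k)
      case (Suc l)
      \<comment> \<open>With this middle piece the two k-fold lists are \<open>Ls @ X\<close> and
        \<open>X @ Ls\<close>, so a single exchange of two blocks suffices.\<close>
      define X where "X = concat (replicate l (Ms @ Ls)) @ Ms"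
      have X: "concat (replicate k (Ls @ Ms)) = Ls @ X" "concat (replicate k (Ms @ Ls)) = X @ Ls"
        by (simp only: X_def Suc concat_replicate_append)
          (simp only: X_def Suc concat_replicate_Suc append_assoc)
      have "set X \<subseteq> set Ls \<union> set Ms" unfolding X_def by (induction l) auto
      then have pos: "\<And>L. L \<in> set Ls \<union> set X \<Longrightarrow> pos_set R L"
        using * by blast
      have "mat_rho R ` set_prod R (Ls @ X) = mat_rho R ` set_prod R (X @ Ls)"
        using pos by (intro antisym swap) auto
      moreover have "root_sup (set_prod R (Ls @ Ms)) k = root k (nonneg_Sup (mat_rho R ` set_prod R (Ls @ X)))"
        unfolding X(1)[symmetric] using * by (intro root_sup_set_prod) auto
      moreover have "root_sup (set_prod R (Ms @ Ls)) k = root k (nonneg_Sup (mat_rho R ` set_prod R (X @ Ls)))"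
        unfolding X(2)[symmetric] using * by (intro root_sup_set_prod) auto
      ultimately show ?thesis by simp
    qed (simp add: root_sup_def)
    then show "limsup_radius R (mat_rho R) (set_prod R (Ls @ Ms)) = limsup_radius R (mat_rho R) (set_prod R (Ms @ Ls))"
      by (simp add: rad_eq)
  qed simp
qed

section \<open>Cyclic indices and rotated lists of factors\<close>

lemma cyclic_index_add_mult: "m dvd d \<Longrightarrow> 1 \<le> j \<Longrightarrow> cyclic_index m (j + d) = cyclic_index m j"
  using mod_mult_self2[of "j - 1" m] by (auto simp: cyclic_index_def dvd_def)

lemma cyclic_index_in: "1 \<le> m \<Longrightarrow> cyclic_index m j \<in> {1..m}"
  by (simp add: cyclic_index_def Suc_leI)

lemma cyclic_index_id:
  assumes "j \<in> {1..m}"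
  shows "cyclic_index m j = j"
proof -
  have "j - 1 < m" using assms by auto
  then show ?thesis using assms by (simp add: cyclic_index_def)
qed

lemma cyclic_index_bij:
  assumes m: "1 \<le> m"
  shows "bij_betw (\<lambda>j. cyclic_index m (j + t)) {1..m} {1..m}"
proof -
  have le: "a = b" if ab: "a \<in> {1..m}" "b \<in> {1..m}" "b \<le> a"
    and eq: "cyclic_index m (a + t) = cyclic_index m (b + t)" for a b
  proof -
    have "(a + t - 1) mod m = (b + t - 1) mod m" using eq by (simp add: cyclic_index_def)
    then have "m dvd (a + t - 1) - (b + t - 1)" using ab by (subst (asm) mod_eq_dvd_iff_nat) auto
    moreover have "(a + t - 1) - (b + t - 1) = a - b" "a - b < m" using ab by auto
    ultimately show "a = b" using ab nat_dvd_not_less[of "a - b" m] by (cases "a = b") auto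
  qed
  have "inj_on (\<lambda>j. cyclic_index m (j + t)) {1..m}"
  proof (rule inj_onI)
    fix a b assume "a \<in> {1..m}" "b \<in> {1..m}" "cyclic_index m (a + t) = cyclic_index m (b + t)"
    then show "a = b" using le[of a b] le[of b a] by (cases "b \<le> a") auto
  qed
  moreover have "(\<lambda>j. cyclic_index m (j + t)) ` {1..m} \<subseteq> {1..m}"
    using cyclic_index_in[OF m] by blast
  ultimately show ?thesis by (simp add: bij_betw_def endo_inj_surj)
qed

lemma length_alternating [simp]: "length (alternating star idx \<Psi> n) = n"
  by (simp add: alternating_def)

lemma nth_alternating:
  "i < n \<Longrightarrow> alternating star idx \<Psi> n ! i = (if star i then set_adjoint (\<Psi> (idx i)) else \<Psi> (idx i))"
  by (simp add: alternating_def)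

lemma even_mod_iff: "even n \<Longrightarrow> even ((i::nat) mod n) \<longleftrightarrow> even i"
  by (metis dvd_mod_iff)

lemma cyclic_index_mod:
  assumes "m dvd n" "1 \<le> j"
  shows "cyclic_index m (j + i mod n) = cyclic_index m (j + i)"
proof -
  have "(j - 1 + i mod n) mod m = (j - 1 + i) mod m"
    by (metis assms(1) mod_add_right_eq mod_mod_cancel)
  then show ?thesis using assms(2) by (simp add: cyclic_index_def)
qed

lemma alternating_shift_period:
  assumes "1 \<le> j"
  shows "alternating star (\<lambda>i. cyclic_index m (j + m + i)) \<Psi> n = alternating star (\<lambda>i. cyclic_index m (j + i)) \<Psi> n"
proof -
  have "cyclic_index m (j + m + i) = cyclic_index m (j + i)" for i
    using cyclic_index_add_mult[of m m "j + i"] assms by (simp add: add.commute add.left_commute)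
  then show ?thesis by simp
qed

text \<open>Wrapping around at n respects the stars because n is even, and the indices because m
  divides n. An even rotation keeps the star pattern; an odd one exchanges starred and unstarred
  positions, as in the lemma that follows.\<close>

lemma alternating_rotate_even:
  assumes n: "even n" "m dvd n" and d: "even d" and j: "1 \<le> j"
  shows "alternating even (\<lambda>i. cyclic_index m (j + d + i)) \<Psi> n =
    rotate d (alternating even (\<lambda>i. cyclic_index m (j + i)) \<Psi> n)"
proof (rule nth_equalityI)
  fix i assume i: "i < length (alternating even (\<lambda>i. cyclic_index m (j + d + i)) \<Psi> n)"
  then have "(d + i) mod n < n" by auto
  then show "alternating even (\<lambda>i. cyclic_index m (j + d + i)) \<Psi> n ! i =
      rotate d (alternating even (\<lambda>i. cyclic_index m (j + i)) \<Psi> n) ! i"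
    using i n d j by (simp add: nth_rotate nth_alternating even_mod_iff cyclic_index_mod add.assoc)
qed simp

lemma alternating_rotate_odd:
  assumes n: "even n" "m dvd n" and d: "odd d" and j: "1 \<le> j"
  shows "alternating odd (\<lambda>i. cyclic_index m (j + d + i)) \<Psi> n =
    rotate d (alternating even (\<lambda>i. cyclic_index m (j + i)) \<Psi> n)"
proof (rule nth_equalityI)
  fix i assume i: "i < length (alternating odd (\<lambda>i. cyclic_index m (j + d + i)) \<Psi> n)"
  then have "(d + i) mod n < n" by auto
  then show "alternating odd (\<lambda>i. cyclic_index m (j + d + i)) \<Psi> n ! i =
      rotate d (alternating even (\<lambda>i. cyclic_index m (j + i)) \<Psi> n) ! i"
    using i n d j by (simp add: nth_rotate nth_alternating even_mod_iff cyclic_index_mod add.assoc)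
qed simp

text \<open>The list starting at 2 ends with the unstarred factor of index 1. Reversal with adjoints
  brings this factor to the front with a star, followed by the indices m, ..., 2. Rotating by one
  moves it to the end, which is the second product of the even case.\<close>

lemma alternating_reverse:
  assumes m: "even m" "1 \<le> m"
  shows "alternating odd (\<lambda>i. m - i) \<Psi> m =
    rotate 1 (rev (map set_adjoint (alternating even (\<lambda>i. cyclic_index m (2 + i)) \<Psi> m)))"
    (is "?L = rotate 1 (rev (map set_adjoint ?M))")
proof (rule nth_equalityI)
  define M where "M = ?M"
  have m2: "2 \<le> m" using m by (auto elim!: evenE)
  fix i assume "i < length ?L"
  then have i: "i < m" by simp
  define k where "k = Suc i mod m"
  have k: "k < m" using m2 by (simp add: k_def)
  have "length M = m" by (simp add: M_def)
  then have "rotate 1 (rev (map set_adjoint M)) ! i = set_adjoint (M ! (m - Suc k))"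
    using i k by (subst nth_rotate) (simp_all add: rev_nth k_def)
  then have "rotate 1 (rev (map set_adjoint ?M)) ! i = set_adjoint (?M ! (m - Suc k))"
    unfolding M_def .
  also have "\<dots> = (if even (m - Suc k) then \<Psi> (cyclic_index m (2 + (m - Suc k)))
      else set_adjoint (\<Psi> (cyclic_index m (2 + (m - Suc k)))))"
    using k by (simp add: nth_alternating)
  also have "\<dots> = ?L ! i"
  proof (cases "Suc i = m")
    \<comment> \<open>The last position: the rotation fetches its factor from the front of the
      reversed list, where the index m + 1 wraps around to 1.\<close>
    case True
    then have "k = 0" by (simp add: k_def)
    then have "cyclic_index m (2 + (m - Suc k)) = 1" using m2 by (simp add: cyclic_index_def)
    moreover have "odd i" using True m(1) by auto
    ultimately show ?thesis using \<open>k = 0\<close> True m i by (auto simp: nth_alternating)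
  next
    case False
    then have "k = Suc i" using i by (simp add: k_def)
    then have "cyclic_index m (2 + (m - Suc k)) = m - i" using i k by (simp add: cyclic_index_def)
    moreover have "even (m - Suc k) \<longleftrightarrow> even i" using \<open>k = Suc i\<close> k m(1) by simp
    ultimately show ?thesis using i by (simp add: nth_alternating)
  qed
  finally show "?L ! i = rotate 1 (rev (map set_adjoint ?M)) ! i" by simp
qed simp

section \<open>The inequalities\<close>

text \<open>Lists the factors of \<open>P j\<close> for n = m and those of \<open>Q j\<close> for n
  = 2 * m. The arguments common to both parities are carried out for a positive even multiple n of
  m.\<close>

definition starred_from :: "nat \<Rightarrow> nat \<Rightarrow> (nat \<Rightarrow> matrix set) \<Rightarrow> nat \<Rightarrow> matrix set list" where
  "starred_from m n \<Psi> j = alternating even (\<lambda>i. cyclic_index m (j + i)) \<Psi> n"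

context spectral_size
begin

context
  fixes m n :: nat and \<alpha> :: real and \<Psi> :: "nat \<Rightarrow> matrix set"
  assumes m: "1 \<le> m" and n: "even n" "0 < n" "m dvd n" and \<alpha>: "1 / real m \<le> \<alpha>"
    and \<Psi>: "\<And>j. j \<in> {1..m} \<Longrightarrow> pos_set R (\<Psi> j)"
begin

abbreviation "alt j \<equiv> starred_from m n \<Psi> j"

lemma alt_pos: "L \<in> set (alt j) \<Longrightarrow> pos_set R L"
  using cyclic_index_in[OF m] by (auto simp: starred_from_def alternating_def intro!: \<Psi> pos_set_adjoint)

lemma alt_prod_pos: "pos_set R (set_prod R (alt j))"
  by (intro pos_set_prod alt_pos)

lemma alt_hadamard_pos: "pos_set R (set_hadamard m (\<lambda>_. \<alpha>) (\<lambda>j. set_prod R (alt j)))"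
  by (intro pos_set_hadamard m \<alpha> alt_prod_pos)

text \<open>Every factor of \<open>(N\<^sup>* N)\<^bsup>n/2\<^esup>\<close> is a Hadamard product over all \<open>j\<close>, so its Hadamard factors may be
  permuted cyclically by one more step from each factor to the next before the product is
  distributed over the Hadamard product.\<close>

lemma set_norm_power_le_rad:
  "set_norm R (set_hadamard m (\<lambda>_. \<alpha>) \<Psi>) \<le>
    rad (set_hadamard m (\<lambda>_. \<alpha>) (\<lambda>j. set_prod R (alt j))) powr (1 / real n)"
proof (rule set_norm_least)
  let ?\<Sigma> = "set_hadamard m (\<lambda>_. \<alpha>) (\<lambda>j. set_prod R (alt j))"
  fix N assume "N \<in> set_hadamard m (\<lambda>_. \<alpha>) \<Psi>"
  then obtain A where A: "N = hadamard m \<alpha> A" "\<And>j. j \<in> {1..m} \<Longrightarrow> A j \<in> \<Psi> j"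
    by (auto simp: set_hadamard_eq)
  have Apos: "pos_op R (A j)" if "j \<in> {1..m}" for j
    using pos_set_norm(1)[OF \<Psi>[OF that] A(2)[OF that]] .
  have N: "pos_op R N" unfolding A(1) by (rule hadamard_norm(1)[OF m \<alpha> Apos])
  define B where "B t j = (if even t then mat_adjoint (A (cyclic_index m (j + t))) else A (cyclic_index m (j + t)))"
    for t j
  have Bpos: "pos_op R (B t j)" for t j
    unfolding B_def using Apos cyclic_index_in[OF m] pos_op_adjoint(1) by auto
  have factor: "(if even t then mat_adjoint N else N) = hadamard m \<alpha> (B t)" for t
  proof -
    have perm: "(\<Prod>j=1..m. A (cyclic_index m (j + t)) i k powr \<alpha>) = (\<Prod>j=1..m. A j i k powr \<alpha>)" for i k
      by (rule prod.reindex_bij_betw[OF cyclic_index_bij[OF m, of t], of "\<lambda>j. A j i k powr \<alpha>"])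
    show ?thesis
      by (auto simp: fun_eq_iff A(1) hadamard_def mat_adjoint_def B_def perm simp del: One_nat_def)
  qed
  define S where "S = hadamard m \<alpha> (\<lambda>j. mat_prod R (map (\<lambda>t. B t j) [0..<n]))"
  have "mat_prod R (map (\<lambda>t. B t j) [0..<n]) \<in> set_prod R (alt j)" if "j \<in> {1..m}" for j
    unfolding set_prod_def
  proof (rule imageI)
    have "B t j \<in> alt j ! t" if "t < n" for t
      using that A(2)[OF cyclic_index_in[OF m]] by (auto simp: starred_from_def nth_alternating B_def set_adjoint_def)
    then show "map (\<lambda>t. B t j) [0..<n] \<in> listset (alt j)"
      by (auto simp: in_listset_iff list_all2_conv_all_nth starred_from_def)
  qed
  then have S: "S \<in> ?\<Sigma>" unfolding S_def set_hadamard_eq by blast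
  have "mat_norm R N ^ n \<le> mat_rho R (mat_prod R (map (\<lambda>t. if even t then mat_adjoint N else N) [0..<n]))"
    by (rule mat_norm_power_le_rho[OF N nonempty n(1,2)])
  also have "\<dots> = mat_rho R (mat_prod R (map (\<lambda>t. hadamard m \<alpha> (B t)) [0..<n]))"
    unfolding factor ..
  also have "\<dots> \<le> mat_rho R S"
    unfolding S_def by (intro mat_rho_mono hadamard_prod_le hadamard_norm(1) pos_op_prod m \<alpha> nonempty)
      (auto simp: Bpos)
  also have "\<dots> \<le> rad ?\<Sigma>" by (rule mat_rho_le_rad[OF alt_hadamard_pos S])
  finally have "(mat_norm R N ^ n) powr (1 / real n) \<le> rad ?\<Sigma> powr (1 / real n)"
    using pos_op_norm(3)[OF N] by (intro powr_mono2) auto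
  moreover have "(mat_norm R N ^ n) powr (1 / real n) = mat_norm R N"
    using pos_op_norm(3)[OF N] n(2) by (simp add: root_powr_inverse[symmetric] real_root_power_cancel)
  ultimately show "mat_norm R N \<le> rad ?\<Sigma> powr (1 / real n)" by simp
qed simp

lemma rad_alt_hadamard_le:
  "rad (set_hadamard m (\<lambda>_. \<alpha>) (\<lambda>j. set_prod R (alt j))) \<le> (\<Prod>j=1..m. rad (set_prod R (alt j)) powr \<alpha>)"
  by (intro rad_hadamard_le m \<alpha> alt_prod_pos)

lemma rad_alt_shift:
  assumes "even d" "1 \<le> j"
  shows "rad (set_prod R (alt (j + d))) = rad (set_prod R (alt j))"
proof -
  have "alt (j + d) = rotate d (alt j)"
    unfolding starred_from_def by (rule alternating_rotate_even[OF n(1,3) assms])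
  then show ?thesis by (simp add: rad_rotate alt_pos)
qed

end

end

text \<open>The source of the exponent \<alpha>/2. For even m there are h = m/2 equal pairs of radii
  under an m-th root; for odd m there are h = m equal radii under a 2m-th root.\<close>

lemma powr_powr_root:
  fixes t :: real
  assumes "0 \<le> t" "1 \<le> h"
  shows "((t powr \<alpha>) ^ h) powr (1 / (2 * real h)) = t powr (\<alpha> / 2)"
proof (cases "t = 0")
  case False
  then have "(t powr \<alpha>) ^ h = t powr (real h * \<alpha>)" by (rule powr_power)
  then show ?thesis using assms by (simp add: powr_powr)
qed (use assms in simp)

lemma prod_alternate:
  fixes a b :: real
  shows "(\<Prod>j=1..2 * h. if odd j then a else b) = (a * b) ^ h"
  by (induction h) (auto simp: prod.nat_ivl_Suc' mult_ac)

context spectral_size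
begin

text \<open>All shifts by even amounts leave the radius of a factor product unchanged, so the m
  radii reduce to two values, at j = 1 and at j = 2. The latter is matched with the reversed product
  by \<open>alternating_reverse\<close>.\<close>

lemma hadamard_bounds_even:
  assumes m: "1 \<le> m" "even m" and \<alpha>: "1 / real m \<le> \<alpha>"
    and \<Psi>: "\<And>j. j \<in> {1..m} \<Longrightarrow> pos_set R (\<Psi> j)"
  defines "P \<equiv> \<lambda>j. set_prod R (alternating even (\<lambda>i. cyclic_index m (j + i)) \<Psi> m)"
  shows "set_norm R (set_hadamard m (\<lambda>_. \<alpha>) \<Psi>) \<le> rad (set_hadamard m (\<lambda>_. \<alpha>) P) powr (1 / real m)"
    and "rad (set_hadamard m (\<lambda>_. \<alpha>) P) powr (1 / real m)
      \<le> (rad (set_prod R (alternating even (\<lambda>i. 1 + i) \<Psi> m)) *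
          rad (set_prod R (alternating odd (\<lambda>i. m - i) \<Psi> m))) powr (\<alpha> / 2)"
proof -
  obtain h where h: "m = 2 * h" "1 \<le> h" using m by (auto elim!: evenE)
  have n: "even m" "0 < m" "m dvd m" using m by auto
  define r where "r j = rad (set_prod R (starred_from m m \<Psi> j))" for j
  have P: "P = (\<lambda>j. set_prod R (starred_from m m \<Psi> j))"
    by (simp add: P_def starred_from_def)
  show "set_norm R (set_hadamard m (\<lambda>_. \<alpha>) \<Psi>) \<le> rad (set_hadamard m (\<lambda>_. \<alpha>) P) powr (1 / real m)"
    unfolding P by (rule set_norm_power_le_rad[OF m(1) n \<alpha> \<Psi>])
  have pos: "pos_set R L" if "L \<in> set (starred_from m m \<Psi> j)" for L j
    by (rule alt_pos[OF m(1) n \<alpha> \<Psi> that])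
  have r0: "0 \<le> r j" for j unfolding r_def by (intro limsup_eq_rad pos_set_prod pos)
  have shift: "r (j + d) = r j" if "even d" "1 \<le> j" for d j
    unfolding r_def by (rule rad_alt_shift[OF m(1) n \<alpha> \<Psi> that])
  have r: "r j = (if odd j then r 1 else r 2)" if j: "j \<in> {1..m}" for j
  proof (cases "odd j")
    case True
    then have "even (j - 1)" "j = 1 + (j - 1)" using j by auto
    then show ?thesis using True shift[of "j - 1" 1] by simp
  next
    case False
    then have "even (j - 2)" "j = 2 + (j - 2)" using j by (auto elim!: evenE)
    then show ?thesis using False shift[of "j - 2" 2] by simp
  qed
  have "rad (set_hadamard m (\<lambda>_. \<alpha>) P) \<le> (\<Prod>j=1..m. r j powr \<alpha>)"
    unfolding P r_def by (rule rad_alt_hadamard_le[OF m(1) n \<alpha> \<Psi>])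
  also have "\<dots> = (\<Prod>j=1..2 * h. if odd j then r 1 powr \<alpha> else r 2 powr \<alpha>)"
    unfolding h(1)[symmetric] using r by (intro prod.cong refl) (metis (full_types))
  also have "\<dots> = ((r 1 * r 2) powr \<alpha>) ^ h"
    unfolding prod_alternate using r0 by (simp add: powr_mult)
  finally have "rad (set_hadamard m (\<lambda>_. \<alpha>) P) powr (1 / real m) \<le> (((r 1 * r 2) powr \<alpha>) ^ h) powr (1 / real m)"
    unfolding P using limsup_eq_rad(2)[OF alt_hadamard_pos[OF m(1) n \<alpha> \<Psi>]] by (intro powr_mono2) auto
  also have "\<dots> = (r 1 * r 2) powr (\<alpha> / 2)"
    using powr_powr_root[of "r 1 * r 2" h \<alpha>] r0 h by simp
  also have "starred_from m m \<Psi> 1 = alternating even (\<lambda>i. 1 + i) \<Psi> m"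
    unfolding starred_from_def alternating_def
    by (intro map_cong refl) (auto simp: cyclic_index_id)
  then have "r 1 = rad (set_prod R (alternating even (\<lambda>i. 1 + i) \<Psi> m))" by (simp only: r_def)
  also have "r 2 = rad (set_prod R (alternating odd (\<lambda>i. m - i) \<Psi> m))"
  proof -
    have "rad (set_prod R (alternating odd (\<lambda>i. m - i) \<Psi> m)) =
        rad (set_prod R (rotate 1 (rev (map set_adjoint (starred_from m m \<Psi> 2)))))"
      unfolding alternating_reverse[OF m(2,1)] starred_from_def ..
    also have "\<dots> = rad (set_prod R (rev (map set_adjoint (starred_from m m \<Psi> 2))))"
      using pos by (intro rad_rotate) (auto intro!: pos_set_adjoint)
    also have "\<dots> = r 2"
      unfolding r_def by (intro rad_rev_adjoint pos)
    finally show ?thesis ..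
  qed
  finally show "rad (set_hadamard m (\<lambda>_. \<alpha>) P) powr (1 / real m)
      \<le> (rad (set_prod R (alternating even (\<lambda>i. 1 + i) \<Psi> m)) *
          rad (set_prod R (alternating odd (\<lambda>i. m - i) \<Psi> m))) powr (\<alpha> / 2)" .
qed

lemma hadamard_bounds_odd:
  assumes m: "1 \<le> m" "odd m" and \<alpha>: "1 / real m \<le> \<alpha>"
    and \<Psi>: "\<And>j. j \<in> {1..m} \<Longrightarrow> pos_set R (\<Psi> j)"
  defines "Q \<equiv> \<lambda>j. set_prod R (alternating even (\<lambda>i. cyclic_index m (j + i)) \<Psi> (2 * m))"
  shows "set_norm R (set_hadamard m (\<lambda>_. \<alpha>) \<Psi>) \<le> rad (set_hadamard m (\<lambda>_. \<alpha>) Q) powr (1 / (2 * real m))"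
    and "rad (set_hadamard m (\<lambda>_. \<alpha>) Q) powr (1 / (2 * real m))
      \<le> rad (set_prod R (alternating odd (\<lambda>i. cyclic_index m (1 + i)) \<Psi> (2 * m))) powr (\<alpha> / 2)"
proof -
  have n: "even (2 * m)" "0 < 2 * m" "m dvd 2 * m" using m by auto
  define r where "r j = rad (set_prod R (starred_from m (2 * m) \<Psi> j))" for j
  have Q: "Q = (\<lambda>j. set_prod R (starred_from m (2 * m) \<Psi> j))"
    by (simp add: Q_def starred_from_def)
  show "set_norm R (set_hadamard m (\<lambda>_. \<alpha>) \<Psi>) \<le> rad (set_hadamard m (\<lambda>_. \<alpha>) Q) powr (1 / (2 * real m))"
    using set_norm_power_le_rad[OF m(1) n \<alpha> \<Psi>] unfolding Q by simp
  have pos: "pos_set R L" if "L \<in> set (starred_from m (2 * m) \<Psi> j)" for L j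
    by (rule alt_pos[OF m(1) n \<alpha> \<Psi> that])
  have r0: "0 \<le> r j" for j unfolding r_def by (intro limsup_eq_rad pos_set_prod pos)
  have shift: "r (j + d) = r j" if "even d" "1 \<le> j" for d j
    unfolding r_def by (rule rad_alt_shift[OF m(1) n \<alpha> \<Psi> that])
  have r: "r j = r 1" if j: "j \<in> {1..m}" for j
  proof (cases "odd j")
    case True
    then have "even (j - 1)" "j = 1 + (j - 1)" using j by auto
    then show ?thesis using shift[of "j - 1" 1] by simp
  next
    case False
    \<comment> \<open>For even j the shift from 1 to j is odd. Adding m does not change the list and
      makes the shift even, since m is odd; hence all m radii coincide.\<close>
    have "starred_from m (2 * m) \<Psi> (j + m) = starred_from m (2 * m) \<Psi> j"
      unfolding starred_from_def using j by (intro alternating_shift_period) auto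
    moreover have "even (j + m - 1)" "j + m = 1 + (j + m - 1)" using False m(2) j by auto
    ultimately show ?thesis
      using shift[of "j + m - 1" 1] by (simp add: r_def)
  qed
  have "rad (set_hadamard m (\<lambda>_. \<alpha>) Q) \<le> (\<Prod>j=1..m. r j powr \<alpha>)"
    unfolding Q r_def by (rule rad_alt_hadamard_le[OF m(1) n \<alpha> \<Psi>])
  also have "\<dots> = (\<Prod>j=1..m. r 1 powr \<alpha>)"
    by (intro prod.cong refl arg_cong2[where f = "(powr)"] r)
  also have "\<dots> = (r 1 powr \<alpha>) ^ m" by simp
  finally have "rad (set_hadamard m (\<lambda>_. \<alpha>) Q) powr (1 / (2 * real m)) \<le> ((r 1 powr \<alpha>) ^ m) powr (1 / (2 * real m))"
    unfolding Q using limsup_eq_rad(2)[OF alt_hadamard_pos[OF m(1) n \<alpha> \<Psi>]] by (intro powr_mono2) auto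
  also have "\<dots> = r 1 powr (\<alpha> / 2)"
    by (rule powr_powr_root[OF r0 m(1)])
  also have "r 1 = rad (set_prod R (alternating odd (\<lambda>i. cyclic_index m (1 + i)) \<Psi> (2 * m)))"
  proof -
    \<comment> \<open>The product on the right starts without a star. Rotation by the odd number m
      exchanges the star pattern and returns the indices to where they were.\<close>
    have "alternating odd (\<lambda>i. cyclic_index m (1 + i)) \<Psi> (2 * m) =
        alternating odd (\<lambda>i. cyclic_index m (1 + m + i)) \<Psi> (2 * m)"
      by (rule alternating_shift_period[symmetric]) simp
    also have "\<dots> = rotate m (starred_from m (2 * m) \<Psi> 1)"
      unfolding starred_from_def using m n by (intro alternating_rotate_odd) auto
    finally show ?thesis by (simp add: rad_rotate pos r_def)
  qed
  finally show "rad (set_hadamard m (\<lambda>_. \<alpha>) Q) powr (1 / (2 * real m))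
      \<le> rad (set_prod R (alternating odd (\<lambda>i. cyclic_index m (1 + i)) \<Psi> (2 * m))) powr (\<alpha> / 2)" .
qed

end

theorem theorem3p3:
  fixes R :: "nat set" and m :: nat and \<Psi> :: "nat \<Rightarrow> matrix set" and \<alpha> :: real
    and r :: "matrix set \<Rightarrow> real"
  assumes R: "R = {1..} \<or> (\<exists>N\<ge>1. R = {1..N})"
    and m: "m \<ge> 1"
    and matrices: "\<And>j A. j \<in> {1..m} \<Longrightarrow> A \<in> \<Psi> j \<Longrightarrow> nonneg_matrix R A \<and> defines_operator R A"
    and bounded: "\<And>j. j \<in> {1..m} \<Longrightarrow> bounded_matrices R (\<Psi> j)"
    and \<alpha>: "\<alpha> \<ge> 1 / real m"
    and r: "r \<in> {gen_spectral_radius R, joint_spectral_radius R}"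
  shows
    "(even m \<longrightarrow>
       (let P = (\<lambda>j. set_prod R (alternating even (\<lambda>i. cyclic_index m (j + i)) \<Psi> m));
            \<Sigma>\<^sub>\<alpha> = set_hadamard m (\<lambda>_. \<alpha>) P
        in set_norm R (set_hadamard m (\<lambda>_. \<alpha>) \<Psi>) \<le> r \<Sigma>\<^sub>\<alpha> powr (1 / real m) \<and>
           r \<Sigma>\<^sub>\<alpha> powr (1 / real m)
             \<le> (r (set_prod R (alternating even (\<lambda>i. 1 + i) \<Psi> m)) *
                 r (set_prod R (alternating odd (\<lambda>i. m - i) \<Psi> m))) powr (\<alpha> / 2))) \<and>
     (odd m \<longrightarrow>
       (let Q = (\<lambda>j. set_prod R (alternating even (\<lambda>i. cyclic_index m (j + i)) \<Psi> (2 * m)));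
            \<Omega>\<^sub>\<alpha> = set_hadamard m (\<lambda>_. \<alpha>) Q
        in set_norm R (set_hadamard m (\<lambda>_. \<alpha>) \<Psi>) \<le> r \<Omega>\<^sub>\<alpha> powr (1 / (2 * real m)) \<and>
           r \<Omega>\<^sub>\<alpha> powr (1 / (2 * real m))
             \<le> r (set_prod R (alternating odd (\<lambda>i. cyclic_index m (1 + i)) \<Psi> (2 * m)))
                 powr (\<alpha> / 2)))"
proof -
  have ne: "R \<noteq> {}" using R by auto
  have \<Psi>: "pos_set R (\<Psi> j)" if "j \<in> {1..m}" for j
    using matrices[OF that] bounded[OF that] by (auto simp: pos_set_def pos_op_def)
  \<comment> \<open>The agreement of r with the upper limit is claimed only for bounded sets of
    positive operators: for the joint spectral radius it rests on convergence.\<close>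
  obtain f where f: "spectral_size R f" "\<And>\<Sigma>. pos_set R \<Sigma> \<Longrightarrow> r \<Sigma> = limsup_radius R f \<Sigma>"
  proof (cases "r = gen_spectral_radius R")
    case True
    then show thesis using that rho_spectral_size[OF ne] by (simp add: gen_spectral_radius_eq)
  next
    case False
    then have "r = joint_spectral_radius R" using r by blast
    then show thesis using that norm_spectral_size[OF ne] joint_spectral_radius_eq by blast
  qed
  interpret spectral_size R f by (rule f(1))
  have pos: "pos_set R (set_prod R (alternating star idx \<Psi> n))" if "\<And>i. i < n \<Longrightarrow> idx i \<in> {1..m}" for star idx n
    using that by (intro pos_set_prod) (auto simp: alternating_def intro!: pos_set_adjoint \<Psi>)
  note cyc = cyclic_index_in[OF m]
  have posH: "pos_set R (set_hadamard m (\<lambda>_. \<alpha>) (\<lambda>j. set_prod R (alternating even (\<lambda>i. cyclic_index m (j + i)) \<Psi> n)))" for n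
    by (intro pos_set_hadamard m \<alpha> pos cyc)
  show ?thesis
    unfolding Let_def f(2)[OF posH]
  proof (intro conjI impI)
    assume "even m"
    note * = hadamard_bounds_even[OF m this \<alpha> \<Psi>]
    show "set_norm R (set_hadamard m (\<lambda>_. \<alpha>) \<Psi>) \<le> rad (set_hadamard m (\<lambda>_. \<alpha>)
        (\<lambda>j. set_prod R (alternating even (\<lambda>i. cyclic_index m (j + i)) \<Psi> m))) powr (1 / real m)"
      by (rule *(1))
    have "r (set_prod R (alternating even (\<lambda>i. 1 + i) \<Psi> m)) = rad (set_prod R (alternating even (\<lambda>i. 1 + i) \<Psi> m))"
      "r (set_prod R (alternating odd (\<lambda>i. m - i) \<Psi> m)) = rad (set_prod R (alternating odd (\<lambda>i. m - i) \<Psi> m))"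
      by (auto intro!: f(2) pos)
    then show "rad (set_hadamard m (\<lambda>_. \<alpha>)
        (\<lambda>j. set_prod R (alternating even (\<lambda>i. cyclic_index m (j + i)) \<Psi> m))) powr (1 / real m)
      \<le> (r (set_prod R (alternating even (\<lambda>i. 1 + i) \<Psi> m)) *
          r (set_prod R (alternating odd (\<lambda>i. m - i) \<Psi> m))) powr (\<alpha> / 2)"
      by (simp only:) (rule *(2))
  next
    assume "odd m"
    note * = hadamard_bounds_odd[OF m this \<alpha> \<Psi>]
    show "set_norm R (set_hadamard m (\<lambda>_. \<alpha>) \<Psi>) \<le> rad (set_hadamard m (\<lambda>_. \<alpha>)
        (\<lambda>j. set_prod R (alternating even (\<lambda>i. cyclic_index m (j + i)) \<Psi> (2 * m)))) powr (1 / (2 * real m))"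
      by (rule *(1))
    have "r (set_prod R (alternating odd (\<lambda>i. cyclic_index m (1 + i)) \<Psi> (2 * m))) =
        rad (set_prod R (alternating odd (\<lambda>i. cyclic_index m (1 + i)) \<Psi> (2 * m)))"
      by (intro f(2) pos cyc)
    then show "rad (set_hadamard m (\<lambda>_. \<alpha>)
        (\<lambda>j. set_prod R (alternating even (\<lambda>i. cyclic_index m (j + i)) \<Psi> (2 * m)))) powr (1 / (2 * real m))
      \<le> r (set_prod R (alternating odd (\<lambda>i. cyclic_index m (1 + i)) \<Psi> (2 * m))) powr (\<alpha> / 2)"
      by (simp only:) (rule *(2))
  qed
qed

end
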